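(* Consider the interacting particle system $\bm{\widetilde X}=(\widetilde X^1,\ldots,\widetilde X^n)$ of the context with $p=1$, so that there is $\widetilde L<\infty$ with $|\widetilde b(t,x,m)-\widetilde b(t,x',m')|\le\widetilde L(|x-x'|+\mathcal W_1(m,m'))$ for all $t,x,x',m,m'$. Assume also that there exists $\kappa_0<\infty$ such that $$\mathcal W_1(\widetilde\mu_0,\nu)\le\sqrt{2\kappa_0\,\mathcal R(\nu|\widetilde\mu_0)}\qquad\text{for all }\nu\ll\widetilde\mu_0.$$ Then there exists a constant $\delta>0$, independent of $n$, such that for every $a>0$ and every $\Phi:(\mathcal C^d)^n\to\mathbb R$ that is $1$-Lipschitz with respect to $\|\bm x\|_{n,1}=\sum_{i=1}^n\|x^i\|_\infty$, we have $$\mathbb P\big(\Phi(\bm{\widetilde X})-\mathbb E\,\Phi(\bm{\widetilde X})>a\big)\le2\exp(-\delta a^2/n).$$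
   Context: $\mathcal C^d=C([0,T];\mathbb R^d)$ carries the sup norm $\|x\|_\infty=\sup_{t\in[0,T]}|x_t|$, $|\cdot|$ Euclidean. $\mathcal P^p(\mathbb R^d)$ is the set of Borel probability measures on $\mathbb R^d$ with finite $p$-th moment, with the $p$-Wasserstein distance $\mathcal W_p$ (associated to the Euclidean norm). For $\bm x\in(\mathbb R^d)^n$, $m^n_{\bm x}=\frac1n\sum_{i=1}^n\delta_{x_i}$. Relative entropy: $\mathcal R(\nu|\mu)=\int\frac{d\nu}{d\mu}\log\frac{d\nu}{d\mu}d\mu$ if $\nu\ll\mu$, $\infty$ otherwise. **Particle system.** Let $T\in(0,\infty)$, $B^1,\ldots,B^n$ i.i.d. standard $d$-dimensional Wiener processes, $\sigma\in\mathbb R^{d\times d}$, $p\in[1,2]$, and $\widetilde b:[0,T]\times\mathbb R^d\times\mathcal P^p(\mathbb R^d)\to\mathbb R^d$ jointly measurable, Lipschitz in $(x,m)$ uniformly in $t$ (Lipschitz in $m$ for $\mathcal W_p$, constant $\widetilde L$), with $\sup_{t\in[0,T]}|\widetilde b(t,0,\delta_0)|<\infty$. The system is the unique strong solution of $$d\widetilde X^i_t=\widetilde b(t,\widetilde X^i_t,m^n_{\bm{\widetilde X}_t})dt+\sigma dB^i_t,\quad i=1,\ldots,n,$$ with initial states $\widetilde X^1_0,\ldots,\widetilde X^n_0$ i.i.d. (and independent of $B^1,\ldots,B^n$) with law $\widetilde\mu_0$ satisfying $\mathbb E|\widetilde X^1_0|^2<\infty$. The data $d,T,\sigma,\widetilde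 b,\widetilde\mu_0$ do not depend on $n$. *)

theory Defs
  imports "HOL-Probability.Probability"
begin

definition finite_mean_measures :: "'a::euclidean_space measure set" where
  "finite_mean_measures =
     {m. prob_space m \<and> sets m = sets borel \<and> integrable m (\<lambda>x. norm x)}"

definition couplings ::
    "'a::euclidean_space measure \<Rightarrow> 'a measure \<Rightarrow> ('a \<times> 'a) measure set" where
  "couplings m m' =
     {\<pi>. sets \<pi> = sets (borel \<Otimes>\<^sub>M borel) \<and> distr \<pi> borel fst = m \<and> distr \<pi> borel snd = m'}"

text \<open>The value is extended: it is finite on \<^const>\<open>finite_mean_measures\<close>, and \<open>\<infinity>\<close> when exactly
  one of the two probability measures has a finite first moment.\<close>

definition wasserstein1 :: "'a::euclidean_space measure \<Rightarrow> 'a measure \<Rightarrow> ennreal" where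
  "wasserstein1 m m' = (INF \<pi>\<in>couplings m m'. \<integral>\<^sup>+ z. ennreal (dist (fst z) (snd z)) \<partial>\<pi>)"

definition wasserstein1_borel :: "'a::euclidean_space measure measure" where
  "wasserstein1_borel = sigma finite_mean_measures
     {U. U \<subseteq> finite_mean_measures \<and>
         (\<forall>m\<in>U. \<exists>\<epsilon>>0. \<forall>m'\<in>finite_mean_measures. wasserstein1 m m' < ennreal \<epsilon> \<longrightarrow> m' \<in> U)}"

text \<open>\<open>\<R>(\<nu>|\<mu>)\<close> for probability measures. As \<open>u ln u \<ge> - 1 / e\<close>, the integral always exists in
  \<open>(-\<infinity>, \<infinity>]\<close>, and it is \<open>\<infinity>\<close> exactly when the integrand is not integrable; it is nonnegative by
  Jensen, so that \<^const>\<open>ennreal\<close> does not truncate.\<close>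

definition relative_entropy :: "'a measure \<Rightarrow> 'a measure \<Rightarrow> ennreal" where
  "relative_entropy \<nu> \<mu> =
     (let f = (\<lambda>x. enn2real (RN_deriv \<mu> \<nu> x)) in
      if absolutely_continuous \<mu> \<nu> \<and> integrable \<mu> (\<lambda>x. f x * ln (f x))
      then ennreal (\<integral>x. f x * ln (f x) \<partial>\<mu>) else \<infinity>)"

definition ennreal_sqrt :: "ennreal \<Rightarrow> ennreal" where
  "ennreal_sqrt u = (if u = \<infinity> then \<infinity> else ennreal (sqrt (enn2real u)))"

definition empirical_measure :: "nat \<Rightarrow> (nat \<Rightarrow> 'a::euclidean_space) \<Rightarrow> 'a measure" where
  "empirical_measure n x = distr (uniform_count_measure {..<n}) borel x"

lemma emeasure_empirical_measure:
  assumes "n \<ge> 1" and A: "A \<in> sets borel"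
  shows "emeasure (empirical_measure n x) A = (1 / of_nat n) * (\<Sum>i<n. emeasure (return borel (x i)) A)"
proof -
  have "emeasure (empirical_measure n x) A = ennreal (card {i. i < n \<and> x i \<in> A} / n)"
    using A assms(1) unfolding empirical_measure_def
    by (subst emeasure_distr)
       (auto simp: emeasure_uniform_count_measure space_uniform_count_measure
          measurable_def sets_uniform_count_measure intro!: arg_cong[where f=card])
  also have "\<dots> = (1 / of_nat n) * of_nat (card {i. i < n \<and> x i \<in> A})"
    using assms(1) by (simp add: ennreal_of_nat_eq_real_of_nat ennreal_mult'[symmetric]
        divide_ennreal flip: ennreal_1)
  also have "of_nat (card {i. i < n \<and> x i \<in> A}) = (\<Sum>i<n. emeasure (return borel (x i)) A)"
    using A by (simp add: indicator_def sum.If_cases Int_def)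
  finally show ?thesis .
qed

text \<open>The product density of \<open>W\<^sub>t - W\<^sub>s\<close> is that of the centred Gaussian on \<open>\<real>\<^sup>d\<close> with covariance
  \<open>(t - s) I\<close>.\<close>

definition (in prob_space) standard_wiener ::
    "real \<Rightarrow> (real \<Rightarrow> 'a \<Rightarrow> real ^ 'd::finite) \<Rightarrow> bool" where
  "standard_wiener T W \<longleftrightarrow>
     (\<forall>t\<in>{0..T}. W t \<in> borel_measurable M) \<and>
     (AE \<omega> in M. W 0 \<omega> = 0) \<and>
     (AE \<omega> in M. continuous_on {0..T} (\<lambda>t. W t \<omega>)) \<and>
     (\<forall>s t. 0 \<le> s \<and> s < t \<and> t \<le> T \<longrightarrow>
        distributed M lborel (\<lambda>\<omega>. W t \<omega> - W s \<omega>)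
          (\<lambda>x. ennreal (\<Prod>k\<in>UNIV. normal_density 0 (sqrt (t - s)) (x $ k)))) \<and>
     (\<forall>(r :: nat \<Rightarrow> real) N. strict_mono_on {..N} r \<and> r ` {..N} \<subseteq> {0..T} \<longrightarrow>
        indep_vars (\<lambda>_. borel) (\<lambda>j \<omega>. W (r (Suc j)) \<omega> - W (r j) \<omega>) {..<N})"

definition preimages :: "'w set \<Rightarrow> 'i set \<Rightarrow> ('i \<Rightarrow> 'w \<Rightarrow> 'b::topological_space) \<Rightarrow> 'w set set" where
  "preimages \<Omega> I Z = (\<Union>i\<in>I. {Z i -` A \<inter> \<Omega> | A. A \<in> sets borel})"

definition augmented_filtration ::
    "'w measure \<Rightarrow> nat \<Rightarrow> (nat \<Rightarrow> 'w \<Rightarrow> real ^ 'd::finite) \<Rightarrow> (nat \<Rightarrow> real \<Rightarrow> 'w \<Rightarrow> real ^ 'd) \<Rightarrow>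
      real \<Rightarrow> 'w measure" where
  "augmented_filtration M n \<xi> B t = sigma (space M)
     (preimages (space M) {..<n} \<xi> \<union> preimages (space M) ({..<n} \<times> {0..t}) (\<lambda>(i, s). B i s) \<union>
      null_sets M)"

text \<open>The processes are indexed by \<open>i < n\<close>; only times in \<open>[0, T]\<close> matter.\<close>

definition (in prob_space) particle_noise ::
    "real \<Rightarrow> (real ^ 'd::finite) measure \<Rightarrow> nat \<Rightarrow> (nat \<Rightarrow> 'a \<Rightarrow> real ^ 'd) \<Rightarrow>
      (nat \<Rightarrow> real \<Rightarrow> 'a \<Rightarrow> real ^ 'd) \<Rightarrow> bool" where
  "particle_noise T \<mu>0 n \<xi> B \<longleftrightarrow>
     (\<forall>i<n. standard_wiener T (B i)) \<and>
     indep_vars (\<lambda>_. \<Pi>\<^sub>M t\<in>{0..T}. borel) (\<lambda>i \<omega>. \<lambda>t\<in>{0..T}. B i t \<omega>) {..<n} \<and>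
     (\<forall>i<n. distr M borel (\<xi> i) = \<mu>0) \<and>
     indep_vars (\<lambda>_. borel) \<xi> {..<n} \<and>
     indep_set (sigma_sets (space M) (preimages (space M) {..<n} \<xi>))
       (sigma_sets (space M) (preimages (space M) ({..<n} \<times> {0..T}) (\<lambda>(i, t). B i t)))"

definition strong_solution ::
    "'w measure \<Rightarrow> real \<Rightarrow> real ^ 'd ^ 'd::finite \<Rightarrow>
      (real \<Rightarrow> real ^ 'd \<Rightarrow> (real ^ 'd) measure \<Rightarrow> real ^ 'd) \<Rightarrow> nat \<Rightarrow>
      (nat \<Rightarrow> real \<Rightarrow> 'w \<Rightarrow> real ^ 'd) \<Rightarrow> (nat \<Rightarrow> real \<Rightarrow> 'w \<Rightarrow> real ^ 'd) \<Rightarrow> bool" where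
  "strong_solution M T \<sigma> b n B X \<longleftrightarrow>
     (\<forall>i<n. \<forall>\<omega>\<in>space M. continuous_on {0..T} (\<lambda>t. X i t \<omega>)) \<and>
     (\<forall>i<n. \<forall>t\<in>{0..T}.
        X i t \<in> borel_measurable (augmented_filtration M n (\<lambda>j. X j 0) B t)) \<and>
     (\<forall>i<n. AE \<omega> in M.
        set_integrable lborel {0..T}
          (\<lambda>s. b s (X i s \<omega>) (empirical_measure n (\<lambda>j. X j s \<omega>))) \<and>
        (\<forall>t\<in>{0..T}. X i t \<omega> =
           X i 0 \<omega> + (LINT s:{0..t}|lborel. b s (X i s \<omega>) (empirical_measure n (\<lambda>j. X j s \<omega>)))
             + \<sigma> *v B i t \<omega>))"

definition path_norm :: "real \<Rightarrow> (real \<Rightarrow> 'b::real_normed_vector) \<Rightarrow> real" where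
  "path_norm T x = (SUP t\<in>{0..T}. norm (x t))"

definition paths_norm1 :: "nat \<Rightarrow> real \<Rightarrow> (nat \<Rightarrow> real \<Rightarrow> 'b::real_normed_vector) \<Rightarrow> real" where
  "paths_norm1 n T x = (\<Sum>i<n. path_norm T (x i))"

text \<open>An \<open>n\<close>-tuple of paths in \<open>C([0, T])\<close> is represented by any family of functions whose first \<open>n\<close>
  members are continuous on \<open>[0, T]\<close>. Representatives of the same tuple are at distance \<open>0\<close>, so a
  Lipschitz functional takes the same value on them and is a function on \<open>C([0, T])\<^sup>n\<close>.\<close>

definition path_tuples :: "nat \<Rightarrow> real \<Rightarrow> (nat \<Rightarrow> real \<Rightarrow> 'b::real_normed_vector) set" where
  "path_tuples n T = {x. \<forall>i<n. continuous_on {0..T} (x i)}"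

definition lipschitz1_functional ::
    "nat \<Rightarrow> real \<Rightarrow> ((nat \<Rightarrow> real \<Rightarrow> 'b::real_normed_vector) \<Rightarrow> real) \<Rightarrow> bool" where
  "lipschitz1_functional n T \<Phi> \<longleftrightarrow>
     (\<forall>x\<in>path_tuples n T. \<forall>y\<in>path_tuples n T.
        \<bar>\<Phi> x - \<Phi> y\<bar> \<le> paths_norm1 n T (\<lambda>i t. x i t - y i t))"

end

theory Submission
  imports Defs
begin

text \<open>Gronwall's inequality shows that the particle paths depend on the driving paths
  \<open>X i 0 + \<sigma> B i\<close> in a Lipschitz way for the norm \<^const>\<open>paths_norm1\<close>, with a constant \<open>C\<close> that
  does not depend on \<open>n\<close>: the empirical measures satisfy
  \<open>W\<^sub>1(m\<^sub>x, m\<^sub>y) \<le> (1/n) \<Sum>\<^sub>i |x\<^sub>i - y\<^sub>i|\<close>, and summing the drifts over \<open>i\<close> cancels the factor \<open>1/n\<close>.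
  Hence \<open>\<Phi>(X)\<close> is a \<open>C\<close>-Lipschitz function of \<open>2 n\<close> independent variables, and integrating them
  out one at a time bounds its centred Laplace transform by \<open>exp (n K \<theta>\<^sup>2)\<close>, once a function of a
  single variable satisfies such a bound with \<open>n = 1\<close>. For an initial state this is the theorem of
  Bobkov and Goetze. For a Wiener path it suffices that the square of its maximum has an
  exponential moment, which Doob's inequality provides. The functional is evaluated along dyadic
  step functions, so that only finitely many values of the noise are involved before the limit.\<close>

section \<open>Sub-Gaussian functions\<close>

text \<open>The obstacle is that \<open>\<Phi>\<close> of the solution is given only as a function
  of the sample point, nothing is assumed about measurability on path space, and the integral
  equation holds only almost surely. Stability, applied to pairs of sample points outside a null
  set, shows that the value is determined by the driving paths and is Lipschitz in them. McShane's
  extension turns it into a functional \<open>F\<close> on tuples of bounded functions, continuous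
  or not, so that Fubini arguments become available. The two kinds of coordinates are charged
  differently. In an initial state the functional is Lipschitz; exchanging a Wiener path
  \<open>u\<close> for \<open>u'\<close> is charged with the sum of their maxima rather than with
  their distance. This cruder charge asks only for a square-exponential moment, at the price of a
  constant that grows with the dimension. The grids are dyadic because nested grids have increasing
  maxima, so one integrable function dominates all levels. With \<open>C\<close> the stability
  constant and \<open>A\<close> a bound for \<open>\<sigma>\<close>, the rate is
  \<open>1 / (4 * K)\<close> for \<open>K = \<kappa>0 * C\<^sup>2 / 2 + 128 * sqrt 2 ^ CARD('d) * T
  * (C * A)\<^sup>2\<close>.\<close>

definition sub_gaussian :: "'a measure \<Rightarrow> ('a \<Rightarrow> real) \<Rightarrow> real \<Rightarrow> bool" where
  "sub_gaussian M f K \<longleftrightarrow> integrable M f \<and>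
     (\<forall>\<theta>. (\<integral>\<^sup>+ x. ennreal (exp (\<theta> * (f x - (\<integral>y. f y \<partial>M)))) \<partial>M) \<le> ennreal (exp (K * \<theta>\<^sup>2)))"

lemma sub_gaussianD:
  assumes "sub_gaussian M f K"
  shows "integrable M f"
    and "(\<integral>\<^sup>+ x. ennreal (exp (\<theta> * (f x - (\<integral>y. f y \<partial>M)))) \<partial>M) \<le> ennreal (exp (K * \<theta>\<^sup>2))"
  using assms by (auto simp: sub_gaussian_def)

lemma sub_gaussian_distr_iff:
  assumes [measurable]: "g \<in> measurable M N" "f \<in> borel_measurable N"
  shows "sub_gaussian (distr M N g) f K \<longleftrightarrow> sub_gaussian M (\<lambda>x. f (g x)) K"
  unfolding sub_gaussian_def by (simp add: integrable_distr_eq integral_distr nn_integral_distr)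

text \<open>Fatou's lemma passes the exponential bound to the limit with the same constant, which is
  why \<open>sub_gaussian\<close> is phrased with the nonnegative integral. The dominating
  \<open>w\<close> serves the integrability of \<open>g\<close> and the convergence of the
  means.\<close>

lemma sub_gaussian_limit:
  fixes f :: "nat \<Rightarrow> 'a \<Rightarrow> real"
  assumes sg: "\<And>k. sub_gaussian M (f k) K"
    and meas [measurable]: "g \<in> borel_measurable M"
    and lim: "AE x in M. (\<lambda>k. f k x) \<longlonglongrightarrow> g x"
    and w: "integrable M w" and dom: "\<And>k. AE x in M. \<bar>f k x\<bar> \<le> w x"
  shows "sub_gaussian M g K"
  unfolding sub_gaussian_def
proof (intro conjI allI)
  have [measurable]: "f k \<in> borel_measurable M" for k using sub_gaussianD(1)[OF sg] by auto
  show "integrable M g"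
    by (rule integrable_dominated_convergence[OF meas _ w lim]) (use dom in auto)
  have Ef: "(\<lambda>k. \<integral>x. f k x \<partial>M) \<longlonglongrightarrow> (\<integral>x. g x \<partial>M)"
    by (rule integral_dominated_convergence[OF meas _ w lim]) (use dom in auto)
  fix \<theta> :: real
  have "(\<integral>\<^sup>+ x. ennreal (exp (\<theta> * (g x - (\<integral>y. g y \<partial>M)))) \<partial>M)
      = (\<integral>\<^sup>+ x. liminf (\<lambda>k. ennreal (exp (\<theta> * (f k x - (\<integral>y. f k y \<partial>M))))) \<partial>M)"
  proof (rule nn_integral_cong_AE, use lim in eventually_elim)
    fix x assume "(\<lambda>k. f k x) \<longlonglongrightarrow> g x"
    then have "(\<lambda>k. ennreal (exp (\<theta> * (f k x - (\<integral>y. f k y \<partial>M)))))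
        \<longlonglongrightarrow> ennreal (exp (\<theta> * (g x - (\<integral>y. g y \<partial>M))))"
      by (intro tendsto_intros tendsto_ennrealI Ef)
    then show "ennreal (exp (\<theta> * (g x - (\<integral>y. g y \<partial>M)))) =
        liminf (\<lambda>k. ennreal (exp (\<theta> * (f k x - (\<integral>y. f k y \<partial>M)))))"
      by (rule lim_imp_Liminf[OF sequentially_bot, symmetric])
  qed
  also have "\<dots> \<le> liminf (\<lambda>k. \<integral>\<^sup>+ x. ennreal (exp (\<theta> * (f k x - (\<integral>y. f k y \<partial>M)))) \<partial>M)"
    by (rule nn_integral_liminf) measurable
  also have "\<dots> \<le> liminf (\<lambda>k :: nat. ennreal (exp (K * \<theta>\<^sup>2)))"
    by (intro Liminf_mono always_eventually allI sub_gaussianD(2)[OF sg])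
  also have "\<dots> = ennreal (exp (K * \<theta>\<^sup>2))" by (simp add: Liminf_const)
  finally show "(\<integral>\<^sup>+ x. ennreal (exp (\<theta> * (g x - (\<integral>y. g y \<partial>M)))) \<partial>M) \<le> ennreal (exp (K * \<theta>\<^sup>2))" .
qed

lemma (in prob_space) sub_gaussian_tail:
  assumes sg: "sub_gaussian M f K" and "K > 0" "a > 0"
  shows "measure M {x \<in> space M. f x - (\<integral>y. f y \<partial>M) > a} \<le> exp (- a\<^sup>2 / (4 * K))"
proof -
  have [measurable]: "f \<in> borel_measurable M" using sub_gaussianD(1)[OF sg] by auto
  define m where "m = (\<integral>y. f y \<partial>M)"
  \<comment> \<open>This value minimises \<open>K * \<theta>\<^sup>2 - \<theta> * a\<close>.\<close>
  define \<theta> where "\<theta> = a / (2 * K)"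
  have \<theta>: "\<theta> > 0" using assms by (simp add: \<theta>_def)
  let ?A = "{x \<in> space M. f x - m > a}"
  have A: "?A \<in> sets M" by measurable
  have "ennreal (exp (\<theta> * a)) * emeasure M ?A = (\<integral>\<^sup>+ x. ennreal (exp (\<theta> * a)) * indicator ?A x \<partial>M)"
    using A by (simp add: nn_integral_cmult_indicator)
  also have "\<dots> \<le> (\<integral>\<^sup>+ x. ennreal (exp (\<theta> * (f x - m))) \<partial>M)"
    using \<theta> by (intro nn_integral_mono) (auto split: split_indicator intro!: ennreal_leI)
  also have "\<dots> \<le> ennreal (exp (K * \<theta>\<^sup>2))"
    unfolding m_def by (rule sub_gaussianD(2)[OF sg])
  finally have "exp (\<theta> * a) * prob ?A \<le> exp (K * \<theta>\<^sup>2)"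
    by (simp add: emeasure_eq_measure flip: ennreal_mult'')
  then have "prob ?A \<le> exp (K * \<theta>\<^sup>2) / exp (\<theta> * a)" by (simp add: field_simps)
  also have "\<dots> = exp (K * \<theta>\<^sup>2 - \<theta> * a)" by (simp add: exp_diff)
  also have "K * \<theta>\<^sup>2 - \<theta> * a = - a\<^sup>2 / (4 * K)"
    using \<open>K > 0\<close> by (simp add: \<theta>_def field_simps power2_eq_square)
  finally show ?thesis by (simp add: m_def)
qed

text \<open>Base case of the product argument: a product over no factors has a one-point space, on
  which every function is constant.\<close>

lemma (in prob_space) sub_gaussian_const:
  assumes "\<And>x. x \<in> space M \<Longrightarrow> f x = c" "K \<ge> 0"
  shows "sub_gaussian M f K"
proof -
  have "sub_gaussian M (\<lambda>x. c) K"
    using assms(2) by (simp add: sub_gaussian_def prob_space emeasure_space_1)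
  moreover have "integral\<^sup>L M f = integral\<^sup>L M (\<lambda>x. c)"
    using assms by (intro Bochner_Integration.integral_cong) auto
  moreover have "integrable M f \<longleftrightarrow> integrable M (\<lambda>x. c)"
    using assms by (intro Bochner_Integration.integrable_cong) auto
  moreover have "(\<integral>\<^sup>+ x. ennreal (exp (\<theta> * (f x - integral\<^sup>L M f))) \<partial>M)
      = (\<integral>\<^sup>+ x. ennreal (exp (\<theta> * (c - integral\<^sup>L M f))) \<partial>M)" for \<theta>
    using assms by (intro nn_integral_cong) auto
  ultimately show ?thesis unfolding sub_gaussian_def by simp
qed

section \<open>Tensorisation of sub-Gaussian bounds\<close>

lemma exp_abs_le: "exp \<bar>x\<bar> \<le> exp x + exp (- x :: real)"
  by (cases "x \<ge> 0") auto

text \<open>The bound depends on \<open>f\<close> only through \<open>K\<close>, so it is uniform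
  over the sections of a function of two variables; this is how joint integrability is reached in
  \<open>sub_gaussian_pair\<close>.\<close>

lemma sub_gaussian_abs_deviation:
  assumes "sub_gaussian M f K"
  shows "(\<integral>\<^sup>+ x. ennreal \<bar>f x - (\<integral>y. f y \<partial>M)\<bar> \<partial>M) \<le> 2 * ennreal (exp K)"
proof -
  have [measurable]: "f \<in> borel_measurable M" using sub_gaussianD(1)[OF assms] by auto
  let ?h = "\<lambda>x. f x - (\<integral>y. f y \<partial>M)"
  have t: "\<bar>t\<bar> \<le> exp t + exp (- t)" for t :: real
    using exp_abs_le[of t] exp_ge_add_one_self[of "\<bar>t\<bar>"] by linarith
  have "(\<integral>\<^sup>+ x. ennreal \<bar>?h x\<bar> \<partial>M) \<le> (\<integral>\<^sup>+ x. ennreal (exp (1 * ?h x)) + ennreal (exp (-1 * ?h x)) \<partial>M)"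
    by (intro nn_integral_mono) (simp flip: ennreal_plus, use t[of "?h _"] in \<open>force intro!: ennreal_leI\<close>)
  also have "\<dots> = (\<integral>\<^sup>+ x. ennreal (exp (1 * ?h x)) \<partial>M) + (\<integral>\<^sup>+ x. ennreal (exp (-1 * ?h x)) \<partial>M)"
    by (rule nn_integral_add) measurable
  also have "\<dots> \<le> ennreal (exp (K * 1\<^sup>2)) + ennreal (exp (K * (-1)\<^sup>2))"
    by (intro add_mono sub_gaussianD(2)[OF assms])
  finally show ?thesis by (simp add: mult_2)
qed

text \<open>With \<open>G\<close> the partial mean, \<open>F - m\<close> is \<open>F - G\<close>
  plus \<open>G - m\<close>. For fixed \<open>y\<close> the second term is constant and the first
  has Laplace transform at most \<open>exp (K1 * \<theta>\<^sup>2)\<close>, so the constants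
  add.\<close>

lemma sub_gaussian_pair:
  fixes F :: "'a \<times> 'b \<Rightarrow> real"
  assumes "prob_space N1" "prob_space N2"
    and F [measurable]: "F \<in> borel_measurable (N1 \<Otimes>\<^sub>M N2)"
    and inner: "\<And>y. y \<in> space N2 \<Longrightarrow> sub_gaussian N1 (\<lambda>x. F (x, y)) K1"
    and outer: "sub_gaussian N2 (\<lambda>y. \<integral>x. F (x, y) \<partial>N1) K2"
  shows "sub_gaussian (N1 \<Otimes>\<^sub>M N2) F (K1 + K2)"
proof -
  interpret N1: prob_space N1 by fact
  interpret N2: prob_space N2 by fact
  interpret pair_prob_space N1 N2 ..
  define G where "G = (\<lambda>y. \<integral>x. F (x, y) \<partial>N1)"
  have G [measurable]: "G \<in> borel_measurable N2" unfolding G_def by measurable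
  have intG: "integrable N2 G" using sub_gaussianD(1)[OF outer] by (simp add: G_def)
  have F': "(\<lambda>x. F (x, y)) \<in> borel_measurable N1" if "y \<in> space N2" for y
    using that by measurable
  \<comment> \<open>Integrability of each section does not give joint integrability. It comes from a
    bound on \<open>F - G\<close> uniform in \<open>y\<close>, combined with the integrability of
    \<open>G\<close>.\<close>
  have dev: "(\<integral>\<^sup>+ z. ennreal \<bar>F z - G (snd z)\<bar> \<partial>(N1 \<Otimes>\<^sub>M N2)) < \<infinity>"
  proof -
    have "(\<integral>\<^sup>+ z. ennreal \<bar>F z - G (snd z)\<bar> \<partial>(N1 \<Otimes>\<^sub>M N2))
        = (\<integral>\<^sup>+ y. (\<integral>\<^sup>+ x. ennreal \<bar>F (x, y) - G y\<bar> \<partial>N1) \<partial>N2)"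
      by (subst nn_integral_snd[symmetric]) auto
    also have "\<dots> \<le> (\<integral>\<^sup>+ y. 2 * ennreal (exp K1) \<partial>N2)"
      by (intro nn_integral_mono) (use sub_gaussian_abs_deviation[OF inner] in \<open>auto simp: G_def\<close>)
    also have "\<dots> < \<infinity>" by (simp add: N2.emeasure_space_1 ennreal_mult_less_top)
    finally show ?thesis .
  qed
  have intG': "integrable (N1 \<Otimes>\<^sub>M N2) (\<lambda>z. G (snd z))"
  proof (rule integrableI_bounded)
    have "(\<integral>\<^sup>+ z. ennreal (norm (G (snd z))) \<partial>(N1 \<Otimes>\<^sub>M N2)) = (\<integral>\<^sup>+ y. ennreal (norm (G y)) \<partial>N2)"
      by (subst nn_integral_snd[symmetric]) (auto simp: N1.emeasure_space_1)
    also have "\<dots> < \<infinity>" using intG by (simp add: integrable_iff_bounded)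
    finally show "(\<integral>\<^sup>+ z. ennreal (norm (G (snd z))) \<partial>(N1 \<Otimes>\<^sub>M N2)) < \<infinity>" .
  qed measurable
  have "integrable (N1 \<Otimes>\<^sub>M N2) (\<lambda>z. F z - G (snd z))"
    using dev by (intro integrableI_bounded) auto
  from Bochner_Integration.integrable_add[OF this intG']
  have intF: "integrable (N1 \<Otimes>\<^sub>M N2) F" by simp
  have EF: "integral\<^sup>L (N1 \<Otimes>\<^sub>M N2) F = integral\<^sup>L N2 G"
    using integral_snd[of "\<lambda>x y. F (x, y)"] intF unfolding G_def by (simp add: split_beta')
  define m where "m = integral\<^sup>L N2 G"
  show ?thesis
    unfolding sub_gaussian_def EF m_def[symmetric]
  proof (intro conjI allI intF)
    fix \<theta> :: real
    have "(\<integral>\<^sup>+ z. ennreal (exp (\<theta> * (F z - m))) \<partial>(N1 \<Otimes>\<^sub>M N2))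
        = (\<integral>\<^sup>+ y. (\<integral>\<^sup>+ x. ennreal (exp (\<theta> * (F (x, y) - m))) \<partial>N1) \<partial>N2)"
      by (subst nn_integral_snd[symmetric]) auto
    also have "\<dots> = (\<integral>\<^sup>+ y. ennreal (exp (\<theta> * (G y - m)))
        * (\<integral>\<^sup>+ x. ennreal (exp (\<theta> * (F (x, y) - G y))) \<partial>N1) \<partial>N2)"
      by (intro nn_integral_cong, subst nn_integral_cmult[symmetric])
         (auto simp flip: ennreal_mult exp_add simp: algebra_simps)
    also have "\<dots> \<le> (\<integral>\<^sup>+ y. ennreal (exp (\<theta> * (G y - m))) * ennreal (exp (K1 * \<theta>\<^sup>2)) \<partial>N2)"
      by (intro nn_integral_mono mult_left_mono) (use sub_gaussianD(2)[OF inner] in \<open>auto simp: G_def\<close>)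
    also have "\<dots> = (\<integral>\<^sup>+ y. ennreal (exp (\<theta> * (G y - m))) \<partial>N2) * ennreal (exp (K1 * \<theta>\<^sup>2))"
      by (rule nn_integral_multc) measurable
    also have "\<dots> \<le> ennreal (exp (K2 * \<theta>\<^sup>2)) * ennreal (exp (K1 * \<theta>\<^sup>2))"
      using sub_gaussianD(2)[OF outer, of \<theta>] by (intro mult_right_mono) (auto simp: m_def G_def)
    also have "\<dots> = ennreal (exp ((K1 + K2) * \<theta>\<^sup>2))"
      by (simp flip: ennreal_mult exp_add add: algebra_simps)
    finally show "(\<integral>\<^sup>+ z. ennreal (exp (\<theta> * (F z - m))) \<partial>(N1 \<Otimes>\<^sub>M N2)) \<le> ennreal (exp ((K1 + K2) * \<theta>\<^sup>2))" .
  qed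
qed

lemma (in prob_space) integral_diff_le:
  fixes f g :: "'a \<Rightarrow> real"
  assumes "integrable M f" "integrable M g" "\<And>x. x \<in> space M \<Longrightarrow> \<bar>f x - g x\<bar> \<le> e"
  shows "\<bar>(\<integral>x. f x \<partial>M) - (\<integral>x. g x \<partial>M)\<bar> \<le> e"
proof -
  have "\<bar>(\<integral>x. f x \<partial>M) - (\<integral>x. g x \<partial>M)\<bar> = \<bar>\<integral>x. f x - g x \<partial>M\<bar>"
    using assms by simp
  also have "\<dots> \<le> (\<integral>x. \<bar>f x - g x\<bar> \<partial>M)" by (rule integral_abs_bound)
  also have "\<dots> \<le> (\<integral>x. e \<partial>M)" using assms by (intro integral_mono) auto
  finally show ?thesis by (simp add: prob_space)
qed

text \<open>The modulus \<open>e i\<close> is arbitrary because it will be a multiple of the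
  distance for initial states and a sum of maxima for Wiener paths. The hypothesis
  \<open>single\<close> ranges over all functions with that modulus, since the induction meets
  sections of partial means as well as of \<open>F\<close>.\<close>

lemma sub_gaussian_PiM:
  fixes N :: "'i \<Rightarrow> 'a measure" and F :: "('i \<Rightarrow> 'a) \<Rightarrow> real"
  assumes "finite I" and prob: "\<And>i. i \<in> I \<Longrightarrow> prob_space (N i)"
    and single: "\<And>i f. i \<in> I \<Longrightarrow> f \<in> borel_measurable (N i) \<Longrightarrow>
      (\<And>u u'. u \<in> space (N i) \<Longrightarrow> u' \<in> space (N i) \<Longrightarrow> \<bar>f u - f u'\<bar> \<le> e i u u') \<Longrightarrow>
      sub_gaussian (N i) f (K i)"
    and F: "F \<in> borel_measurable (PiM I N)"
    and osc: "\<And>z i u u'. z \<in> space (PiM I N) \<Longrightarrow> i \<in> I \<Longrightarrow> u \<in> space (N i) \<Longrightarrow> u' \<in> space (N i) \<Longrightarrow>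
      \<bar>F (z(i := u)) - F (z(i := u'))\<bar> \<le> e i u u'"
  shows "sub_gaussian (PiM I N) F (\<Sum>i\<in>I. K i)"
  using \<open>finite I\<close> prob single F osc
proof (induction I arbitrary: F)
  case empty
  then show ?case by (intro prob_space.sub_gaussian_const[where c="F (\<lambda>_. undefined)"] prob_space_PiM)
      (auto simp: space_PiM)
next
  case (insert i I)
  note [measurable] = insert.prems(3)
  interpret i: prob_space "N i" using insert.prems by auto
  interpret I: prob_space "PiM I N" by (intro prob_space_PiM insert.prems) auto
  have upd: "(\<lambda>(x, X). X(i := x)) \<in> measurable (N i \<Otimes>\<^sub>M PiM I N) (PiM (insert i I) N)"
    by measurable
  have F2: "(\<lambda>z. F ((snd z)(i := fst z))) \<in> borel_measurable (N i \<Otimes>\<^sub>M PiM I N)"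
    by measurable
  have sp: "X(i := u) \<in> space (PiM (insert i I) N)" if "X \<in> space (PiM I N)" "u \<in> space (N i)" for X u
    using that by (auto simp: space_PiM PiE_iff extensional_def)
  have inner: "sub_gaussian (N i) (\<lambda>u. F (X(i := u))) (K i)" if "X \<in> space (PiM I N)" for X
  proof (rule insert.prems(2))
    show "(\<lambda>u. F (X(i := u))) \<in> borel_measurable (N i)"
      using that by measurable
    show "\<bar>F (X(i := u)) - F (X(i := u'))\<bar> \<le> e i u u'" if "u \<in> space (N i)" "u' \<in> space (N i)" for u u'
      using insert.prems(4)[OF sp[OF \<open>X \<in> _\<close> that(1)] insertI1 that] by (simp only: fun_upd_upd)
  qed simp
  define G where "G = (\<lambda>X. \<integral>u. F (X(i := u)) \<partial>N i)"
  \<comment> \<open>Averaging over coordinate \<open>i\<close> preserves the modulus in every other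
    coordinate.\<close>
  have "sub_gaussian (PiM I N) G (\<Sum>i\<in>I. K i)"
  proof (rule insert.IH)
    show "G \<in> borel_measurable (PiM I N)" unfolding G_def by measurable
    fix z j u u' assume *: "z \<in> space (PiM I N)" "j \<in> I" "u \<in> space (N j)" "u' \<in> space (N j)"
    have sp': "z(j := v) \<in> space (PiM I N)" if "v \<in> space (N j)" for v
      using * that by (auto simp: space_PiM PiE_iff extensional_def)
    have ij: "i \<noteq> j" using * insert.hyps by auto
    have ints: "integrable (N i) (\<lambda>x. F ((z(j := v))(i := x)))" if "v \<in> space (N j)" for v
      using sub_gaussianD(1)[OF inner[OF sp'[OF that]]] .
    show "\<bar>G (z(j := u)) - G (z(j := u'))\<bar> \<le> e j u u'"
      unfolding G_def
    proof (rule i.integral_diff_le[OF ints[OF *(3)] ints[OF *(4)]])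
      fix x assume "x \<in> space (N i)"
      then show "\<bar>F ((z(j := u))(i := x)) - F ((z(j := u'))(i := x))\<bar> \<le> e j u u'"
        using insert.prems(4)[OF sp[OF *(1)] insertI2[OF *(2)] *(3,4), of x]
        by (simp only: fun_upd_twist[OF ij])
    qed
  qed (use insert.prems in auto)
  then have "sub_gaussian (N i \<Otimes>\<^sub>M PiM I N) (\<lambda>z. F ((snd z)(i := fst z))) (K i + (\<Sum>i\<in>I. K i))"
    using inner by (intro sub_gaussian_pair F2) (auto simp: G_def intro: i.prob_space_axioms I.prob_space_axioms)
  then have "sub_gaussian (N i \<Otimes>\<^sub>M PiM I N) (\<lambda>z. F ((\<lambda>(x, X). X(i := x)) z)) (\<Sum>i\<in>insert i I. K i)"
    using insert.hyps by (simp add: split_beta')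
  then show ?case
    using sub_gaussian_distr_iff[OF upd insert.prems(3)] distr_pair_PiM_eq_PiM[of I N i] insert.prems(1)
    by auto
qed

section \<open>From square-exponential moments to sub-Gaussian bounds\<close>

lemma exp_le_add_exp_square: "exp x \<le> x + exp (x\<^sup>2)" for x :: real
proof -
  consider "x \<ge> 1" | "0 \<le> x" "x \<le> 1" | "-1 \<le> x" "x \<le> 0" | "x \<le> -1" by linarith
  then show ?thesis
  proof cases
    case 1
    then have "x \<le> x\<^sup>2" by (simp add: power2_eq_square)
    with 1 show ?thesis by (smt (verit) exp_le_cancel_iff)
  next
    case 2
    then have "exp x \<le> 1 + x + x\<^sup>2" by (rule exp_bound)
    then show ?thesis using exp_ge_add_one_self[of "x\<^sup>2"] by linarith
  next
    case 3
    have "exp x * (1 - x) \<le> exp x * exp (- x)"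
      using exp_ge_add_one_self[of "-x"] by (intro mult_left_mono) auto
    then have "exp x * (1 - x) \<le> 1" by (simp flip: exp_add)
    \<comment> \<open>The right-hand side is \<open>1 - x ^ 3\<close>, and \<open>x\<close> is not
      positive.\<close>
    also have "1 \<le> (1 + x + x\<^sup>2) * (1 - x)"
      using 3 mult_nonpos_nonneg[of x "x * x"] by (simp add: algebra_simps power2_eq_square)
    finally have "exp x \<le> 1 + x + x\<^sup>2" using 3 by (simp add: mult_le_cancel_right)
    then show ?thesis using exp_ge_add_one_self[of "x\<^sup>2"] by linarith
  next
    case 4
    have "(- x) * 1 \<le> (-x) * (-x)" using 4 by (intro mult_left_mono) auto
    then have "- x \<le> x\<^sup>2" by (simp add: power2_eq_square)
    moreover have "exp x \<le> 1" using 4 by simp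
    ultimately show ?thesis using exp_ge_add_one_self[of "x\<^sup>2"] by linarith
  qed
qed

text \<open>Convexity on the segment from \<open>0\<close> to \<open>z\<close>. With
  \<open>z = c * (D u)\<^sup>2\<close> it bounds a fractional power of an exponential by an affine
  function of it, whose expectation is known.\<close>

lemma exp_convex_interpolate:
  assumes "0 \<le> s" "s \<le> 1"
  shows "exp (s * z) \<le> 1 + s * (exp z - 1 :: real)"
proof -
  have "exp ((1 - s) *\<^sub>R 0 + s *\<^sub>R z) \<le> (1 - s) * exp 0 + s * exp z"
    by (rule convex_onD[OF exp_convex]) (use assms in auto)
  then show ?thesis by (simp add: algebra_simps)
qed

text \<open>For small \<open>\<theta>\<close> the linear term of the exponential has mean zero and
  the rest contributes an exponent of order \<open>\<theta>\<^sup>2\<close>. For large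
  \<open>\<theta>\<close> Young's inequality suffices, because multiplicative constants can then be
  absorbed into the exponent.\<close>

lemma (in prob_space) sub_gaussian_of_square_exponential:
  fixes D f :: "'a \<Rightarrow> real"
  assumes [measurable]: "f \<in> borel_measurable M" "D \<in> borel_measurable M"
    and D_nonneg: "\<And>u. u \<in> space M \<Longrightarrow> 0 \<le> D u" and "c > 0"
    and osc: "\<And>u u'. u \<in> space M \<Longrightarrow> u' \<in> space M \<Longrightarrow> \<bar>f u - f u'\<bar> \<le> D u + D u'"
    and m: "(\<integral>\<^sup>+ u. ennreal (exp (c * (D u)\<^sup>2)) \<partial>M) \<le> ennreal m"
  shows "sub_gaussian M f (4 * m / c)"
proof -
  let ?E = "\<lambda>u. exp (c * (D u)\<^sup>2)"
  have int_E: "integrable M ?E"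
  proof (rule integrableI_bounded)
    show "(\<integral>\<^sup>+ x. ennreal (norm (?E x)) \<partial>M) < \<infinity>"
      using m by (simp add: order_le_less_trans[OF m])
  qed measurable
  have "1 \<le> (\<integral>\<^sup>+ u. ennreal (exp (c * (D u)\<^sup>2)) \<partial>M)"
    using nn_integral_mono[of M "\<lambda>_. 1" "\<lambda>u. ennreal (?E u)"] \<open>c > 0\<close>
    by (simp add: emeasure_space_1)
  with m have m1: "1 \<le> m" by (metis ennreal_1 ennreal_le_iff2 order_trans not_one_le_zero ennreal_neg linorder_not_le order_less_imp_le)
  have Em: "(\<integral>u. ?E u \<partial>M) \<le> m"
    using m m1 by (subst (asm) nn_integral_eq_integral[OF int_E]) auto
  have cD: "c * (D u)\<^sup>2 \<le> ?E u - 1" for u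
    using exp_ge_add_one_self[of "c * (D u)\<^sup>2"] by linarith
  have int_D2: "integrable M (\<lambda>u. (D u)\<^sup>2)"
  proof (rule Bochner_Integration.integrable_bound[of M "\<lambda>u. ?E u / c"])
    show "AE u in M. norm ((D u)\<^sup>2) \<le> norm (?E u / c)"
      using cD \<open>c > 0\<close> by (intro AE_I2) (smt (verit, best) divide_right_mono nonzero_mult_div_cancel_left real_norm_def zero_le_power2)
  qed (use int_E in auto)
  have int_D: "integrable M D"
    by (rule square_integrable_imp_integrable[OF _ int_D2]) measurable
  define d where "d = expectation D"
  \<comment> \<open>Jensen's inequality for the square, followed by
    \<open>x \<le> exp x - 1\<close>, leads to \<open>c * d\<^sup>2 \<le> m - 1\<close>.\<close>
  have "0 \<le> variance D" by (rule variance_positive)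
  then have "d\<^sup>2 \<le> (\<integral>u. (D u)\<^sup>2 \<partial>M)"
    using variance_eq[OF int_D int_D2] by (simp add: d_def)
  then have "c * d\<^sup>2 \<le> c * (\<integral>u. (D u)\<^sup>2 \<partial>M)" using \<open>c > 0\<close> by simp
  also have "\<dots> = (\<integral>u. c * (D u)\<^sup>2 \<partial>M)" by simp
  also have "\<dots> \<le> (\<integral>u. ?E u - 1 \<partial>M)"
    using cD int_D2 int_E by (intro integral_mono) auto
  also have "\<dots> \<le> m - 1" using Em int_E by (simp add: prob_space)
  finally have cd: "c * d\<^sup>2 \<le> m - 1" .
  obtain u0 where u0: "u0 \<in> space M" using not_empty by auto
  have int_f: "integrable M f"
  proof (rule Bochner_Integration.integrable_bound[of M "\<lambda>u. \<bar>f u0\<bar> + D u0 + D u"])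
    show "AE u in M. norm (f u) \<le> norm (\<bar>f u0\<bar> + D u0 + D u)"
      using osc[OF _ u0] D_nonneg u0 by (intro AE_I2) (smt (verit) real_norm_def)
  qed (use int_D in auto)
  define h where "h = (\<lambda>u. f u - expectation f)"
  have [measurable]: "h \<in> borel_measurable M" unfolding h_def by measurable
  have int_h: "integrable M h" and Eh: "expectation h = 0"
    using int_f by (auto simp: h_def prob_space)
  have h: "\<bar>h u\<bar> \<le> D u + d" if u: "u \<in> space M" for u
  proof -
    \<comment> \<open>Centring by the mean amounts to comparison with an independent copy
      \<open>u'\<close>.\<close>
    have "h u = (\<integral>u'. f u - f u' \<partial>M)" using int_f by (simp add: h_def prob_space)
    then have "\<bar>h u\<bar> \<le> (\<integral>u'. \<bar>f u - f u'\<bar> \<partial>M)" by (simp add: integral_abs_bound)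
    also have "\<dots> \<le> (\<integral>u'. D u + D u' \<partial>M)"
      using int_f int_D osc[OF u] by (intro integral_mono) auto
    also have "\<dots> = D u + d" using int_D by (simp add: d_def prob_space)
    finally show ?thesis .
  qed
  show ?thesis
    unfolding sub_gaussian_def h_def[THEN fun_cong, symmetric]
  proof (intro conjI allI int_f)
    fix \<theta> :: real
    have h2: "(h u)\<^sup>2 \<le> 2 * (D u)\<^sup>2 + 2 * d\<^sup>2" if "u \<in> space M" for u
    proof -
      have "(h u)\<^sup>2 \<le> (D u + d)\<^sup>2" using h[OF that] by (metis abs_ge_zero power2_abs power_mono)
      also have "\<dots> \<le> 2 * (D u)\<^sup>2 + 2 * d\<^sup>2"
        using sum_squares_bound[of "D u" d] by (simp add: power2_sum)
      finally show ?thesis .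
    qed
    show "(\<integral>\<^sup>+ u. ennreal (exp (\<theta> * h u)) \<partial>M) \<le> ennreal (exp (4 * m / c * \<theta>\<^sup>2))"
    proof (cases "2 * \<theta>\<^sup>2 \<le> c")
      case True
      \<comment> \<open>The bound \<open>s \<le> 1\<close> is the case assumption; up to a constant,
        \<open>\<theta>\<^sup>2 * (h u)\<^sup>2\<close> is at most the fraction \<open>s\<close> of
        \<open>c * (D u)\<^sup>2\<close>.\<close>
      define s where "s = 2 * \<theta>\<^sup>2 / c"
      have s: "0 \<le> s" "s \<le> 1" using True \<open>c > 0\<close> by (auto simp: s_def)
      let ?R = "\<lambda>u. \<theta> * h u + exp (2 * \<theta>\<^sup>2 * d\<^sup>2) * (1 + s * (?E u - 1))"
      have R: "exp (\<theta> * h u) \<le> ?R u" if u: "u \<in> space M" for u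
      proof -
        \<comment> \<open>The first summand has mean zero, so only the square survives
          integration.\<close>
        have "exp (\<theta> * h u) \<le> \<theta> * h u + exp (\<theta>\<^sup>2 * (h u)\<^sup>2)"
          using exp_le_add_exp_square[of "\<theta> * h u"] by (simp add: power_mult_distrib)
        also have "\<theta>\<^sup>2 * (h u)\<^sup>2 \<le> \<theta>\<^sup>2 * (2 * (D u)\<^sup>2 + 2 * d\<^sup>2)"
          by (intro mult_left_mono h2 u) auto
        also have "\<dots> = 2 * \<theta>\<^sup>2 * d\<^sup>2 + s * (c * (D u)\<^sup>2)"
          using \<open>c > 0\<close> by (simp add: s_def algebra_simps)
        also have "exp (2 * \<theta>\<^sup>2 * d\<^sup>2 + s * (c * (D u)\<^sup>2)) \<le> exp (2 * \<theta>\<^sup>2 * d\<^sup>2) * (1 + s * (?E u - 1))"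
          unfolding exp_add by (intro mult_left_mono exp_convex_interpolate s) auto
        finally show ?thesis by simp
      qed
      have int_R: "integrable M ?R" using int_h int_E by auto
      have "(\<integral>\<^sup>+ u. ennreal (exp (\<theta> * h u)) \<partial>M) \<le> (\<integral>\<^sup>+ u. ennreal (?R u) \<partial>M)"
        using R by (intro nn_integral_mono ennreal_leI) auto
      also have "\<dots> = ennreal (\<integral>u. ?R u \<partial>M)"
      proof (rule nn_integral_eq_integral[OF int_R], rule AE_I2)
        show "0 \<le> ?R u" if "u \<in> space M" for u using R[OF that] exp_ge_zero order_trans by blast
      qed
      also have "(\<integral>u. ?R u \<partial>M) = exp (2 * \<theta>\<^sup>2 * d\<^sup>2) * (1 + s * (expectation ?E - 1))"
        using int_h int_E by (simp add: Eh prob_space)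
      also have "\<dots> \<le> exp (2 * \<theta>\<^sup>2 * d\<^sup>2) * exp (s * (m - 1))"
      proof (intro mult_left_mono)
        have "s * (expectation ?E - 1) \<le> s * (m - 1)" using s Em by (intro mult_left_mono) auto
        then show "1 + s * (expectation ?E - 1) \<le> exp (s * (m - 1))"
          using exp_ge_add_one_self[of "s * (m - 1)"] by linarith
      qed auto
      also have "\<dots> = exp (2 * \<theta>\<^sup>2 / c * (c * d\<^sup>2) + s * (m - 1))"
        using \<open>c > 0\<close> by (simp add: exp_add)
      also have "\<dots> \<le> exp (4 * m / c * \<theta>\<^sup>2)"
      proof -
        have "2 * \<theta>\<^sup>2 / c * (c * d\<^sup>2) \<le> 2 * \<theta>\<^sup>2 / c * (m - 1)"
          using cd \<open>c > 0\<close> by (intro mult_left_mono) auto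
        then have "2 * \<theta>\<^sup>2 / c * (c * d\<^sup>2) + s * (m - 1) \<le> 4 * \<theta>\<^sup>2 / c * (m - 1)"
          by (simp add: s_def)
        also have "\<dots> \<le> 4 * \<theta>\<^sup>2 / c * m" using \<open>c > 0\<close> by (intro mult_left_mono) auto
        also have "4 * \<theta>\<^sup>2 / c * m = 4 * m / c * \<theta>\<^sup>2" by simp
        finally show ?thesis by (simp only: exp_le_cancel_iff)
      qed
      finally show ?thesis by (simp add: ennreal_leI)
    next
      case False
      have q: "1 \<le> 2 * \<theta>\<^sup>2 / c" using False \<open>c > 0\<close> by simp
      have P: "exp (\<theta> * h u) \<le> exp (\<theta>\<^sup>2 / (2 * c) + c * d\<^sup>2) * ?E u" if u: "u \<in> space M" for u
      proof -
        \<comment> \<open>Young's inequality, from the square of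
          \<open>\<bar>\<theta>\<bar> - 2 * c * y\<close>.\<close>
        have y: "\<bar>\<theta>\<bar> * y \<le> \<theta>\<^sup>2 / (4 * c) + c * y\<^sup>2" for y
        proof -
          have "0 \<le> (\<bar>\<theta>\<bar> - 2 * c * y)\<^sup>2 / (4 * c)" using \<open>c > 0\<close> by simp
          then show ?thesis using \<open>c > 0\<close> by (simp add: power2_eq_square field_simps)
        qed
        have "\<theta> * h u \<le> \<bar>\<theta>\<bar> * \<bar>h u\<bar>" by (metis abs_ge_self abs_mult)
        also have "\<dots> \<le> \<bar>\<theta>\<bar> * (D u + d)" by (intro mult_left_mono h u) auto
        also have "\<dots> \<le> \<theta>\<^sup>2 / (2 * c) + c * d\<^sup>2 + c * (D u)\<^sup>2"
          using y[of "D u"] y[of d] by (simp add: algebra_simps)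
        finally show ?thesis by (simp flip: exp_add)
      qed
      have "(\<integral>\<^sup>+ u. ennreal (exp (\<theta> * h u)) \<partial>M)
          \<le> (\<integral>\<^sup>+ u. ennreal (exp (\<theta>\<^sup>2 / (2 * c) + c * d\<^sup>2)) * ennreal (?E u) \<partial>M)"
        using P by (intro nn_integral_mono) (simp add: ennreal_leI flip: ennreal_mult)
      also have "\<dots> \<le> ennreal (exp (\<theta>\<^sup>2 / (2 * c) + c * d\<^sup>2)) * ennreal m"
        by (subst nn_integral_cmult) (auto intro!: mult_left_mono m)
      also have "\<dots> = ennreal (exp (\<theta>\<^sup>2 / (2 * c) + c * d\<^sup>2) * m)"
        using m1 by (simp flip: ennreal_mult)
      also have "\<dots> \<le> ennreal (exp (4 * m / c * \<theta>\<^sup>2))"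
      proof (rule ennreal_leI)
        \<comment> \<open>The prefactor \<open>m\<close> moves into the exponent. Since
          \<open>2 * \<theta>\<^sup>2 / c\<close> is at least \<open>1\<close> here, the exponents
          without \<open>\<theta>\<close> may be multiplied by it.\<close>
        have "m \<le> exp (m - 1)" using exp_ge_add_one_self[of "m - 1"] by simp
        then have "exp (\<theta>\<^sup>2 / (2 * c) + c * d\<^sup>2) * m \<le> exp (\<theta>\<^sup>2 / (2 * c) + c * d\<^sup>2) * exp (m - 1)"
          by (intro mult_left_mono) auto
        also have "\<dots> \<le> exp (4 * m / c * \<theta>\<^sup>2)"
        proof -
          have "c * d\<^sup>2 + (m - 1) \<le> 1 * (2 * (m - 1))" using cd by simp
          also have "\<dots> \<le> 2 * \<theta>\<^sup>2 / c * (2 * (m - 1))" using q m1 by (intro mult_right_mono) auto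
          finally have "\<theta>\<^sup>2 / (2 * c) + c * d\<^sup>2 + (m - 1) \<le> \<theta>\<^sup>2 / (2 * c) + 2 * \<theta>\<^sup>2 / c * (2 * (m - 1))"
            by simp
          also have "\<dots> \<le> 4 * m / c * \<theta>\<^sup>2"
            using \<open>c > 0\<close> by (simp add: field_simps)
          finally show ?thesis by (simp flip: exp_add)
        qed
        finally show "exp (\<theta>\<^sup>2 / (2 * c) + c * d\<^sup>2) * m \<le> exp (4 * m / c * \<theta>\<^sup>2)" .
      qed
      finally show ?thesis .
    qed
  qed
qed

section \<open>Transport inequalities\<close>

lemma lipschitz_imp_borel_measurable:
  fixes f :: "'a::euclidean_space \<Rightarrow> real"
  assumes "\<And>x y. \<bar>f x - f y\<bar> \<le> C * dist x y" "0 \<le> C"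
  shows "f \<in> borel_measurable borel"
proof -
  have "C-lipschitz_on UNIV f"
    using assms by (intro lipschitz_onI) (auto simp: dist_real_def)
  then show ?thesis
    by (intro borel_measurable_continuous_onI lipschitz_on_continuous_on)
qed

text \<open>A Radon-Nikodym derivative is determined only almost everywhere, so both the
  integrability condition in \<open>relative_entropy\<close> and its value are transferred along an
  almost sure equality.\<close>

lemma relative_entropy_density:
  assumes "prob_space \<mu>" and [measurable]: "g \<in> borel_measurable \<mu>"
    and g: "\<And>x. 0 < g x" and "prob_space (density \<mu> (\<lambda>x. ennreal (g x)))"
    and int: "integrable \<mu> (\<lambda>x. g x * ln (g x))"
  shows "relative_entropy (density \<mu> (\<lambda>x. ennreal (g x))) \<mu> = ennreal (\<integral>x. g x * ln (g x) \<partial>\<mu>)"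
proof -
  interpret prob_space \<mu> by fact
  let ?\<nu> = "density \<mu> (\<lambda>x. ennreal (g x))"
  let ?f = "\<lambda>x. enn2real (RN_deriv \<mu> ?\<nu> x)"
  have ac: "absolutely_continuous \<mu> ?\<nu>" by (rule absolutely_continuousI_density) simp
  have ae: "AE x in \<mu>. ?f x * ln (?f x) = g x * ln (g x)"
    using RN_deriv_unique[of "\<lambda>x. ennreal (g x)" ?\<nu>, OF _ refl]
    by simp (use g in \<open>auto elim!: eventually_mono dest: sym simp: less_imp_le\<close>)
  have "integrable \<mu> (\<lambda>x. ?f x * ln (?f x)) \<longleftrightarrow> integrable \<mu> (\<lambda>x. g x * ln (g x))"
    by (rule integrable_cong_AE) (use ae in auto)
  moreover have "(\<integral>x. ?f x * ln (?f x) \<partial>\<mu>) = (\<integral>x. g x * ln (g x) \<partial>\<mu>)"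
    by (rule integral_cong_AE) (use ae in auto)
  ultimately show ?thesis
    using ac int by (simp add: relative_entropy_def Let_def)
qed

text \<open>The easy half of Kantorovich-Rubinstein duality: under any coupling the difference of
  the means is the mean of \<open>f (snd z) - f (fst z)\<close>, which is at most \<open>C\<close>
  times the cost.\<close>

lemma wasserstein1_dual_bound:
  fixes f :: "'a::euclidean_space \<Rightarrow> real"
  assumes lip: "\<And>x y. \<bar>f x - f y\<bar> \<le> C * dist x y" and "C > 0"
    and \<mu>: "prob_space \<mu>" "sets \<mu> = sets borel" and \<nu>: "prob_space \<nu>" "sets \<nu> = sets borel"
    and int: "integrable \<mu> f" "integrable \<nu> f"
  shows "ennreal (((\<integral>x. f x \<partial>\<nu>) - (\<integral>x. f x \<partial>\<mu>)) / C) \<le> wasserstein1 \<mu> \<nu>"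
  unfolding wasserstein1_def
proof (rule INF_greatest)
  fix \<pi> assume "\<pi> \<in> couplings \<mu> \<nu>"
  then have [measurable_cong]: "sets \<pi> = sets (borel \<Otimes>\<^sub>M borel)"
    and fst: "distr \<pi> borel fst = \<mu>" and snd: "distr \<pi> borel snd = \<nu>"
    by (auto simp: couplings_def)
  have f [measurable]: "f \<in> borel_measurable borel"
    using lip \<open>C > 0\<close> by (intro lipschitz_imp_borel_measurable[of f C]) auto
  have [measurable]: "fst \<in> measurable \<pi> borel" "snd \<in> measurable \<pi> borel" by measurable
  have i1: "integrable \<pi> (\<lambda>z. f (fst z))" and e1: "(\<integral>z. f (fst z) \<partial>\<pi>) = (\<integral>x. f x \<partial>\<mu>)"
    using int(1) by (auto simp: fst[symmetric] integrable_distr_eq integral_distr)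
  have i2: "integrable \<pi> (\<lambda>z. f (snd z))" and e2: "(\<integral>z. f (snd z) \<partial>\<pi>) = (\<integral>x. f x \<partial>\<nu>)"
    using int(2) by (auto simp: snd[symmetric] integrable_distr_eq integral_distr)
  have "ennreal (((\<integral>x. f x \<partial>\<nu>) - (\<integral>x. f x \<partial>\<mu>)) / C) = ennreal (\<integral>z. (f (snd z) - f (fst z)) / C \<partial>\<pi>)"
    using i1 i2 by (simp add: e1 e2)
  also have "\<dots> \<le> (\<integral>\<^sup>+ z. ennreal (norm ((f (snd z) - f (fst z)) / C)) \<partial>\<pi>)"
    using i1 i2 \<open>C > 0\<close>
    by (intro order_trans[OF ennreal_leI integral_norm_bound_ennreal]) (auto intro: divide_right_mono)
  also have "\<dots> \<le> (\<integral>\<^sup>+ z. ennreal (dist (fst z) (snd z)) \<partial>\<pi>)"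
    using lip[of "snd _" "fst _"] \<open>C > 0\<close>
    by (intro nn_integral_mono ennreal_leI) (simp add: field_simps dist_commute)
  finally show "ennreal (((\<integral>x. f x \<partial>\<nu>) - (\<integral>x. f x \<partial>\<mu>)) / C) \<le> (\<integral>\<^sup>+ z. ennreal (dist (fst z) (snd z)) \<partial>\<pi>)" .
qed

text \<open>The argument of Bobkov and Goetze: the transport inequality is applied to the measure with
  density proportional to \<open>exp f\<close>, whose entropy contains the logarithmic Laplace transform.\<close>

lemma transport_entropy_imp_exp_bound:
  fixes f :: "'a::euclidean_space \<Rightarrow> real"
  assumes \<mu>: "prob_space \<mu>" "sets \<mu> = sets borel" and "0 \<le> \<kappa>"
    and transport: "\<And>\<nu>. prob_space \<nu> \<Longrightarrow> sets \<nu> = sets borel \<Longrightarrow> absolutely_continuous \<mu> \<nu> \<Longrightarrow>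
      wasserstein1 \<mu> \<nu> \<le> ennreal_sqrt (2 * ennreal \<kappa> * relative_entropy \<nu> \<mu>)"
    and lip: "\<And>x y. \<bar>f x - f y\<bar> \<le> C * dist x y" and "C > 0"
    and bdd: "\<And>x. \<bar>f x\<bar> \<le> B"
  shows "(\<integral>\<^sup>+ x. ennreal (exp (f x - (\<integral>y. f y \<partial>\<mu>))) \<partial>\<mu>) \<le> ennreal (exp (\<kappa> * C\<^sup>2 / 2))"
proof -
  interpret prob_space \<mu> by fact
  note [measurable_cong] = \<mu>(2)
  have [measurable]: "f \<in> borel_measurable borel"
    using lip \<open>C > 0\<close> by (intro lipschitz_imp_borel_measurable[of f C]) auto
  have int_f: "integrable \<mu> f"
    by (rule integrable_const_bound[of _ B]) (use bdd in auto)
  have int_exp: "integrable \<mu> (\<lambda>x. exp (f x))"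
    by (rule integrable_const_bound[of _ "exp B"]) (use bdd in \<open>auto simp: abs_le_iff\<close>)
  have int_fexp: "integrable \<mu> (\<lambda>x. exp (f x) * f x)"
  proof (rule integrable_const_bound[of _ "exp B * B"])
    show "AE x in \<mu>. norm (exp (f x) * f x) \<le> exp B * B"
      using bdd by (intro AE_I2) (auto simp: abs_mult abs_le_iff intro!: mult_mono)
  qed measurable
  define Z where "Z = (\<integral>x. exp (f x) \<partial>\<mu>)"
  have "(\<integral>x. exp (- B) \<partial>\<mu>) \<le> Z"
    unfolding Z_def using bdd int_exp by (intro integral_mono) (auto simp: abs_le_iff minus_le_iff)
  then have Z: "Z > 0" using exp_gt_zero[of "- B"] by (simp add: prob_space del: exp_gt_zero)
  define g where "g = (\<lambda>x. exp (f x) / Z)"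
  have g: "0 < g x" and ln_g: "ln (g x) = f x - ln Z" for x
    using Z by (auto simp: g_def ln_div)
  have [measurable]: "g \<in> borel_measurable borel" unfolding g_def by measurable
  have int_g: "integrable \<mu> g" and Eg: "(\<integral>x. g x \<partial>\<mu>) = 1"
    using int_exp Z by (auto simp: g_def Z_def)
  define \<nu> where "\<nu> = density \<mu> (\<lambda>x. ennreal (g x))"
  have sets_\<nu>: "sets \<nu> = sets borel" using \<mu>(2) by (simp add: \<nu>_def)
  have "emeasure \<nu> (space \<nu>) = (\<integral>\<^sup>+ x. ennreal (g x) \<partial>\<mu>)"
    by (simp add: \<nu>_def emeasure_density cong: nn_integral_cong)
  also have "\<dots> = 1" using int_g g Eg by (subst nn_integral_eq_integral) (auto simp: less_imp_le)
  finally have \<nu>: "prob_space \<nu>" by (rule prob_spaceI)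
  have int_fg: "integrable \<mu> (\<lambda>x. g x * f x)"
    using int_fexp by (simp add: g_def)
  define a where "a = (\<integral>x. g x * f x \<partial>\<mu>)"
  have E\<nu>: "(\<integral>x. f x \<partial>\<nu>) = a" and int_f\<nu>: "integrable \<nu> f"
    using int_fg g unfolding \<nu>_def a_def
    by (simp_all add: integral_density integrable_density less_imp_le)
  define H where "H = (\<integral>x. g x * ln (g x) \<partial>\<mu>)"
  have gln: "g x * ln (g x) = g x * f x - ln Z * g x" for x by (simp add: ln_g algebra_simps)
  have int_H: "integrable \<mu> (\<lambda>x. g x * ln (g x))" unfolding gln using int_fg int_g by simp
  have H: "H = a - ln Z" unfolding H_def gln using int_fg int_g by (simp add: a_def Eg)
  \<comment> \<open>Nonnegativity of the entropy, by integrating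
    \<open>u - 1 \<le> u * ln u\<close>.\<close>
  have "0 = (\<integral>x. g x - 1 \<partial>\<mu>)" using int_g by (simp add: Eg prob_space)
  also have "\<dots> \<le> H" unfolding H_def
  proof (rule integral_mono)
    fix x
    have "- ln (g x) \<le> 1 / g x - 1"
      using ln_le_minus_one[of "1 / g x"] g[of x] by (simp add: ln_div)
    then have "g x * (- ln (g x)) \<le> g x * (1 / g x - 1)" using g[of x] by (intro mult_left_mono) auto
    then show "g x - 1 \<le> g x * ln (g x)" using g[of x] by (simp add: algebra_simps)
  qed (use int_g int_H in auto)
  finally have H0: "0 \<le> H" .
  have "ennreal ((a - (\<integral>x. f x \<partial>\<mu>)) / C) \<le> wasserstein1 \<mu> \<nu>"
    using wasserstein1_dual_bound[OF lip \<open>C > 0\<close> \<mu> \<nu> sets_\<nu> int_f int_f\<nu>] by (simp add: E\<nu>)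
  also have "\<dots> \<le> ennreal_sqrt (2 * ennreal \<kappa> * relative_entropy \<nu> \<mu>)"
    by (intro transport \<nu> sets_\<nu>) (simp add: \<nu>_def absolutely_continuousI_density)
  also have "relative_entropy \<nu> \<mu> = ennreal H"
    unfolding \<nu>_def H_def
    by (rule relative_entropy_density[OF \<mu>(1) _ g \<nu>[unfolded \<nu>_def] int_H]) measurable
  also have "2 * ennreal \<kappa> * ennreal H = ennreal (2 * \<kappa> * H)"
    using \<open>0 \<le> \<kappa>\<close> H0 by (simp add: ennreal_mult)
  also have "ennreal_sqrt \<dots> = ennreal (sqrt (2 * \<kappa> * H))"
    using \<open>0 \<le> \<kappa>\<close> H0 by (simp add: ennreal_sqrt_def)
  finally have "(a - (\<integral>x. f x \<partial>\<mu>)) / C \<le> sqrt (2 * \<kappa> * H)"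
    using \<open>0 \<le> \<kappa>\<close> H0 by (simp add: ennreal_le_iff)
  then have *: "a - (\<integral>x. f x \<partial>\<mu>) \<le> C * sqrt (2 * \<kappa> * H)"
    using \<open>C > 0\<close> by (simp add: field_simps)
  \<comment> \<open>The product is split so that the entropy appears with coefficient one. As
    \<open>H = a - ln Z\<close>, the tilted mean \<open>a\<close> then cancels and
    \<open>ln Z\<close> remains.\<close>
  have "C * sqrt (2 * \<kappa> * H) = (C * sqrt \<kappa>) * sqrt (2 * H)" by (simp add: real_sqrt_mult)
  also have "\<dots> \<le> ((C * sqrt \<kappa>)\<^sup>2 + (sqrt (2 * H))\<^sup>2) / 2"
    using sum_squares_bound[of "C * sqrt \<kappa>" "sqrt (2 * H)"] by simp
  also have "\<dots> = \<kappa> * C\<^sup>2 / 2 + H"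
    using \<open>0 \<le> \<kappa>\<close> H0 by (simp add: power_mult_distrib)
  finally have "ln Z - (\<integral>x. f x \<partial>\<mu>) \<le> \<kappa> * C\<^sup>2 / 2" using * H by simp
  moreover have "(\<integral>\<^sup>+ x. ennreal (exp (f x - (\<integral>y. f y \<partial>\<mu>))) \<partial>\<mu>) = ennreal (exp (ln Z - (\<integral>x. f x \<partial>\<mu>)))"
    using int_exp Z by (subst nn_integral_eq_integral) (auto simp: exp_diff Z_def)
  ultimately show ?thesis by (simp add: ennreal_leI)
qed

text \<open>Truncation keeps the Lipschitz constant and supplies the boundedness used for the tilted
  measure. Multiplying by \<open>\<theta>\<close> turns \<open>C\<close> into
  \<open>\<bar>\<theta>\<bar> * C\<close>, which makes the exponent quadratic in
  \<open>\<theta>\<close>.\<close>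

lemma transport_entropy_imp_sub_gaussian:
  fixes f :: "'a::euclidean_space \<Rightarrow> real"
  assumes \<mu>: "prob_space \<mu>" "sets \<mu> = sets borel" and "0 \<le> \<kappa>"
    and transport: "\<And>\<nu>. prob_space \<nu> \<Longrightarrow> sets \<nu> = sets borel \<Longrightarrow> absolutely_continuous \<mu> \<nu> \<Longrightarrow>
      wasserstein1 \<mu> \<nu> \<le> ennreal_sqrt (2 * ennreal \<kappa> * relative_entropy \<nu> \<mu>)"
    and moment: "integrable \<mu> (\<lambda>x. norm x)"
    and lip: "\<And>x y. \<bar>f x - f y\<bar> \<le> C * dist x y" and "C > 0"
  shows "sub_gaussian \<mu> f (\<kappa> * C\<^sup>2 / 2)"
proof (rule sub_gaussian_limit)
  interpret prob_space \<mu> by fact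
  note [measurable_cong] = \<mu>(2)
  have [measurable]: "f \<in> borel_measurable borel"
    using lip \<open>C > 0\<close> by (intro lipschitz_imp_borel_measurable[of f C]) auto
  show "f \<in> borel_measurable \<mu>" by measurable
  define F where "F = (\<lambda>(k::nat) x. max (- real k) (min (real k) (f x)))"
  have F_bdd: "\<bar>F k x\<bar> \<le> real k" for k x by (auto simp: F_def)
  have F_lip: "\<bar>F k x - F k y\<bar> \<le> C * dist x y" for k x y
    using lip[of x y] by (auto simp: F_def)
  show "sub_gaussian \<mu> (F k) (\<kappa> * C\<^sup>2 / 2)" for k
    unfolding sub_gaussian_def
  proof (intro conjI allI)
    show "integrable \<mu> (F k)"
      by (rule integrable_const_bound[of _ "real k"]) (use F_bdd in \<open>auto simp: F_def\<close>)
    fix \<theta> :: real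
    show "(\<integral>\<^sup>+ x. ennreal (exp (\<theta> * (F k x - (\<integral>y. F k y \<partial>\<mu>)))) \<partial>\<mu>) \<le> ennreal (exp (\<kappa> * C\<^sup>2 / 2 * \<theta>\<^sup>2))"
    \<comment> \<open>The bound for bounded functions asks for a positive Lipschitz
      constant.\<close>
    proof (cases "\<theta> = 0")
      case True
      then show ?thesis by (simp add: emeasure_space_1)
    next
      case False
      have "(\<integral>\<^sup>+ x. ennreal (exp (\<theta> * F k x - (\<integral>y. \<theta> * F k y \<partial>\<mu>))) \<partial>\<mu>)
          \<le> ennreal (exp (\<kappa> * (\<bar>\<theta>\<bar> * C)\<^sup>2 / 2))"
      proof (rule transport_entropy_imp_exp_bound[OF \<mu> \<open>0 \<le> \<kappa>\<close> transport])
        show "\<bar>\<theta> * F k x - \<theta> * F k y\<bar> \<le> \<bar>\<theta>\<bar> * C * dist x y" for x y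
          using mult_left_mono[OF F_lip[of k x y], of "\<bar>\<theta>\<bar>"]
          by (simp add: abs_mult[symmetric] algebra_simps)
        show "\<bar>\<theta> * F k x\<bar> \<le> \<bar>\<theta>\<bar> * real k" for x
          using F_bdd[of k x] by (simp add: abs_mult mult_left_mono)
      qed (use False \<open>C > 0\<close> in auto)
      then show ?thesis by (simp add: algebra_simps power_mult_distrib)
    qed
  qed
  show "AE x in \<mu>. (\<lambda>k. F k x) \<longlonglongrightarrow> f x"
  proof (rule AE_I2, rule tendsto_eventually)
    fix x
    obtain N :: nat where N: "\<bar>f x\<bar> \<le> real N" using real_arch_simple by blast
    show "\<forall>\<^sub>F k in sequentially. F k x = f x"
      using eventually_ge_at_top[of N]
    proof eventually_elim
      case (elim k)
      then have "real N \<le> real k" by simp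
      with N show ?case by (auto simp: F_def max_def min_def)
    qed
  qed
  show "integrable \<mu> (\<lambda>x. \<bar>f 0\<bar> + C * norm x)" using moment by simp
  show "AE x in \<mu>. \<bar>F k x\<bar> \<le> \<bar>f 0\<bar> + C * norm x" for k
  proof (rule AE_I2)
    fix x
    have "\<bar>F k x\<bar> \<le> \<bar>f x\<bar>" by (auto simp: F_def)
    then show "\<bar>F k x\<bar> \<le> \<bar>f 0\<bar> + C * norm x" using lip[of x 0] by simp
  qed
qed

section \<open>Exponential moments of the maximum of a Wiener process\<close>

text \<open>Multiplying the density of variance \<open>t\<close> by
  \<open>exp (x\<^sup>2 / (4 * t))\<close> gives \<open>sqrt 2\<close> times the density of variance
  \<open>2 * t\<close>. The weight with \<open>T\<close> in place of \<open>t\<close> is smaller, so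
  the bound is uniform in \<open>t\<close>.\<close>

lemma nn_integral_exp_square_normal_density:
  assumes "0 < t" "t \<le> T"
  shows "(\<integral>\<^sup>+ x. ennreal (normal_density 0 (sqrt t) x * exp (x\<^sup>2 / (4 * T))) \<partial>lborel) \<le> ennreal (sqrt 2)"
proof -
  have "(\<integral>\<^sup>+ x. ennreal (normal_density 0 (sqrt t) x * exp (x\<^sup>2 / (4 * T))) \<partial>lborel)
      \<le> (\<integral>\<^sup>+ x. ennreal (sqrt 2) * ennreal (normal_density 0 (sqrt (2 * t)) x) \<partial>lborel)"
  proof (rule nn_integral_mono)
    fix x :: real
    have "normal_density 0 (sqrt t) x * exp (x\<^sup>2 / (4 * T))
        \<le> normal_density 0 (sqrt t) x * exp (x\<^sup>2 / (4 * t))"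
      using assms by (intro mult_left_mono) (auto intro!: divide_left_mono)
    also have "\<dots> = 1 / sqrt (2 * pi * t) * exp (- x\<^sup>2 / (2 * t) + x\<^sup>2 / (4 * t))"
      unfolding exp_add using assms by (simp add: normal_density_def)
    also have "- x\<^sup>2 / (2 * t) + x\<^sup>2 / (4 * t) = - x\<^sup>2 / (2 * (2 * t))"
      using assms by (simp add: field_simps)
    also have "1 / sqrt (2 * pi * t) * exp (- x\<^sup>2 / (2 * (2 * t))) = sqrt 2 * normal_density 0 (sqrt (2 * t)) x"
      using assms by (simp add: normal_density_def real_sqrt_mult power_mult_distrib field_simps)
    finally show "ennreal (normal_density 0 (sqrt t) x * exp (x\<^sup>2 / (4 * T)))
        \<le> ennreal (sqrt 2) * ennreal (normal_density 0 (sqrt (2 * t)) x)"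
      by (simp flip: ennreal_mult add: ennreal_leI)
  qed
  also have "\<dots> = ennreal (sqrt 2) * (\<integral>\<^sup>+ x. ennreal (normal_density 0 (sqrt (2 * t)) x) \<partial>lborel)"
    by (rule nn_integral_cmult) measurable
  also have "(\<integral>\<^sup>+ x. ennreal (normal_density 0 (sqrt (2 * t)) x) \<partial>lborel) = 1"
    using assms by (subst nn_integral_eq_integral) (auto intro: integrable_normal_density)
  finally show ?thesis by simp
qed

lemma bij_betw_axis_Basis: "bij_betw (\<lambda>k. axis k 1) UNIV (Basis :: (real ^ 'd::finite) set)"
  by (auto simp: bij_betw_def inj_on_def axis_eq_axis Basis_vec_def)

lemma prod_components_eq_prod_Basis:
  fixes x :: "real ^ 'd::finite"
  shows "(\<Prod>k\<in>UNIV. g (x $ k)) = (\<Prod>b\<in>Basis. g (x \<bullet> b))"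
proof -
  have "(\<Prod>b\<in>Basis. g (x \<bullet> b)) = (\<Prod>k\<in>UNIV. g (x \<bullet> axis k 1))"
    by (rule prod.reindex_bij_betw[OF bij_betw_axis_Basis, symmetric])
  then show ?thesis by (simp add: cart_eq_inner_axis)
qed

lemma lborel_distr_uminus_euclidean:
  "distr lborel borel uminus = (lborel :: 'a::euclidean_space measure)"
  using lborel_affine[of "- 1" "0 :: 'a"] by (simp add: density_1)

lemma borel_measurable_component [measurable (raw)]:
  fixes f :: "'a \<Rightarrow> real ^ 'd::finite"
  shows "f \<in> borel_measurable M \<Longrightarrow> (\<lambda>x. f x $ k) \<in> borel_measurable M"
  by (rule measurable_compose[OF _ borel_measurable_nth])

abbreviation std_gaussian_density :: "real \<Rightarrow> real ^ 'd::finite \<Rightarrow> ennreal" where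
  "std_gaussian_density t x \<equiv> ennreal (\<Prod>k\<in>UNIV. normal_density 0 (sqrt t) (x $ k))"

context prob_space
begin

text \<open>The weight factorises over the coordinates as the density does, so the one-dimensional
  bound enters once per coordinate.\<close>

lemma gaussian_exp_square_bound:
  fixes X :: "'a \<Rightarrow> real ^ 'd::finite"
  assumes X: "distributed M lborel X (std_gaussian_density t)" and t: "0 < t" "t \<le> T"
  shows "(\<integral>\<^sup>+ \<omega>. ennreal (exp ((norm (X \<omega>))\<^sup>2 / (4 * T))) \<partial>M) \<le> ennreal (sqrt 2 ^ CARD('d))"
proof -
  let ?g = "\<lambda>y. normal_density 0 (sqrt t) y * exp (y\<^sup>2 / (4 * T))"
  have "(\<integral>\<^sup>+ \<omega>. ennreal (exp ((norm (X \<omega>))\<^sup>2 / (4 * T))) \<partial>M)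
      = (\<integral>\<^sup>+ (x :: real ^ 'd). std_gaussian_density t x * ennreal (exp ((norm x)\<^sup>2 / (4 * T))) \<partial>lborel)"
    by (rule distributed_nn_integral[OF X, symmetric]) measurable
  also have "\<dots> = (\<integral>\<^sup>+ (x :: real ^ 'd). (\<Prod>b\<in>Basis. ennreal (?g (x \<bullet> b))) \<partial>lborel)"
  proof (rule nn_integral_cong)
    fix x :: "real ^ 'd"
    have "(norm x)\<^sup>2 = (\<Sum>k\<in>UNIV. (x $ k)\<^sup>2)"
      by (simp add: norm_vec_def L2_set_def sum_nonneg)
    then have "exp ((norm x)\<^sup>2 / (4 * T)) = (\<Prod>k\<in>UNIV. exp ((x $ k)\<^sup>2 / (4 * T)))"
      by (simp add: exp_sum sum_divide_distrib)
    then have "std_gaussian_density t x * ennreal (exp ((norm x)\<^sup>2 / (4 * T)))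
        = ennreal (\<Prod>k\<in>UNIV. ?g (x $ k))"
      by (simp add: prod.distrib prod_nonneg flip: ennreal_mult)
    also have "\<dots> = (\<Prod>k\<in>UNIV. ennreal (?g (x $ k)))"
      by (rule prod_ennreal[symmetric]) simp
    also have "\<dots> = (\<Prod>b\<in>Basis. ennreal (?g (x \<bullet> b)))"
      by (rule prod_components_eq_prod_Basis)
    finally show "std_gaussian_density t x * ennreal (exp ((norm x)\<^sup>2 / (4 * T)))
        = (\<Prod>b\<in>Basis. ennreal (?g (x \<bullet> b)))" .
  qed
  also have "\<dots> = (\<Prod>b\<in>(Basis :: (real ^ 'd) set). \<integral>\<^sup>+ y. ennreal (?g y) \<partial>lborel)"
    by (rule nn_integral_lborel_prod) auto
  also have "\<dots> \<le> (\<Prod>b\<in>(Basis :: (real ^ 'd) set). ennreal (sqrt 2))"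
    unfolding prod_constant by (intro power_mono nn_integral_exp_square_normal_density t) auto
  also have "\<dots> = ennreal (sqrt 2 ^ CARD('d))" by (simp add: ennreal_power)
  finally show ?thesis .
qed

text \<open>The density is even and Lebesgue measure is invariant under reflection, so the
  expectation equals its own negative.\<close>

lemma gaussian_mean_zero:
  fixes X :: "'a \<Rightarrow> real ^ 'd::finite"
  assumes X: "distributed M lborel X (std_gaussian_density t)"
  shows "expectation (\<lambda>\<omega>. X \<omega> $ k) = 0"
proof -
  let ?f = "\<lambda>x :: real ^ 'd. \<Prod>k\<in>UNIV. normal_density 0 (sqrt t) (x $ k)"
  have "expectation (\<lambda>\<omega>. X \<omega> $ k) = (\<integral>x. ?f x * (x $ k) \<partial>lborel)"
    by (rule distributed_integral[OF X, symmetric]) (auto intro: prod_nonneg)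
  also have "\<dots> = (\<integral>x. ?f x * (x $ k) \<partial>distr lborel borel uminus)"
    by (simp add: lborel_distr_uminus_euclidean)
  also have "\<dots> = (\<integral>x. ?f (- x) * ((- x) $ k) \<partial>lborel)"
    by (rule integral_distr) measurable
  also have "\<dots> = - (\<integral>x. ?f x * (x $ k) \<partial>lborel)"
    by (simp add: normal_density_def)
  also have "(\<integral>x. ?f x * (x $ k) \<partial>lborel) = expectation (\<lambda>\<omega>. X \<omega> $ k)"
    by (rule distributed_integral[OF X]) (auto intro: prod_nonneg)
  finally show ?thesis by simp
qed

end

section \<open>A maximal inequality along a grid\<close>

primrec runmax :: "(nat \<Rightarrow> real) \<Rightarrow> nat \<Rightarrow> real" where
  "runmax y 0 = y 0"
| "runmax y (Suc j) = max (runmax y j) (y (Suc j))"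

lemma runmax_cong: "(\<And>i. i \<le> j \<Longrightarrow> y i = z i) \<Longrightarrow> runmax y j = runmax z j"
  by (induction j) auto

lemma le_runmax: "i \<le> j \<Longrightarrow> y i \<le> runmax y j"
  by (induction j) (auto simp: le_Suc_eq)

lemma runmax_measurable:
  "(\<And>i. i \<le> j \<Longrightarrow> (\<lambda>x. y i x) \<in> borel_measurable M) \<Longrightarrow>
    (\<lambda>x. runmax (\<lambda>i. y i x) j) \<in> borel_measurable M"
  by (induction j) auto

context prob_space
begin

text \<open>Doob's \<open>L\<^sup>2\<close> maximal inequality for the submartingale \<open>Y j = exp (c |S j|\<^sup>2)\<close>, where \<open>S\<close> is a
  random walk with centred steps. Burkholder's function \<open>2 m (m - 2 y)\<close> dominates \<open>m\<^sup>2 - 4 y\<^sup>2\<close>, and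
  its expectation along \<open>(Y, runmax Y)\<close> starts below \<open>0\<close> and decreases.\<close>

lemma random_walk_maximal:
  fixes \<Delta> :: "nat \<Rightarrow> 'a \<Rightarrow> real ^ 'd::finite"
  defines "S \<equiv> \<lambda>j \<omega>. \<Sum>i<j. \<Delta> i \<omega>"
  assumes indep: "indep_vars (\<lambda>_. borel) \<Delta> {..<N}" and "c > 0"
    and mean: "\<And>i k. i < N \<Longrightarrow> expectation (\<lambda>\<omega>. \<Delta> i \<omega> $ k) = 0"
    and int_\<Delta>: "\<And>i k. i < N \<Longrightarrow> integrable M (\<lambda>\<omega>. \<Delta> i \<omega> $ k)"
    and int_exp: "\<And>j. j \<le> N \<Longrightarrow> integrable M (\<lambda>\<omega>. exp (4 * c * (norm (S j \<omega>))\<^sup>2))"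
  shows "integrable M (\<lambda>\<omega>. (runmax (\<lambda>j. exp (c * (norm (S j \<omega>))\<^sup>2)) N)\<^sup>2)"
    and "expectation (\<lambda>\<omega>. (runmax (\<lambda>j. exp (c * (norm (S j \<omega>))\<^sup>2)) N)\<^sup>2)
      \<le> 4 * expectation (\<lambda>\<omega>. exp (2 * c * (norm (S N \<omega>))\<^sup>2))"
proof -
  define Y where "Y = (\<lambda>j \<omega>. exp (c * (norm (S j \<omega>))\<^sup>2))"
  define R where "R = (\<lambda>j \<omega>. runmax (\<lambda>i. Y i \<omega>) j)"
  have \<Delta>_meas [measurable]: "\<Delta> i \<in> borel_measurable M" if "i < N" for i
    using indep that by (auto simp: indep_vars_def)
  have S_meas [measurable]: "S j \<in> borel_measurable M" if "j \<le> N" for j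
    unfolding S_def using that by (intro borel_measurable_sum \<Delta>_meas) auto
  have Y_meas [measurable]: "Y j \<in> borel_measurable M" if "j \<le> N" for j
    unfolding Y_def using that by measurable
  have R_meas [measurable]: "R j \<in> borel_measurable M" if "j \<le> N" for j
    unfolding R_def using that by (intro runmax_measurable Y_meas) auto
  have Y1: "1 \<le> Y j \<omega>" for j \<omega> using \<open>c > 0\<close> by (simp add: Y_def)
  have R1: "1 \<le> R j \<omega>" for j \<omega>
    using Y1[of 0 \<omega>] le_runmax[of 0 j "\<lambda>i. Y i \<omega>"] by (simp add: R_def)
  have int_Y4: "integrable M (\<lambda>\<omega>. (Y j \<omega>) ^ 4)" if "j \<le> N" for j
    using int_exp[OF that] by (simp add: Y_def flip: exp_of_nat_mult) (simp add: algebra_simps)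
  have int_Y2: "integrable M (\<lambda>\<omega>. (Y j \<omega>)\<^sup>2)" if "j \<le> N" for j
  proof (rule Bochner_Integration.integrable_bound[OF int_Y4[OF that]])
    show "AE \<omega> in M. norm ((Y j \<omega>)\<^sup>2) \<le> norm ((Y j \<omega>) ^ 4)"
      using Y1[of j] by (intro AE_I2) (auto intro!: power_increasing)
  qed (use that in measurable)
  have int_R2: "integrable M (\<lambda>\<omega>. (R j \<omega>)\<^sup>2)" if "j \<le> N" for j
    using that
  proof (induction j)
    case 0
    then show ?case using int_Y2[of 0] by (simp add: R_def)
  next
    case (Suc j)
    show ?case
    proof (rule Bochner_Integration.integrable_bound)
      show "integrable M (\<lambda>\<omega>. (R j \<omega>)\<^sup>2 + (Y (Suc j) \<omega>)\<^sup>2)"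
        using Suc int_Y2[of "Suc j"] by auto
      show "AE \<omega> in M. norm ((R (Suc j) \<omega>)\<^sup>2) \<le> norm ((R j \<omega>)\<^sup>2 + (Y (Suc j) \<omega>)\<^sup>2)"
        by (intro AE_I2) (auto simp: R_def max_def)
    qed (use Suc.prems in measurable)
  qed
  have int_RY: "integrable M (\<lambda>\<omega>. R j \<omega> * Y i \<omega>)" if "j \<le> N" "i \<le> N" for i j
  proof (rule Bochner_Integration.integrable_bound)
    show "integrable M (\<lambda>\<omega>. (R j \<omega>)\<^sup>2 + (Y i \<omega>)\<^sup>2)"
      using int_R2 int_Y2 that by auto
    show "AE \<omega> in M. norm (R j \<omega> * Y i \<omega>) \<le> norm ((R j \<omega>)\<^sup>2 + (Y i \<omega>)\<^sup>2)"
    proof (rule AE_I2)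
      fix \<omega>
      have p: "0 \<le> R j \<omega> * Y i \<omega>" using R1[of j \<omega>] Y1[of i \<omega>] by simp
      show "norm (R j \<omega> * Y i \<omega>) \<le> norm ((R j \<omega>)\<^sup>2 + (Y i \<omega>)\<^sup>2)"
        using sum_squares_bound[of "R j \<omega>" "Y i \<omega>"] p
        by (subst real_norm_def, subst abs_of_nonneg[OF p]) simp
    qed
  qed (use that in measurable)
  \<comment> \<open>Here the exponent \<open>4 * c\<close> is needed: the factor \<open>S j\<close>
    costs one more \<open>Y j\<close>, up to \<open>sqrt c\<close>, and \<open>R * Y\<^sup>2\<close>
    is at most \<open>R\<^sup>2 + Y ^ 4\<close>.\<close>
  have int_RYS: "integrable M (\<lambda>\<omega>. R j \<omega> * Y j \<omega> * (S j \<omega> $ k))" if "j \<le> N" for j k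
  proof (rule Bochner_Integration.integrable_bound)
    show "integrable M (\<lambda>\<omega>. ((R j \<omega>)\<^sup>2 + (Y j \<omega>) ^ 4) / sqrt c)"
      using int_R2 int_Y4 that by auto
    show "AE \<omega> in M. norm (R j \<omega> * Y j \<omega> * (S j \<omega> $ k)) \<le> norm (((R j \<omega>)\<^sup>2 + (Y j \<omega>) ^ 4) / sqrt c)"
    proof (rule AE_I2)
      fix \<omega>
      have pos: "0 \<le> R j \<omega>" "0 \<le> Y j \<omega>" using R1[of j \<omega>] Y1[of j \<omega>] by auto
      have "0 \<le> sqrt c * norm (S j \<omega>)" using \<open>c > 0\<close> by simp
      then have "sqrt c * norm (S j \<omega>) \<le> 1 + (sqrt c * norm (S j \<omega>))\<^sup>2"
        using sum_squares_bound[of 1 "sqrt c * norm (S j \<omega>)"] unfolding power_one mult_1_right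
        by linarith
      also have "\<dots> \<le> Y j \<omega>"
        using \<open>c > 0\<close> exp_ge_add_one_self[of "c * (norm (S j \<omega>))\<^sup>2"]
        by (simp add: Y_def power_mult_distrib)
      finally have "norm (S j \<omega>) \<le> Y j \<omega> / sqrt c" using \<open>c > 0\<close> by (simp add: field_simps)
      then have "\<bar>S j \<omega> $ k\<bar> \<le> Y j \<omega> / sqrt c"
        using component_le_norm_cart[of "S j \<omega>" k] by linarith
      then have "R j \<omega> * Y j \<omega> * \<bar>S j \<omega> $ k\<bar> \<le> R j \<omega> * Y j \<omega> * (Y j \<omega> / sqrt c)"
        using pos by (intro mult_left_mono) auto
      also have "\<dots> = R j \<omega> * (Y j \<omega>)\<^sup>2 / sqrt c" by (simp add: power2_eq_square)
      also have "\<dots> \<le> ((R j \<omega>)\<^sup>2 + (Y j \<omega>) ^ 4) / sqrt c"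
      proof (rule divide_right_mono)
        have "0 \<le> R j \<omega> * (Y j \<omega>)\<^sup>2" using pos by simp
        then show "R j \<omega> * (Y j \<omega>)\<^sup>2 \<le> (R j \<omega>)\<^sup>2 + (Y j \<omega>) ^ 4"
          using sum_squares_bound[of "R j \<omega>" "(Y j \<omega>)\<^sup>2"] by (simp only: power_mult[symmetric]) simp
      qed (use \<open>c > 0\<close> in simp)
      finally show "norm (R j \<omega> * Y j \<omega> * (S j \<omega> $ k)) \<le> norm (((R j \<omega>)\<^sup>2 + (Y j \<omega>) ^ 4) / sqrt c)"
        using pos \<open>c > 0\<close> by (simp add: abs_mult)
    qed
  qed (use that in measurable)
  \<comment> \<open>The first factor is a function \<open>\<phi>\<close> of the steps before
    \<open>j\<close>, hence independent of the centred step \<open>\<Delta> j\<close>.\<close>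
  have cross: "integrable M (\<lambda>\<omega>. (R j \<omega> * Y j \<omega> * (S j \<omega> $ k)) * (\<Delta> j \<omega> $ k))"
    "expectation (\<lambda>\<omega>. (R j \<omega> * Y j \<omega> * (S j \<omega> $ k)) * (\<Delta> j \<omega> $ k)) = 0" if j: "j < N" for j k
  proof -
    define P where "P = (\<lambda>(v :: nat \<Rightarrow> real ^ 'd) i. \<Sum>l<i. v l)"
    define \<phi> where "\<phi> = (\<lambda>v. runmax (\<lambda>i. exp (c * (norm (P v i))\<^sup>2)) j * exp (c * (norm (P v j))\<^sup>2) * (P v j $ k))"
    have P_meas [measurable]: "(\<lambda>v. P v i) \<in> borel_measurable (PiM {..<j} (\<lambda>_. borel))" if "i \<le> j" for i
      unfolding P_def using that by (intro borel_measurable_sum) auto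
    have \<phi>_meas: "\<phi> \<in> borel_measurable (PiM {..<j} (\<lambda>_. borel))"
      unfolding \<phi>_def by (intro borel_measurable_times runmax_measurable) auto
    have P_eq: "P (\<lambda>i\<in>{..<j}. \<Delta> i \<omega>) i = S i \<omega>" if "i \<le> j" for i \<omega>
      unfolding P_def S_def using that by (intro sum.cong) auto
    have \<phi>_eq: "\<phi> (\<lambda>i\<in>{..<j}. \<Delta> i \<omega>) = R j \<omega> * Y j \<omega> * (S j \<omega> $ k)" for \<omega>
      unfolding \<phi>_def R_def Y_def by (simp add: P_eq cong: runmax_cong)
    have iv: "indep_var (PiM {..<j} (\<lambda>_. borel)) (\<lambda>\<omega>. \<lambda>i\<in>{..<j}. \<Delta> i \<omega>)
        (PiM {j} (\<lambda>_. borel)) (\<lambda>\<omega>. \<lambda>i\<in>{j}. \<Delta> i \<omega>)"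
      by (rule indep_var_restrict[OF indep]) (use j in auto)
    have "indep_var borel (\<phi> \<circ> (\<lambda>\<omega>. \<lambda>i\<in>{..<j}. \<Delta> i \<omega>))
        borel ((\<lambda>v. v j $ k) \<circ> (\<lambda>\<omega>. \<lambda>i\<in>{j}. \<Delta> i \<omega>))"
      by (rule indep_var_compose[OF iv \<phi>_meas]) measurable
    then have iv': "indep_var borel (\<lambda>\<omega>. R j \<omega> * Y j \<omega> * (S j \<omega> $ k)) borel (\<lambda>\<omega>. \<Delta> j \<omega> $ k)"
      by (simp add: comp_def \<phi>_eq)
    show "integrable M (\<lambda>\<omega>. (R j \<omega> * Y j \<omega> * (S j \<omega> $ k)) * (\<Delta> j \<omega> $ k))"
      by (rule indep_var_integrable[OF iv']) (use int_RYS int_\<Delta> j in auto)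
    show "expectation (\<lambda>\<omega>. (R j \<omega> * Y j \<omega> * (S j \<omega> $ k)) * (\<Delta> j \<omega> $ k)) = 0"
      by (subst indep_var_lebesgue_integral[OF iv']) (use int_RYS int_\<Delta> j mean in auto)
  qed
  \<comment> \<open>The submartingale property tested against \<open>R j\<close>:
    \<open>Y (Suc j)\<close> is at least
    \<open>Y j * (1 + 2 * c * (S j \<bullet> \<Delta> j))\<close>, and the linear term, expanded
    over components in \<open>?G\<close>, has mean zero by \<open>cross\<close>.\<close>
  have step: "expectation (\<lambda>\<omega>. R j \<omega> * Y j \<omega>) \<le> expectation (\<lambda>\<omega>. R j \<omega> * Y (Suc j) \<omega>)" if j: "j < N" for j
  proof -
    let ?G = "\<lambda>\<omega>. \<Sum>k\<in>UNIV. 2 * c * ((R j \<omega> * Y j \<omega> * (S j \<omega> $ k)) * (\<Delta> j \<omega> $ k))"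
    have int_G: "integrable M ?G" and EG: "expectation ?G = 0"
      using cross[OF j] by auto
    have "expectation (\<lambda>\<omega>. R j \<omega> * Y j \<omega>) = expectation (\<lambda>\<omega>. R j \<omega> * Y j \<omega> + ?G \<omega>)"
      using int_G EG int_RY[of j j] j by (subst Bochner_Integration.integral_add) auto
    also have "\<dots> \<le> expectation (\<lambda>\<omega>. R j \<omega> * Y (Suc j) \<omega>)"
    proof (rule integral_mono)
      fix \<omega>
      have pos: "0 \<le> R j \<omega>" "0 \<le> Y j \<omega>" using R1[of j \<omega>] Y1[of j \<omega>] by auto
      have S: "S (Suc j) \<omega> = S j \<omega> + \<Delta> j \<omega>" by (simp add: S_def)
      have "(norm (S (Suc j) \<omega>))\<^sup>2 \<ge> (norm (S j \<omega>))\<^sup>2 + 2 * (S j \<omega> \<bullet> \<Delta> j \<omega>)"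
        unfolding S by (simp add: power2_norm_eq_inner inner_add inner_commute)
      then have "c * ((norm (S j \<omega>))\<^sup>2 + 2 * (S j \<omega> \<bullet> \<Delta> j \<omega>)) \<le> c * (norm (S (Suc j) \<omega>))\<^sup>2"
        using \<open>c > 0\<close> by (intro mult_left_mono) auto
      then have "exp (c * ((norm (S j \<omega>))\<^sup>2 + 2 * (S j \<omega> \<bullet> \<Delta> j \<omega>))) \<le> Y (Suc j) \<omega>"
        by (simp add: Y_def)
      moreover have "Y j \<omega> * (1 + 2 * c * (S j \<omega> \<bullet> \<Delta> j \<omega>)) \<le> Y j \<omega> * exp (2 * c * (S j \<omega> \<bullet> \<Delta> j \<omega>))"
        using pos by (intro mult_left_mono) auto
      moreover have "Y j \<omega> * exp (2 * c * (S j \<omega> \<bullet> \<Delta> j \<omega>)) = exp (c * ((norm (S j \<omega>))\<^sup>2 + 2 * (S j \<omega> \<bullet> \<Delta> j \<omega>)))"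
        by (simp add: Y_def algebra_simps flip: exp_add)
      ultimately have "Y j \<omega> * (1 + 2 * c * (S j \<omega> \<bullet> \<Delta> j \<omega>)) \<le> Y (Suc j) \<omega>" by linarith
      from mult_left_mono[OF this pos(1)]
      show "R j \<omega> * Y j \<omega> + ?G \<omega> \<le> R j \<omega> * Y (Suc j) \<omega>"
        by (simp add: inner_vec_def sum_distrib_left algebra_simps)
    qed (use int_G int_RY j in auto)
    finally show ?thesis .
  qed
  have descent: "expectation (\<lambda>\<omega>. 2 * (R j \<omega>)\<^sup>2 - 4 * (R j \<omega> * Y j \<omega>)) \<le> 0" if "j \<le> N" for j
    using that
  proof (induction j)
    case 0
    then show ?case by (simp add: R_def flip: power2_eq_square)
  next
    case (Suc j)
    have "expectation (\<lambda>\<omega>. 2 * (R (Suc j) \<omega>)\<^sup>2 - 4 * (R (Suc j) \<omega> * Y (Suc j) \<omega>))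
        \<le> expectation (\<lambda>\<omega>. 2 * (R j \<omega>)\<^sup>2 - 4 * (R j \<omega> * Y (Suc j) \<omega>))"
    proof (rule integral_mono)
      fix \<omega>
      \<comment> \<open>If the maximum rises to \<open>Y (Suc j)\<close>, the expression drops by
        exactly this amount; otherwise it does not change.\<close>
      have "0 \<le> 2 * (Y (Suc j) \<omega> - R j \<omega>)\<^sup>2" by simp
      then show "2 * (R (Suc j) \<omega>)\<^sup>2 - 4 * (R (Suc j) \<omega> * Y (Suc j) \<omega>)
          \<le> 2 * (R j \<omega>)\<^sup>2 - 4 * (R j \<omega> * Y (Suc j) \<omega>)"
        by (auto simp: R_def max_def power2_eq_square algebra_simps)
    qed (use Suc.prems int_R2 int_RY in auto)
    also have "\<dots> \<le> expectation (\<lambda>\<omega>. 2 * (R j \<omega>)\<^sup>2 - 4 * (R j \<omega> * Y j \<omega>))"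
      using Suc.prems int_R2[of j] int_RY[of j] step[of j] by simp
    finally show ?case using Suc by simp
  qed
  show "integrable M (\<lambda>\<omega>. (runmax (\<lambda>j. exp (c * (norm (S j \<omega>))\<^sup>2)) N)\<^sup>2)"
    using int_R2[of N] by (simp add: R_def Y_def)
  have "expectation (\<lambda>\<omega>. (R N \<omega>)\<^sup>2 - 4 * (Y N \<omega>)\<^sup>2) \<le> expectation (\<lambda>\<omega>. 2 * (R N \<omega>)\<^sup>2 - 4 * (R N \<omega> * Y N \<omega>))"
  proof (rule integral_mono)
    fix \<omega>
    have "0 \<le> (R N \<omega> - 2 * Y N \<omega>)\<^sup>2" by simp
    then show "(R N \<omega>)\<^sup>2 - 4 * (Y N \<omega>)\<^sup>2 \<le> 2 * (R N \<omega>)\<^sup>2 - 4 * (R N \<omega> * Y N \<omega>)"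
      by (simp add: power2_eq_square algebra_simps)
  qed (use int_R2 int_Y2 int_RY in auto)
  also have "\<dots> \<le> 0" using descent by simp
  finally have "expectation (\<lambda>\<omega>. (R N \<omega>)\<^sup>2) \<le> 4 * expectation (\<lambda>\<omega>. (Y N \<omega>)\<^sup>2)"
    using int_R2[of N] int_Y2[of N] by simp
  moreover have "(Y N \<omega>)\<^sup>2 = exp (2 * c * (norm (S N \<omega>))\<^sup>2)" for \<omega>
    by (simp add: Y_def power2_eq_square flip: exp_add)
  ultimately show "expectation (\<lambda>\<omega>. (runmax (\<lambda>j. exp (c * (norm (S j \<omega>))\<^sup>2)) N)\<^sup>2)
      \<le> 4 * expectation (\<lambda>\<omega>. exp (2 * c * (norm (S N \<omega>))\<^sup>2))"
    by (simp add: R_def Y_def)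
qed

text \<open>The increments on the grid form a random walk with centred independent steps. The bound
  does not involve \<open>N\<close>, which is what permits refining the grid.\<close>

lemma wiener_exp_square_maximal:
  fixes W :: "real \<Rightarrow> 'a \<Rightarrow> real ^ 'd::finite"
  assumes W: "standard_wiener T W" and "0 < T" "0 < N"
  shows "(\<integral>\<^sup>+ \<omega>. ennreal (exp (1 / (8 * T) * (Max ((\<lambda>j. norm (W (T * real j / real N) \<omega>)) ` {..N}))\<^sup>2)) \<partial>M)
    \<le> ennreal (4 * sqrt 2 ^ CARD('d))"
proof -
  define r where "r = (\<lambda>j. T * real j / real N)"
  define \<Delta> where "\<Delta> = (\<lambda>j \<omega>. W (r (Suc j)) \<omega> - W (r j) \<omega>)"
  define S where "S = (\<lambda>j \<omega>. \<Sum>i<j. \<Delta> i \<omega>)"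
  define c where "c = 1 / (16 * T)"
  have c: "c > 0" "4 * c = 1 / (4 * T)" "2 * c = 1 / (8 * T)" using \<open>0 < T\<close> by (auto simp: c_def)
  have mono: "strict_mono_on {..N} r"
    using \<open>0 < T\<close> \<open>0 < N\<close> by (auto simp: strict_mono_on_def r_def field_simps)
  have r0: "r 0 = 0" and rN: "r N = T" using \<open>0 < N\<close> by (auto simp: r_def)
  have r_in: "r j \<in> {0..T}" if "j \<le> N" for j
    using \<open>0 < T\<close> \<open>0 < N\<close> that by (auto simp: r_def field_simps)
  have r_less: "r i < r j" if "i < j" "j \<le> N" for i j
    using mono that by (auto simp: strict_mono_on_def)
  have S_eq: "S j \<omega> = W (r j) \<omega> - W 0 \<omega>" for j \<omega>
    unfolding S_def \<Delta>_def by (subst sum_lessThan_telescope) (simp add: r0)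
  have dist: "distributed M lborel (\<lambda>\<omega>. W t \<omega> - W s \<omega>) (std_gaussian_density (t - s))"
    if "0 \<le> s" "s < t" "t \<le> T" for s t
    using W that by (simp add: standard_wiener_def)
  have indep: "indep_vars (\<lambda>_. borel) \<Delta> {..<N}"
    using W mono r_in unfolding standard_wiener_def \<Delta>_def by (auto simp: image_subset_iff)
  have dist\<Delta>: "distributed M lborel (\<Delta> j) (std_gaussian_density (r (Suc j) - r j))" if "j < N" for j
    unfolding \<Delta>_def using r_in[of j] r_in[of "Suc j"] r_less[of j "Suc j"] that by (intro dist) auto
  have meas_W: "W t \<in> borel_measurable M" if "t \<in> {0..T}" for t
    using W that by (auto simp: standard_wiener_def)
  have meas_S: "S j \<in> borel_measurable M" if "j \<le> N" for j
    unfolding S_eq using r_in[OF that] \<open>0 < T\<close> by (intro borel_measurable_diff meas_W) auto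
  have bound: "(\<integral>\<^sup>+ \<omega>. ennreal (exp ((norm (S j \<omega>))\<^sup>2 / (4 * T))) \<partial>M) \<le> ennreal (sqrt 2 ^ CARD('d))" if "j \<le> N" for j
  \<comment> \<open>The Gaussian density is available only for increments over positive
    time.\<close>
  proof (cases "j = 0")
    case True
    moreover have "ennreal 1 \<le> ennreal (sqrt 2 ^ CARD('d))" by (intro ennreal_leI one_le_power) auto
    ultimately show ?thesis by (simp add: S_def emeasure_space_1)
  next
    case False
    then have "distributed M lborel (S j) (std_gaussian_density (r j - 0))"
      unfolding S_eq using r_in[OF that] r_less[of 0 j] that by (intro dist) (auto simp: r0)
    then show ?thesis
      using r_in[OF that] r_less[of 0 j] that False
      by (intro gaussian_exp_square_bound[where t="r j"]) (auto simp: r0)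
  qed
  have int_exp: "integrable M (\<lambda>\<omega>. exp (4 * c * (norm (S j \<omega>))\<^sup>2))" if "j \<le> N" for j
  proof (rule integrableI_bounded)
    note [measurable] = meas_S[OF that]
    show "(\<lambda>\<omega>. exp (4 * c * (norm (S j \<omega>))\<^sup>2)) \<in> borel_measurable M" by measurable
    show "(\<integral>\<^sup>+ \<omega>. ennreal (norm (exp (4 * c * (norm (S j \<omega>))\<^sup>2))) \<partial>M) < \<infinity>"
      using order_le_less_trans[OF bound[OF that]] by (simp add: c)
  qed
  have int_\<Delta>: "integrable M (\<lambda>\<omega>. \<Delta> j \<omega> $ k)" if j: "j < N" for j k
  proof (rule Bochner_Integration.integrable_bound)
    have [measurable]: "\<Delta> j \<in> borel_measurable M" using dist\<Delta>[OF j] by (simp add: distributed_def)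
    show "(\<lambda>\<omega>. \<Delta> j \<omega> $ k) \<in> borel_measurable M"
      by measurable
    have b: "(\<integral>\<^sup>+ \<omega>. ennreal (exp ((norm (\<Delta> j \<omega>))\<^sup>2 / (4 * T))) \<partial>M) \<le> ennreal (sqrt 2 ^ CARD('d))"
      using r_in[of j] r_in[of "Suc j"] r_less[of j "Suc j"] j by (intro gaussian_exp_square_bound[OF dist\<Delta>]) auto
    have "integrable M (\<lambda>\<omega>. exp ((norm (\<Delta> j \<omega>))\<^sup>2 / (4 * T)))"
      using order_le_less_trans[OF b] by (intro integrableI_bounded) auto
    then show "integrable M (\<lambda>\<omega>. 1 + 4 * T * exp ((norm (\<Delta> j \<omega>))\<^sup>2 / (4 * T)))"
      by simp
    show "AE \<omega> in M. norm (\<Delta> j \<omega> $ k) \<le> norm (1 + 4 * T * exp ((norm (\<Delta> j \<omega>))\<^sup>2 / (4 * T)))"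
    proof (rule AE_I2)
      fix \<omega>
      have "norm (\<Delta> j \<omega> $ k) \<le> norm (\<Delta> j \<omega>)" by (simp add: component_le_norm_cart)
      also have "\<dots> \<le> 1 + (norm (\<Delta> j \<omega>))\<^sup>2" using sum_squares_bound[of 1 "norm (\<Delta> j \<omega>)"] norm_ge_zero[of "\<Delta> j \<omega>"]
          unfolding power_one mult_1_right by linarith
      also have "(norm (\<Delta> j \<omega>))\<^sup>2 = 4 * T * ((norm (\<Delta> j \<omega>))\<^sup>2 / (4 * T))" using \<open>0 < T\<close> by simp
      also have "\<dots> \<le> 4 * T * exp ((norm (\<Delta> j \<omega>))\<^sup>2 / (4 * T))"
        using \<open>0 < T\<close> exp_ge_add_one_self[of "(norm (\<Delta> j \<omega>))\<^sup>2 / (4 * T)"] by (intro mult_left_mono) linarith+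
      finally show "norm (\<Delta> j \<omega> $ k) \<le> norm (1 + 4 * T * exp ((norm (\<Delta> j \<omega>))\<^sup>2 / (4 * T)))"
        using \<open>0 < T\<close> by simp
    qed
  qed
  let ?Q = "\<lambda>\<omega>. runmax (\<lambda>j. exp (c * (norm (S j \<omega>))\<^sup>2)) N"
  have maximal: "integrable M (\<lambda>\<omega>. (?Q \<omega>)\<^sup>2)"
    "expectation (\<lambda>\<omega>. (?Q \<omega>)\<^sup>2) \<le> 4 * expectation (\<lambda>\<omega>. exp (2 * c * (norm (S N \<omega>))\<^sup>2))"
    unfolding S_def
    by (rule random_walk_maximal[OF indep c(1) gaussian_mean_zero[OF dist\<Delta>] int_\<Delta> int_exp[unfolded S_def]];
        assumption)+
  have "(\<integral>\<^sup>+ \<omega>. ennreal (exp (1 / (8 * T) * (Max ((\<lambda>j. norm (W (r j) \<omega>)) ` {..N}))\<^sup>2)) \<partial>M)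
      \<le> (\<integral>\<^sup>+ \<omega>. ennreal ((?Q \<omega>)\<^sup>2) \<partial>M)"
  proof (rule nn_integral_mono_AE)
    \<comment> \<open>The process starts at zero only almost surely, so \<open>S j\<close> and
      \<open>W (r j)\<close> agree off a null set.\<close>
    have "AE \<omega> in M. W 0 \<omega> = 0" using W by (simp add: standard_wiener_def)
    then show "AE \<omega> in M. ennreal (exp (1 / (8 * T) * (Max ((\<lambda>j. norm (W (r j) \<omega>)) ` {..N}))\<^sup>2)) \<le> ennreal ((?Q \<omega>)\<^sup>2)"
    proof eventually_elim
      case (elim \<omega>)
      let ?A = "(\<lambda>j. norm (W (r j) \<omega>)) ` {..N}"
      have "Max ?A \<in> ?A" by (rule Max_in) auto
      then obtain j where "j \<in> {..N}" "Max ?A = norm (W (r j) \<omega>)" by (rule imageE) simp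
      then have j: "j \<le> N" "Max ?A = norm (S j \<omega>)" by (simp_all add: S_eq elim)
      have "exp (1 / (8 * T) * (Max ?A)\<^sup>2) = (exp (c * (norm (S j \<omega>))\<^sup>2))\<^sup>2"
        unfolding j(2) c(3)[symmetric] by (simp add: power2_eq_square flip: exp_add)
      also have "\<dots> \<le> (?Q \<omega>)\<^sup>2"
        using le_runmax[OF j(1), of "\<lambda>j. exp (c * (norm (S j \<omega>))\<^sup>2)"] by (intro power_mono) auto
      finally show ?case by (rule ennreal_leI)
    qed
  qed
  also have "\<dots> = ennreal (expectation (\<lambda>\<omega>. (?Q \<omega>)\<^sup>2))"
    using maximal(1) by (intro nn_integral_eq_integral) auto
  also have "\<dots> \<le> ennreal (4 * expectation (\<lambda>\<omega>. exp (2 * c * (norm (S N \<omega>))\<^sup>2)))"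
    using maximal(2) by (intro ennreal_leI) auto
  also have "\<dots> \<le> ennreal (4 * sqrt 2 ^ CARD('d))"
  proof (intro ennreal_leI mult_left_mono)
    have "expectation (\<lambda>\<omega>. exp (2 * c * (norm (S N \<omega>))\<^sup>2)) \<le> expectation (\<lambda>\<omega>. exp (4 * c * (norm (S N \<omega>))\<^sup>2))"
    proof (rule integral_mono')
      show "exp (2 * c * (norm (S N \<omega>))\<^sup>2) \<le> exp (4 * c * (norm (S N \<omega>))\<^sup>2)" for \<omega>
        using c(1) by (simp add: mult_right_mono)
    qed (use int_exp in auto)
    moreover have "ennreal (expectation (\<lambda>\<omega>. exp (4 * c * (norm (S N \<omega>))\<^sup>2))) \<le> ennreal (sqrt 2 ^ CARD('d))"
      using bound[of N] int_exp[of N] by (subst nn_integral_eq_integral[symmetric]) (auto simp: c)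
    ultimately show "expectation (\<lambda>\<omega>. exp (2 * c * (norm (S N \<omega>))\<^sup>2)) \<le> sqrt 2 ^ CARD('d)"
      by simp
  qed simp
  finally show ?thesis by (simp add: r_def)
qed

end

section \<open>Functionals of bounded paths\<close>

definition bounded_tuples :: "nat \<Rightarrow> real \<Rightarrow> (nat \<Rightarrow> real \<Rightarrow> 'b::real_normed_vector) set" where
  "bounded_tuples n T = {x. \<forall>i<n. bounded (x i ` {0..T})}"

lemma path_tuples_subset_bounded_tuples: "path_tuples n T \<subseteq> bounded_tuples n T"
  by (auto simp: path_tuples_def bounded_tuples_def intro!: compact_imp_bounded compact_continuous_image)

lemma bounded_tuples_diff:
  assumes "x \<in> bounded_tuples n T" "y \<in> bounded_tuples n T"
  shows "(\<lambda>i t. x i t - y i t) \<in> bounded_tuples n T"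
  using assms unfolding bounded_tuples_def by (auto intro!: bounded_minus_comp)

lemma norm_le_path_norm:
  assumes "bounded (x ` {0..T})" "t \<in> {0..T}"
  shows "norm (x t) \<le> path_norm T x"
  unfolding path_norm_def
proof (rule cSUP_upper[OF assms(2)])
  show "bdd_above ((\<lambda>t. norm (x t)) ` {0..T})"
    using assms(1) by (auto simp: bounded_iff bdd_above_def)
qed

lemma path_norm_le:
  assumes "0 \<le> T" "\<And>t. t \<in> {0..T} \<Longrightarrow> norm (x t) \<le> c"
  shows "path_norm T x \<le> c"
  unfolding path_norm_def using assms by (intro cSUP_least) auto

lemma path_norm_nonneg:
  assumes "0 \<le> T" "bounded (x ` {0..T})"
  shows "0 \<le> path_norm T x"
  using norm_le_path_norm[OF assms(2), of 0] assms(1) by (auto intro: order_trans[OF norm_ge_zero])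

lemma path_norm_cong: "(\<And>t. t \<in> {0..T} \<Longrightarrow> norm (x t) = norm (y t)) \<Longrightarrow> path_norm T x = path_norm T y"
  unfolding path_norm_def by (intro SUP_cong) auto

lemma paths_norm1_nonneg:
  assumes "0 \<le> T" "x \<in> bounded_tuples n T"
  shows "0 \<le> paths_norm1 n T x"
  unfolding paths_norm1_def using assms by (intro sum_nonneg path_norm_nonneg) (auto simp: bounded_tuples_def)

lemma paths_norm1_commute:
  "paths_norm1 n T (\<lambda>i t. x i t - y i t) = paths_norm1 n T (\<lambda>i t. y i t - x i t)"
  unfolding paths_norm1_def by (intro sum.cong path_norm_cong) (auto simp: norm_minus_commute)

lemma paths_norm1_triangle:
  assumes T: "0 \<le> T" and x: "x \<in> bounded_tuples n T" and y: "y \<in> bounded_tuples n T" and z: "z \<in> bounded_tuples n T"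
  shows "paths_norm1 n T (\<lambda>i t. x i t - z i t)
    \<le> paths_norm1 n T (\<lambda>i t. x i t - y i t) + paths_norm1 n T (\<lambda>i t. y i t - z i t)"
  unfolding paths_norm1_def sum.distrib[symmetric]
proof (intro sum_mono path_norm_le T)
  fix i t assume i: "i \<in> {..<n}" and t: "t \<in> {0..T}"
  have "norm (x i t - z i t) \<le> norm (x i t - y i t) + norm (y i t - z i t)"
    using norm_triangle_ineq[of "x i t - y i t" "y i t - z i t"] by simp
  also have "\<dots> \<le> path_norm T (\<lambda>t. x i t - y i t) + path_norm T (\<lambda>t. y i t - z i t)"
    using bounded_tuples_diff[OF x y] bounded_tuples_diff[OF y z] i t
    by (intro add_mono norm_le_path_norm) (auto simp: bounded_tuples_def)
  finally show "norm (x i t - z i t) \<le> path_norm T (\<lambda>t. x i t - y i t) + path_norm T (\<lambda>t. y i t - z i t)" .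
qed

definition lipschitz_bounded_tuples ::
    "nat \<Rightarrow> real \<Rightarrow> real \<Rightarrow> ((nat \<Rightarrow> real \<Rightarrow> 'b::real_normed_vector) \<Rightarrow> real) \<Rightarrow> bool" where
  "lipschitz_bounded_tuples n T C F \<longleftrightarrow>
     (\<forall>x\<in>bounded_tuples n T. \<forall>y\<in>bounded_tuples n T.
        \<bar>F x - F y\<bar> \<le> C * paths_norm1 n T (\<lambda>i t. x i t - y i t))"

text \<open>McShane's extension. It makes functionals available on step functions, which only take
  finitely many values of a path into account.\<close>

lemma lipschitz_extension:
  fixes g :: "'w \<Rightarrow> real" and Y :: "'w \<Rightarrow> nat \<Rightarrow> real \<Rightarrow> 'b::real_normed_vector"
  assumes "0 \<le> T" "0 \<le> C" and Y: "\<And>w. w \<in> \<Omega> \<Longrightarrow> Y w \<in> bounded_tuples n T"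
    and lip: "\<And>w w'. w \<in> \<Omega> \<Longrightarrow> w' \<in> \<Omega> \<Longrightarrow>
      \<bar>g w - g w'\<bar> \<le> C * paths_norm1 n T (\<lambda>i t. Y w i t - Y w' i t)"
  obtains F where "\<And>w. w \<in> \<Omega> \<Longrightarrow> F (Y w) = g w" "lipschitz_bounded_tuples n T C F"
proof (cases "\<Omega> = {}")
  case True
  then show ?thesis
    using \<open>0 \<le> C\<close> \<open>0 \<le> T\<close>
    by (intro that[of "\<lambda>_. 0"])
       (auto simp: lipschitz_bounded_tuples_def intro!: mult_nonneg_nonneg paths_norm1_nonneg bounded_tuples_diff)
next
  case False
  define e where "e = (\<lambda>x y :: nat \<Rightarrow> real \<Rightarrow> 'b. C * paths_norm1 n T (\<lambda>i t. x i t - y i t))"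
  let ?U = "bounded_tuples n T :: (nat \<Rightarrow> real \<Rightarrow> 'b) set"
  have e_commute: "e x y = e y x" for x y
    unfolding e_def by (simp add: paths_norm1_commute[of n T x y])
  have e_triangle: "e x z \<le> e x y + e y z" if "x \<in> ?U" "y \<in> ?U" "z \<in> ?U" for x y z
    using mult_left_mono[OF paths_norm1_triangle[OF \<open>0 \<le> T\<close> that] \<open>0 \<le> C\<close>]
    by (simp add: e_def distrib_left)
  have e_refl: "e x x = 0" for x
    using \<open>0 \<le> T\<close> by (simp add: e_def paths_norm1_def path_norm_def)
  \<comment> \<open>The infimum is indexed by \<open>w\<close> and not by the tuple
    \<open>Y w\<close>: the Lipschitz hypothesis already makes \<open>g\<close> equal at points
    whose tuples are at distance zero.\<close>
  define F where "F = (\<lambda>x. INF w\<in>\<Omega>. g w + e x (Y w))"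
  have lip': "\<bar>g w - g w'\<bar> \<le> e (Y w) (Y w')" if "w \<in> \<Omega>" "w' \<in> \<Omega>" for w w'
    using lip[OF that] by (simp add: e_def)
  have bdd: "bdd_below ((\<lambda>w. g w + e x (Y w)) ` \<Omega>)" if x: "x \<in> ?U" for x
  proof -
    obtain w0 where w0: "w0 \<in> \<Omega>" using False by auto
    have "g w0 - e x (Y w0) \<le> g w + e x (Y w)" if w: "w \<in> \<Omega>" for w
      using lip'[OF w0 w] e_triangle[OF Y[OF w0] x Y[OF w]] e_commute[of x "Y w0"] by linarith
    then show ?thesis by (auto simp: bdd_below_def)
  qed
  have F_le: "F x \<le> F y + e x y" if x: "x \<in> ?U" and y: "y \<in> ?U" for x y
  proof -
    have "F x - e x y \<le> g w + e y (Y w)" if w: "w \<in> \<Omega>" for w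
    proof -
      have "F x \<le> g w + e x (Y w)" unfolding F_def by (intro cINF_lower bdd x w)
      then show ?thesis using e_triangle[OF x y Y[OF w]] by linarith
    qed
    then have "F x - e x y \<le> F y" unfolding F_def using False by (intro cINF_greatest) auto
    then show ?thesis by simp
  qed
  show ?thesis
  proof (rule that)
    show "lipschitz_bounded_tuples n T C F"
      unfolding lipschitz_bounded_tuples_def e_def[THEN fun_cong, THEN fun_cong, symmetric]
    proof (intro ballI)
      fix x y assume "x \<in> ?U" "y \<in> ?U"
      then show "\<bar>F x - F y\<bar> \<le> e x y" using F_le[of x y] F_le[of y x] e_commute[of x y] by linarith
    qed
    fix w assume w: "w \<in> \<Omega>"
    have "F (Y w) \<le> g w + e (Y w) (Y w)" unfolding F_def by (intro cINF_lower bdd w Y)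
    moreover have "g w \<le> F (Y w)"
      unfolding F_def using False
    proof (rule cINF_greatest)
      fix w' assume "w' \<in> \<Omega>"
      then show "g w \<le> g w' + e (Y w) (Y w')" using lip'[OF w, of w'] by linarith
    qed
    ultimately show "F (Y w) = g w" by (simp add: e_refl)
  qed
qed

section \<open>Empirical measures and their Wasserstein distance\<close>

lemma measurable_uniform_count_measure_iff:
  "f \<in> measurable (uniform_count_measure {..<n}) N \<longleftrightarrow> f \<in> {..<n} \<rightarrow> space N"
  by (auto simp: measurable_def sets_uniform_count_measure space_uniform_count_measure)

lemma empirical_measure_in_finite_mean_measures:
  assumes "n \<ge> 1"
  shows "empirical_measure n x \<in> finite_mean_measures"
proof -
  have "prob_space (uniform_count_measure {..<n})"
    using assms by (intro prob_space_uniform_count_measure) (auto simp: lessThan_empty_iff)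
  then interpret prob_space "uniform_count_measure {..<n}" .
  have m: "x \<in> measurable (uniform_count_measure {..<n}) borel" by (simp add: measurable_uniform_count_measure_iff)
  have "integrable (uniform_count_measure {..<n}) (\<lambda>i. norm (x i))"
    by (rule integrable_const_bound[where B="Max ((\<lambda>i. norm (x i)) ` {..<n})"])
       (auto simp: measurable_uniform_count_measure_iff space_uniform_count_measure intro!: AE_I2)
  with m show ?thesis
    unfolding finite_mean_measures_def empirical_measure_def
    by (auto simp: integrable_distr_eq prob_space_distr)
qed

text \<open>Pairing the atoms of equal index is a coupling, and its cost is the right-hand
  side.\<close>

lemma wasserstein1_empirical_measure_le:
  assumes "n \<ge> 1"
  shows "wasserstein1 (empirical_measure n x) (empirical_measure n y)
    \<le> ennreal ((\<Sum>i<n. norm (x i - y i)) / n)"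
proof -
  let ?u = "uniform_count_measure {..<n}"
  have xy: "(\<lambda>i. (x i, y i)) \<in> measurable ?u (borel \<Otimes>\<^sub>M borel)"
    by (simp add: measurable_uniform_count_measure_iff space_pair_measure)
  let ?\<pi> = "distr ?u (borel \<Otimes>\<^sub>M borel) (\<lambda>i. (x i, y i))"
  have "?\<pi> \<in> couplings (empirical_measure n x) (empirical_measure n y)"
    using xy by (simp add: couplings_def empirical_measure_def distr_distr comp_def)
  then have "wasserstein1 (empirical_measure n x) (empirical_measure n y)
      \<le> (\<integral>\<^sup>+ z. ennreal (dist (fst z) (snd z)) \<partial>?\<pi>)"
    unfolding wasserstein1_def by (rule INF_lower)
  also have "\<dots> = (\<integral>\<^sup>+ i. ennreal (norm (x i - y i)) \<partial>?u)"
    using xy by (subst nn_integral_distr) (auto simp: dist_norm)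
  also have "\<dots> = (\<Sum>i<n. ennreal (1 / n) * ennreal (norm (x i - y i)))"
    unfolding uniform_count_measure_def by (subst nn_integral_point_measure_finite) auto
  also have "\<dots> = (\<Sum>i<n. ennreal (norm (x i - y i) / n))"
    by (simp flip: ennreal_mult)
  also have "\<dots> = ennreal ((\<Sum>i<n. norm (x i - y i)) / n)"
    by (simp add: sum_ennreal sum_divide_distrib)
  finally show ?thesis .
qed

section \<open>A linear integral inequality\<close>

lemma set_integral_sum:
  fixes f :: "'i \<Rightarrow> 'a \<Rightarrow> real"
  assumes "\<And>i. i \<in> I \<Longrightarrow> set_integrable M A (f i)"
  shows "(LINT s:A|M. \<Sum>i\<in>I. f i s) = (\<Sum>i\<in>I. LINT s:A|M. f i s)"
  using assms unfolding set_lebesgue_integral_def set_integrable_def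
  by (simp add: sum_distrib_left)

text \<open>The linear integral inequality is solved by comparing \<open>u t\<close> with \<open>exp (k t)\<close> at the time where
  the quotient is maximal.\<close>

lemma gronwall_bound:
  fixes u :: "real \<Rightarrow> real"
  assumes "0 \<le> T" "0 \<le> L" "0 \<le> A" and cont: "continuous_on {0..T} u"
    and nonneg: "\<And>t. t \<in> {0..T} \<Longrightarrow> 0 \<le> u t"
    and ineq: "\<And>t. t \<in> {0..T} \<Longrightarrow> u t \<le> A + (LINT s:{0..t}|lborel. L * u s)"
    and t: "t \<in> {0..T}"
  shows "u t \<le> 2 * A * exp ((2 * L + 1) * T)"
proof -
  \<comment> \<open>With \<open>k \<ge> 2 * L\<close> the integral is at most half of
    \<open>u t0\<close> and can be moved to the left; the summand \<open>1\<close> keeps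
    \<open>k\<close> positive when \<open>L = 0\<close>.\<close>
  define k where "k = 2 * L + 1"
  have k: "0 < k" "2 * L \<le> k" using \<open>0 \<le> L\<close> by (auto simp: k_def)
  have "continuous_on {0..T} (\<lambda>s. u s * exp (- k * s))" by (intro continuous_intros cont)
  then have "\<exists>x\<in>{0..T}. \<forall>y\<in>{0..T}. u y * exp (- k * y) \<le> u x * exp (- k * x)"
    using \<open>0 \<le> T\<close> by (intro continuous_attains_sup) auto
  then obtain t0 where t0: "t0 \<in> {0..T}" and max: "\<And>s. s \<in> {0..T} \<Longrightarrow> u s * exp (- k * s) \<le> u t0 * exp (- k * t0)"
    by blast
  define m where "m = u t0 * exp (- k * t0)"
  have u_le: "u s \<le> m * exp (k * s)" if "s \<in> {0..T}" for s
    using mult_right_mono[OF max[OF that], of "exp (k * s)"]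
    by (simp add: m_def mult.assoc flip: exp_add)
  have m0: "0 \<le> m" using nonneg[OF t0] by (simp add: m_def)
  have sub: "{0..t0} \<subseteq> {0..T}" using t0 by auto
  have FTC: "(LINT s:{0..t0}|lborel. L * (m * exp (k * s))) = L * m * exp (k * t0) / k - L * m / k"
    unfolding set_lebesgue_integral_def
  proof (subst integral_FTC_atLeastAtMost[where F="\<lambda>s. L * m * exp (k * s) / k"])
    show "((\<lambda>s. L * m * exp (k * s) / k) has_vector_derivative L * (m * exp (k * x))) (at x within {0..t0})" for x
      unfolding has_real_derivative_iff_has_vector_derivative[symmetric]
      using k by (auto intro!: derivative_eq_intros)
  qed (use t0 in \<open>auto intro!: continuous_intros\<close>)
  have "u t0 \<le> A + (LINT s:{0..t0}|lborel. L * u s)" by (rule ineq[OF t0])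
  also have "(LINT s:{0..t0}|lborel. L * u s) \<le> (LINT s:{0..t0}|lborel. L * (m * exp (k * s)))"
  proof (rule set_integral_mono)
    show "set_integrable lborel {0..t0} (\<lambda>s. L * u s)"
      by (intro borel_integrable_atLeastAtMost' continuous_intros continuous_on_subset[OF cont sub])
    show "set_integrable lborel {0..t0} (\<lambda>s. L * (m * exp (k * s)))"
      by (intro borel_integrable_atLeastAtMost' continuous_intros)
    show "L * u s \<le> L * (m * exp (k * s))" if "s \<in> {0..t0}" for s
      using u_le[of s] that sub \<open>0 \<le> L\<close> by (intro mult_left_mono) auto
  qed
  also have "\<dots> \<le> m * exp (k * t0) / 2"
  proof -
    have "L * m * exp (k * t0) / k \<le> m * exp (k * t0) / 2"
      using mult_right_mono[OF k(2), of "m * exp (k * t0)"] k m0 by (simp add: field_simps)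
    moreover have "0 \<le> L * m / k" using \<open>0 \<le> L\<close> m0 k by simp
    ultimately show ?thesis unfolding FTC by linarith
  qed
  also have "m * exp (k * t0) = u t0" by (simp add: m_def mult.assoc flip: exp_add)
  finally have "u t0 \<le> 2 * A" by simp
  moreover have "m \<le> u t0 * 1"
    unfolding m_def using nonneg[OF t0] k t0 by (intro mult_left_mono) auto
  ultimately have "m \<le> 2 * A" by simp
  then have "m * exp (k * t) \<le> 2 * A * exp (k * T)"
    using t k \<open>0 \<le> A\<close> by (intro mult_mono) auto
  then show ?thesis using u_le[OF t] by (simp add: k_def)
qed

section \<open>Stability of the particle system\<close>

text \<open>Gronwall's inequality applies to the sum \<open>u t\<close> of the distances at one
  time, with rate \<open>2 * L\<close>: one \<open>L\<close> for the own distance of each particle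
  and one for the average \<open>u / n\<close>. Since \<open>paths_norm1\<close> is a sum of suprema
  and not a supremum of sums, the bound on \<open>u\<close> is then put back into the estimate for
  each particle, which gives the factor \<open>4 * L * T\<close>.\<close>

lemma particle_system_stability:
  fixes X X' Z Z' :: "nat \<Rightarrow> real \<Rightarrow> real ^ 'd::finite"
    and b :: "real \<Rightarrow> real ^ 'd \<Rightarrow> (real ^ 'd) measure \<Rightarrow> real ^ 'd"
  assumes "0 < T" "0 \<le> L" "n \<ge> 1"
    and b_lipschitz: "\<And>t x x' m m'.
      t \<in> {0..T} \<Longrightarrow> m \<in> finite_mean_measures \<Longrightarrow> m' \<in> finite_mean_measures \<Longrightarrow>
      ennreal (norm (b t x m - b t x' m')) \<le> ennreal L * (ennreal (norm (x - x')) + wasserstein1 m m')"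
    and X: "X \<in> path_tuples n T" and X': "X' \<in> path_tuples n T"
    and Z: "Z \<in> bounded_tuples n T" and Z': "Z' \<in> bounded_tuples n T"
    and int: "\<And>i. i < n \<Longrightarrow> set_integrable lborel {0..T} (\<lambda>s. b s (X i s) (empirical_measure n (\<lambda>j. X j s)))"
    and int': "\<And>i. i < n \<Longrightarrow> set_integrable lborel {0..T} (\<lambda>s. b s (X' i s) (empirical_measure n (\<lambda>j. X' j s)))"
    and eq: "\<And>i t. i < n \<Longrightarrow> t \<in> {0..T} \<Longrightarrow>
      X i t = Z i t + (LINT s:{0..t}|lborel. b s (X i s) (empirical_measure n (\<lambda>j. X j s)))"
    and eq': "\<And>i t. i < n \<Longrightarrow> t \<in> {0..T} \<Longrightarrow>
      X' i t = Z' i t + (LINT s:{0..t}|lborel. b s (X' i s) (empirical_measure n (\<lambda>j. X' j s)))"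
  shows "paths_norm1 n T (\<lambda>i t. X i t - X' i t)
    \<le> (1 + 4 * L * T * exp ((4 * L + 1) * T)) * paths_norm1 n T (\<lambda>i t. Z i t - Z' i t)"
proof -
  define A where "A = paths_norm1 n T (\<lambda>i t. Z i t - Z' i t)"
  define u where "u = (\<lambda>t. \<Sum>i<n. norm (X i t - X' i t))"
  define v where "v = (\<lambda>i t. L * (norm (X i t - X' i t) + u t / n))"
  have dZ: "(\<lambda>i t. Z i t - Z' i t) \<in> bounded_tuples n T" by (rule bounded_tuples_diff[OF Z Z'])
  have A0: "0 \<le> A" unfolding A_def using \<open>0 < T\<close> by (intro paths_norm1_nonneg[OF _ dZ]) simp
  have cont: "continuous_on {0..T} (X i)" "continuous_on {0..T} (X' i)" if "i < n" for i
    using X X' that unfolding path_tuples_def by blast+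
  have cont_u: "continuous_on {0..T} u"
    unfolding u_def by (intro continuous_on_sum continuous_on_norm continuous_on_diff cont) auto
  have cont_v: "continuous_on {0..T} (v i)" if "i < n" for i
    unfolding v_def using \<open>n \<ge> 1\<close> that
    by (intro continuous_on_mult continuous_on_add continuous_on_norm continuous_on_diff
        continuous_on_divide continuous_on_const cont cont_u) auto
  have u0: "0 \<le> u t" for t unfolding u_def by (intro sum_nonneg) auto
  have v_int: "set_integrable lborel {0..t} (v i)" if "i < n" "t \<in> {0..T}" for i t
    using that by (intro borel_integrable_atLeastAtMost' continuous_on_subset[OF cont_v]) auto
  have sum_v_int: "(\<Sum>i<n. LINT s:{0..t}|lborel. v i s) = (LINT s:{0..t}|lborel. \<Sum>i<n. v i s)"
    if "t \<in> {0..T}" for t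
    by (rule set_integral_sum[symmetric]) (use v_int that in auto)
  have sum_v: "(\<Sum>i<n. v i t) = 2 * L * u t" for t
  proof -
    have "(\<Sum>i<n. v i t) = L * (u t + (\<Sum>i<n. u t / n))"
      unfolding v_def sum_distrib_left[symmetric] sum.distrib by (simp add: u_def)
    also have "(\<Sum>i<n. u t / n) = u t" using \<open>n \<ge> 1\<close> by simp
    finally show ?thesis by simp
  qed
  have drift: "norm (b s (X i s) (empirical_measure n (\<lambda>j. X j s)) - b s (X' i s) (empirical_measure n (\<lambda>j. X' j s))) \<le> v i s"
    if "s \<in> {0..T}" for i s
  proof -
    have "ennreal (norm (b s (X i s) (empirical_measure n (\<lambda>j. X j s)) - b s (X' i s) (empirical_measure n (\<lambda>j. X' j s))))
      \<le> ennreal L * (ennreal (norm (X i s - X' i s))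
          + wasserstein1 (empirical_measure n (\<lambda>j. X j s)) (empirical_measure n (\<lambda>j. X' j s)))"
      by (intro b_lipschitz that empirical_measure_in_finite_mean_measures \<open>n \<ge> 1\<close>)
    also have "\<dots> \<le> ennreal L * (ennreal (norm (X i s - X' i s)) + ennreal (u s / n))"
      unfolding u_def by (intro mult_left_mono add_left_mono wasserstein1_empirical_measure_le \<open>n \<ge> 1\<close>) auto
    also have "\<dots> = ennreal (v i s)"
      unfolding v_def using \<open>0 \<le> L\<close> u0[of s] by (simp flip: ennreal_mult ennreal_plus)
    finally show ?thesis
      using \<open>0 \<le> L\<close> u0[of s] by (simp add: v_def ennreal_le_iff)
  qed
  have pointwise: "norm (X i t - X' i t) \<le> path_norm T (\<lambda>t. Z i t - Z' i t) + (LINT s:{0..t}|lborel. v i s)"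
    if i: "i < n" and t: "t \<in> {0..T}" for i t
  proof -
    let ?b = "\<lambda>s. b s (X i s) (empirical_measure n (\<lambda>j. X j s))"
    let ?b' = "\<lambda>s. b s (X' i s) (empirical_measure n (\<lambda>j. X' j s))"
    have ib: "set_integrable lborel {0..t} ?b" "set_integrable lborel {0..t} ?b'"
      using t by (auto intro: set_integrable_subset[OF int[OF i]] set_integrable_subset[OF int'[OF i]])
    have "X i t - X' i t = (Z i t - Z' i t) + (LINT s:{0..t}|lborel. ?b s - ?b' s)"
      unfolding eq[OF i t] eq'[OF i t] using ib by simp
    then have "norm (X i t - X' i t) \<le> norm (Z i t - Z' i t) + norm (LINT s:{0..t}|lborel. ?b s - ?b' s)"
      by (simp only: norm_triangle_ineq)
    also have "norm (LINT s:{0..t}|lborel. ?b s - ?b' s) \<le> (LINT s:{0..t}|lborel. norm (?b s - ?b' s))"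
      by (intro set_integral_norm_bound set_integral_diff ib)
    also have "\<dots> \<le> (LINT s:{0..t}|lborel. v i s)"
      using t by (intro set_integral_mono set_integrable_norm set_integral_diff ib v_int i drift) auto
    also have "norm (Z i t - Z' i t) \<le> path_norm T (\<lambda>t. Z i t - Z' i t)"
      using dZ i t by (intro norm_le_path_norm[of "\<lambda>t. Z i t - Z' i t"]) (auto simp: bounded_tuples_def)
    finally show ?thesis by simp
  qed
  have u_bound: "u t \<le> 2 * A * exp ((4 * L + 1) * T)" if t: "t \<in> {0..T}" for t
  proof -
    have "u t \<le> A + (LINT s:{0..t}|lborel. (2 * L) * u s)" if t: "t \<in> {0..T}" for t
    proof -
      have "u t \<le> (\<Sum>i<n. path_norm T (\<lambda>t. Z i t - Z' i t) + (LINT s:{0..t}|lborel. v i s))"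
        unfolding u_def using t by (intro sum_mono pointwise) auto
      also have "\<dots> = A + (LINT s:{0..t}|lborel. \<Sum>i<n. v i s)"
        by (simp add: sum.distrib A_def paths_norm1_def sum_v_int[OF t])
      finally show ?thesis by (simp add: sum_v)
    qed
    from gronwall_bound[OF _ _ A0 cont_u u0 this t] show ?thesis
      using \<open>0 < T\<close> \<open>0 \<le> L\<close> by simp
  qed
  have "paths_norm1 n T (\<lambda>i t. X i t - X' i t)
      \<le> (\<Sum>i<n. path_norm T (\<lambda>t. Z i t - Z' i t) + (LINT s:{0..T}|lborel. v i s))"
    unfolding paths_norm1_def
  proof (intro sum_mono path_norm_le)
    fix i t assume i: "i \<in> {..<n}" and t: "t \<in> {0..T}"
    have v0: "0 \<le> v i s" for s unfolding v_def using \<open>0 \<le> L\<close> u0[of s] by simp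
    \<comment> \<open>Extending the integral to \<open>T\<close> makes the bound independent of
      \<open>t\<close> before the supremum over \<open>t\<close> is taken.\<close>
    have "(LINT s:{0..t}|lborel. v i s) \<le> (LINT s:{0..T}|lborel. v i s)"
      unfolding set_lebesgue_integral_def
      using v_int[of i t] v_int[of i T] i t v0 \<open>0 < T\<close>
      by (intro integral_mono) (auto simp: set_integrable_def split: split_indicator)
    then show "norm (X i t - X' i t) \<le> path_norm T (\<lambda>t. Z i t - Z' i t) + (LINT s:{0..T}|lborel. v i s)"
      using pointwise[of i t] i t by simp
  qed (use \<open>0 < T\<close> in simp)
  also have "\<dots> = A + (LINT s:{0..T}|lborel. \<Sum>i<n. v i s)"
    using \<open>0 < T\<close> by (simp add: sum.distrib A_def paths_norm1_def sum_v_int)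
  also have "(LINT s:{0..T}|lborel. \<Sum>i<n. v i s) \<le> (LINT s:{0..T}|lborel. 2 * L * (2 * A * exp ((4 * L + 1) * T)))"
    unfolding sum_v
  proof (rule set_integral_mono)
    show "2 * L * u s \<le> 2 * L * (2 * A * exp ((4 * L + 1) * T))" if "s \<in> {0..T}" for s
      using u_bound[OF that] \<open>0 \<le> L\<close> by (intro mult_left_mono) auto
  qed (intro borel_integrable_atLeastAtMost' continuous_intros cont_u)+
  also have "\<dots> = T * (2 * L * (2 * A * exp ((4 * L + 1) * T)))"
    using \<open>0 < T\<close> by (simp add: set_lebesgue_integral_def)
  finally show ?thesis by (simp add: A_def algebra_simps)
qed

section \<open>Discretisation of paths\<close>

definition grid_index :: "real \<Rightarrow> nat \<Rightarrow> real \<Rightarrow> nat" where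
  "grid_index T N t = nat \<lfloor>t * real N / T\<rfloor>"

text \<open>Sampling at left grid points; the time \<open>T\<close> is itself a grid point, so
  \<open>N + 1\<close> values are involved.\<close>

definition step_path :: "real \<Rightarrow> nat \<Rightarrow> (real \<Rightarrow> 'b) \<Rightarrow> real \<Rightarrow> 'b" where
  "step_path T N x t = x (T * real (grid_index T N t) / real N)"

lemma grid_index_le:
  assumes "0 < T" "t \<in> {0..T}"
  shows "grid_index T N t \<le> N"
proof -
  have "t * real N / T \<le> real N"
    using assms by (simp add: divide_le_eq mult.commute mult_right_mono)
  then have "\<lfloor>t * real N / T\<rfloor> \<le> int N" by linarith
  then show ?thesis by (simp add: grid_index_def)
qed

lemma grid_point_in:
  assumes "0 < T" "0 < N" "j \<le> N"
  shows "T * real j / real N \<in> {0..T}"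
  using assms by (auto simp: field_simps)

lemma grid_point_near:
  assumes "0 < T" "0 < N" "t \<in> {0..T}"
  shows "\<bar>T * real (grid_index T N t) / real N - t\<bar> \<le> T / real N"
proof -
  define y where "y = t * real N / T"
  have "0 \<le> y" using assms by (simp add: y_def)
  then have "real (grid_index T N t) = of_int \<lfloor>y\<rfloor>" by (simp add: grid_index_def y_def)
  then have "\<bar>real (grid_index T N t) - y\<bar> \<le> 1" by linarith
  then have "T / real N * \<bar>real (grid_index T N t) - y\<bar> \<le> T / real N * 1"
    using assms by (intro mult_left_mono) auto
  moreover have "T / real N * \<bar>real (grid_index T N t) - y\<bar> = \<bar>T / real N * (real (grid_index T N t) - y)\<bar>"
    using assms by (simp add: abs_mult)
  moreover have "T / real N * (real (grid_index T N t) - y) = T * real (grid_index T N t) / real N - t"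
    using assms by (simp add: y_def field_simps)
  ultimately show ?thesis by (simp only: mult_1_right)
qed

lemma grid_tuple_in_bounded_tuples:
  fixes v :: "nat \<Rightarrow> nat \<Rightarrow> 'b::real_normed_vector"
  assumes "0 < T"
  shows "(\<lambda>i t. v i (grid_index T N t)) \<in> bounded_tuples n T"
proof -
  have "(\<lambda>t. v i (grid_index T N t)) ` {0..T} \<subseteq> v i ` {..N}" for i
    using grid_index_le[OF assms] by auto
  then have "finite ((\<lambda>t. v i (grid_index T N t)) ` {0..T})" for i
    by (rule finite_subset) simp
  then show ?thesis by (auto simp: bounded_tuples_def intro: finite_imp_bounded)
qed

lemma step_path_in_bounded_tuples:
  "0 < T \<Longrightarrow> (\<lambda>i. step_path T N (x i)) \<in> bounded_tuples n T"
  using grid_tuple_in_bounded_tuples[where v="\<lambda>i j. x i (T * real j / real N)"]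
  by (simp add: step_path_def[abs_def])

lemma lipschitz_bounded_tuplesD:
  assumes "lipschitz_bounded_tuples n T C F" "x \<in> bounded_tuples n T" "y \<in> bounded_tuples n T"
  shows "\<bar>F x - F y\<bar> \<le> C * paths_norm1 n T (\<lambda>i t. x i t - y i t)"
  using assms by (simp add: lipschitz_bounded_tuples_def)

text \<open>The arguments of \<open>F\<close> are total functions indexed by all naturals. This
  confines its dependence to the first \<open>n\<close> members and to times in
  \<open>[0, T]\<close>.\<close>

lemma lipschitz_bounded_tuples_cong:
  assumes F: "lipschitz_bounded_tuples n T C F" and "0 \<le> T"
    and x: "x \<in> bounded_tuples n T" and y: "y \<in> bounded_tuples n T"
    and eq: "\<And>i t. i < n \<Longrightarrow> t \<in> {0..T} \<Longrightarrow> x i t = y i t"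
  shows "F x = F y"
proof -
  have "paths_norm1 n T (\<lambda>i t. x i t - y i t) = 0"
    unfolding paths_norm1_def path_norm_def using eq \<open>0 \<le> T\<close> by simp
  then show ?thesis using lipschitz_bounded_tuplesD[OF F x y] by simp
qed

lemma paths_norm1_grid_le:
  fixes v w :: "nat \<Rightarrow> nat \<Rightarrow> 'b::real_normed_vector"
  assumes "0 < T" "\<And>i j. i < n \<Longrightarrow> j \<le> N \<Longrightarrow> norm (v i j - w i j) \<le> d i"
  shows "paths_norm1 n T (\<lambda>i t. v i (grid_index T N t) - w i (grid_index T N t)) \<le> (\<Sum>i<n. d i)"
  unfolding paths_norm1_def
  using assms grid_index_le[OF \<open>0 < T\<close>] by (intro sum_mono path_norm_le) auto

text \<open>Only grid values are compared, so a change in one noise coordinate is charged to a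
  single \<open>d i\<close>.\<close>

lemma lipschitz_step_le:
  assumes F: "lipschitz_bounded_tuples n T C F" and "0 < T" "0 \<le> C"
    and d: "\<And>i j. i < n \<Longrightarrow> j \<le> N \<Longrightarrow> norm (x i (T * real j / real N) - y i (T * real j / real N)) \<le> d i"
  shows "\<bar>F (\<lambda>i. step_path T N (x i)) - F (\<lambda>i. step_path T N (y i))\<bar> \<le> C * (\<Sum>i<n. d i)"
proof -
  have "\<bar>F (\<lambda>i. step_path T N (x i)) - F (\<lambda>i. step_path T N (y i))\<bar>
      \<le> C * paths_norm1 n T (\<lambda>i t. step_path T N (x i) t - step_path T N (y i) t)"
    by (rule lipschitz_bounded_tuplesD[OF F step_path_in_bounded_tuples step_path_in_bounded_tuples, OF \<open>0 < T\<close> \<open>0 < T\<close>])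
  also have "\<dots> \<le> C * (\<Sum>i<n. d i)"
    unfolding step_path_def
    by (intro mult_left_mono \<open>0 \<le> C\<close>
        paths_norm1_grid_le[where v="\<lambda>i j. x i (T * real j / real N)" and w="\<lambda>i j. y i (T * real j / real N)"]
        \<open>0 < T\<close> d)
  finally show ?thesis .
qed

lemma step_path_uniform_limit:
  fixes x :: "real \<Rightarrow> 'b::real_normed_vector"
  assumes "0 < T" and cont: "continuous_on {0..T} x" and "0 < \<epsilon>"
  shows "\<forall>\<^sub>F N in sequentially. path_norm T (\<lambda>t. step_path T N x t - x t) \<le> \<epsilon>"
proof -
  have "uniformly_continuous_on {0..T} x"
    by (rule compact_uniformly_continuous[OF cont compact_Icc])
  then obtain d where d: "0 < d" "\<And>t s. t \<in> {0..T} \<Longrightarrow> s \<in> {0..T} \<Longrightarrow> dist s t < d \<Longrightarrow> dist (x s) (x t) < \<epsilon>"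
    using \<open>0 < \<epsilon>\<close> by (rule uniformly_continuous_onE) (rule that)
  obtain N0 :: nat where N0: "T / d < real N0" using reals_Archimedean2 by blast
  show ?thesis
    using eventually_ge_at_top[of N0]
  proof eventually_elim
    case (elim N)
    have "0 < T / d" using d \<open>0 < T\<close> by simp
    moreover have "real N0 \<le> real N" using elim by simp
    ultimately have N: "0 < N" "T / d < real N" using N0 by (simp, linarith)+
    then have "T / real N < d" using d by (simp add: field_simps)
    show ?case
    proof (rule path_norm_le)
      fix t assume t: "t \<in> {0..T}"
      let ?s = "T * real (grid_index T N t) / real N"
      have "?s \<in> {0..T}" by (intro grid_point_in \<open>0 < T\<close> N grid_index_le t)
      moreover have "dist ?s t < d"
        using grid_point_near[OF \<open>0 < T\<close> N(1) t] \<open>T / real N < d\<close> by (simp add: dist_real_def)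
      ultimately have "dist (x ?s) (x t) < \<epsilon>" by (intro d(2) t)
      then show "norm (step_path T N x t - x t) \<le> \<epsilon>" by (simp add: step_path_def dist_norm)
    qed (use \<open>0 < T\<close> in simp)
  qed
qed

lemma lipschitz_step_path_tendsto:
  assumes F: "lipschitz_bounded_tuples n T C F" and "0 < T" "0 \<le> C" and x: "x \<in> path_tuples n T"
  shows "(\<lambda>N. F (\<lambda>i. step_path T N (x i))) \<longlonglongrightarrow> F x"
proof -
  have xb: "x \<in> bounded_tuples n T" using x path_tuples_subset_bounded_tuples by auto
  have lim: "(\<lambda>N. path_norm T (\<lambda>t. step_path T N (x i) t - x i t)) \<longlonglongrightarrow> 0" if "i < n" for i
  proof (rule tendstoI)
    fix \<epsilon> :: real assume "0 < \<epsilon>"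
    have cont: "continuous_on {0..T} (x i)" using x that by (simp add: path_tuples_def)
    have nonneg: "0 \<le> path_norm T (\<lambda>t. step_path T N (x i) t - x i t)" for N
    proof (rule path_norm_nonneg)
      show "bounded ((\<lambda>t. step_path T N (x i) t - x i t) ` {0..T})"
        using bounded_tuples_diff[OF step_path_in_bounded_tuples[OF \<open>0 < T\<close>] xb, of N x] that
        unfolding bounded_tuples_def by simp
    qed (use \<open>0 < T\<close> in simp)
    show "\<forall>\<^sub>F N in sequentially. dist (path_norm T (\<lambda>t. step_path T N (x i) t - x i t)) 0 < \<epsilon>"
      using step_path_uniform_limit[OF \<open>0 < T\<close> cont half_gt_zero[OF \<open>0 < \<epsilon>\<close>]]
    proof eventually_elim
      case (elim N)
      then show ?case using nonneg[of N] \<open>0 < \<epsilon>\<close> by (simp add: dist_real_def)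
    qed
  qed
  have "(\<lambda>N. C * paths_norm1 n T (\<lambda>i t. step_path T N (x i) t - x i t)) \<longlonglongrightarrow> C * (\<Sum>i<n. 0)"
    unfolding paths_norm1_def by (intro tendsto_mult tendsto_const tendsto_sum lim) simp
  then have "(\<lambda>N. C * paths_norm1 n T (\<lambda>i t. step_path T N (x i) t - x i t)) \<longlonglongrightarrow> 0" by simp
  moreover have "\<forall>\<^sub>F N in sequentially. norm (F (\<lambda>i. step_path T N (x i)) - F x)
      \<le> C * paths_norm1 n T (\<lambda>i t. step_path T N (x i) t - x i t)"
    unfolding real_norm_def
    by (intro always_eventually allI lipschitz_bounded_tuplesD[OF F step_path_in_bounded_tuples[OF \<open>0 < T\<close>] xb])
  ultimately have "(\<lambda>N. F (\<lambda>i. step_path T N (x i)) - F x) \<longlonglongrightarrow> 0"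
    by (rule Lim_null_comparison[rotated])
  then show ?thesis by (simp add: LIM_zero_iff)
qed

text \<open>Along step functions \<open>F\<close> factors through a function \<open>G\<close> of
  finitely many grid values, and the Lipschitz bound makes \<open>G\<close> continuous for the
  product topology, hence Borel.\<close>

lemma lipschitz_step_path_measurable:
  fixes Y :: "nat \<Rightarrow> real \<Rightarrow> 's \<Rightarrow> 'b::{real_normed_vector, second_countable_topology}"
  assumes F: "lipschitz_bounded_tuples n T C F" and "0 < T" "0 \<le> C"
    and Y: "\<And>i j. i < n \<Longrightarrow> j \<le> N \<Longrightarrow> (\<lambda>\<omega>. Y i (T * real j / real N) \<omega>) \<in> borel_measurable S"
  shows "(\<lambda>\<omega>. F (\<lambda>i. step_path T N (\<lambda>t. Y i t \<omega>))) \<in> borel_measurable S"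
proof -
  define G where "G = (\<lambda>v :: nat \<Rightarrow> nat \<Rightarrow> 'b. F (\<lambda>i t. v i (grid_index T N t)))"
  \<comment> \<open>Entries off the grid are set to zero, because measurability of \<open>Y\<close>
    is assumed on the grid only; \<open>F\<close> does not see them.\<close>
  define H where "H = (\<lambda>\<omega> i j. if i < n \<and> j \<le> N then Y i (T * real j / real N) \<omega> else 0)"
  have G_lip: "\<bar>G v - G w\<bar> \<le> C * (\<Sum>i<n. \<Sum>j\<le>N. norm (v i j - w i j))" for v w
  proof -
    have "\<bar>G v - G w\<bar> \<le> C * paths_norm1 n T (\<lambda>i t. v i (grid_index T N t) - w i (grid_index T N t))"
      unfolding G_def by (intro lipschitz_bounded_tuplesD[OF F] grid_tuple_in_bounded_tuples \<open>0 < T\<close>)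
    also have "\<dots> \<le> C * (\<Sum>i<n. \<Sum>j\<le>N. norm (v i j - w i j))"
      by (intro mult_left_mono \<open>0 \<le> C\<close> paths_norm1_grid_le \<open>0 < T\<close>)
         (auto intro!: member_le_sum[where f="\<lambda>j. norm (v _ j - w _ j)"])
    finally show ?thesis .
  qed
  have coord: "continuous_on UNIV (\<lambda>v :: nat \<Rightarrow> nat \<Rightarrow> 'b. v i j)" for i j
    using continuous_on_compose2[OF continuous_on_product_coordinates[of j] continuous_on_product_coordinates[of i]]
    by simp
  have "continuous_on UNIV G"
    unfolding continuous_on_def
  proof
    fix v :: "nat \<Rightarrow> nat \<Rightarrow> 'b"
    have "continuous_on UNIV (\<lambda>w. C * (\<Sum>i<n. \<Sum>j\<le>N. norm (w i j - v i j)))"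
      by (intro continuous_on_mult continuous_on_sum continuous_on_norm continuous_on_diff continuous_on_const coord)
    then have "((\<lambda>w. C * (\<Sum>i<n. \<Sum>j\<le>N. norm (w i j - v i j))) \<longlongrightarrow> 0) (at v within UNIV)"
      unfolding continuous_on_def by (auto dest!: spec[of _ v])
    then have "((\<lambda>w. G w - G v) \<longlongrightarrow> 0) (at v within UNIV)"
      by (rule Lim_null_comparison[rotated]) (use G_lip in \<open>simp add: always_eventually\<close>)
    then show "(G \<longlongrightarrow> G v) (at v within UNIV)" by (simp add: LIM_zero_iff)
  qed
  then have "G \<in> borel_measurable borel" by (rule borel_measurable_continuous_onI)
  moreover have "H \<in> borel_measurable S"
  proof (intro measurable_coordinatewise_then_product)
    show "(\<lambda>\<omega>. H \<omega> i j) \<in> borel_measurable S" for i j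
      using Y[of i j] by (cases "i < n \<and> j \<le> N") (auto simp: H_def)
  qed
  ultimately have "(\<lambda>\<omega>. G (H \<omega>)) \<in> borel_measurable S" by (rule measurable_compose_rev)
  moreover have "G (H \<omega>) = F (\<lambda>i. step_path T N (\<lambda>t. Y i t \<omega>))" for \<omega>
    unfolding G_def
    using \<open>0 < T\<close> grid_index_le[OF \<open>0 < T\<close>, of _ N]
    by (intro lipschitz_bounded_tuples_cong[OF F] grid_tuple_in_bounded_tuples step_path_in_bounded_tuples)
       (auto simp: H_def step_path_def)
  ultimately show ?thesis by simp
qed

section \<open>The law of the noise\<close>

lemma borel_measurable_matrix_vector_mult [measurable (raw)]:
  fixes A :: "real ^ 'd::finite ^ 'd"
  assumes "f \<in> borel_measurable M"
  shows "(\<lambda>x. A *v f x) \<in> borel_measurable M"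
proof (rule measurable_compose[OF assms])
  show "(*v) A \<in> borel_measurable borel"
    by (intro borel_measurable_continuous_onI linear_continuous_on matrix_vector_mul_bounded_linear)
qed

lemma preimages_subset_sets:
  assumes "\<And>i. i \<in> I \<Longrightarrow> Z i \<in> borel_measurable N" "space N = \<Omega>"
  shows "preimages \<Omega> I Z \<subseteq> sets N"
  using assms by (auto simp: preimages_def intro!: measurable_sets)

lemma measurable_sigma_preimages:
  fixes Z :: "'i \<Rightarrow> 'w \<Rightarrow> 'b::topological_space"
  assumes "i \<in> I"
  shows "Z i \<in> borel_measurable (sigma \<Omega> (preimages \<Omega> I Z))"
proof -
  have sub: "preimages \<Omega> I Z \<subseteq> Pow \<Omega>" by (auto simp: preimages_def)
  show ?thesis
  proof (rule measurableI)
    fix A :: "'b set" assume "A \<in> sets borel"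
    then have "Z i -` A \<inter> \<Omega> \<in> preimages \<Omega> I Z" using assms by (auto simp: preimages_def)
    then show "Z i -` A \<inter> space (sigma \<Omega> (preimages \<Omega> I Z)) \<in> sets (sigma \<Omega> (preimages \<Omega> I Z))"
      using sub by (simp add: space_measure_of_conv sets_measure_of)
  qed simp
qed

section \<open>Domination, joint law and concentration of the noise\<close>

context prob_space
begin

text \<open>The maxima \<open>m l\<close> increase with the level, so monotone convergence carries
  the level-free bound of \<open>wiener_exp_square_maximal\<close> over to the supremum. Only
  countably many times enter, which keeps the supremum measurable.\<close>

lemma wiener_dyadic_dominated:
  fixes W :: "real \<Rightarrow> 'a \<Rightarrow> real ^ 'd::finite"
  assumes W: "standard_wiener T W" and "0 < T"
  obtains w where "integrable M w"
    "AE \<omega> in M. \<forall>l. \<forall>j\<le>2 ^ l. norm (W (T * real j / real (2 ^ l)) \<omega>) \<le> w \<omega>"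
proof -
  define c where "c = 1 / (8 * T)"
  define m where "m = (\<lambda>l \<omega>. Max ((\<lambda>j. norm (W (T * real j / real (2 ^ l)) \<omega>)) ` {..(2::nat) ^ l}))"
  define V where "V = (\<lambda>l \<omega>. ennreal (exp (c * (m l \<omega>)\<^sup>2)))"
  have c: "0 < c" using \<open>0 < T\<close> by (simp add: c_def)
  have m_ge: "norm (W (T * real j / real (2 ^ l)) \<omega>) \<le> m l \<omega>" if "j \<le> 2 ^ l" for j l \<omega>
    unfolding m_def using that by (intro Max_ge) auto
  have m0: "0 \<le> m l \<omega>" for l \<omega> by (rule order_trans[OF norm_ge_zero m_ge[of 0]]) simp
  have m_Suc: "m l \<omega> \<le> m (Suc l) \<omega>" for l \<omega>
  proof -
    have "m l \<omega> \<in> (\<lambda>j. norm (W (T * real j / real (2 ^ l)) \<omega>)) ` {..(2::nat) ^ l}"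
      unfolding m_def by (rule Max_in) auto
    then obtain j where j: "j \<in> {..(2::nat) ^ l}" "m l \<omega> = norm (W (T * real j / real (2 ^ l)) \<omega>)"
      by (rule imageE) simp
    \<comment> \<open>Nesting: point \<open>j\<close> of one level is point \<open>2 * j\<close> of
      the next.\<close>
    have "T * real j / real (2 ^ l) = T * real (2 * j) / real (2 ^ Suc l)" by simp
    then show ?thesis using m_ge[of "2 * j" "Suc l" \<omega>] j by simp
  qed
  have V_inc: "incseq V"
    unfolding V_def using c m0 m_Suc
    by (intro incseq_SucI le_funI ennreal_leI) (auto intro!: mult_left_mono power_mono)
  have W_meas: "W (T * real j / real (2 ^ l)) \<in> borel_measurable M" if "j \<le> 2 ^ l" for j l
    using W grid_point_in[OF \<open>0 < T\<close> _ that] by (simp add: standard_wiener_def)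
  have m_meas [measurable]: "m l \<in> borel_measurable M" for l
    unfolding m_def
  proof (rule borel_measurable_Max)
    fix j assume "j \<in> {..(2::nat) ^ l}"
    then have [measurable]: "W (T * real j / real (2 ^ l)) \<in> borel_measurable M" by (intro W_meas) simp
    show "(\<lambda>\<omega>. norm (W (T * real j / real (2 ^ l)) \<omega>)) \<in> borel_measurable M" by measurable
  qed simp
  have V_meas [measurable]: "V l \<in> borel_measurable M" for l unfolding V_def by measurable
  let ?S = "\<lambda>\<omega>. SUP l. V l \<omega>"
  have "(\<integral>\<^sup>+ \<omega>. ?S \<omega> \<partial>M) = (SUP l. \<integral>\<^sup>+ \<omega>. V l \<omega> \<partial>M)"
    by (rule nn_integral_monotone_convergence_SUP[OF V_inc]) measurable
  also have "\<dots> \<le> ennreal (4 * sqrt 2 ^ CARD('d))"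
    unfolding V_def m_def c_def by (intro SUP_least wiener_exp_square_maximal[OF W \<open>0 < T\<close>]) simp
  finally have fin: "(\<integral>\<^sup>+ \<omega>. ?S \<omega> \<partial>M) < \<infinity>" by (rule order_le_less_trans) simp
  have S_meas [measurable]: "?S \<in> borel_measurable M" by measurable
  have ae: "AE \<omega> in M. ?S \<omega> \<noteq> \<infinity>" using fin by (intro nn_integral_noteq_infinite) auto
  have "integrable M (\<lambda>\<omega>. enn2real (?S \<omega>))"
  proof (rule integrableI_bounded)
    have "(\<integral>\<^sup>+ \<omega>. ennreal (norm (enn2real (?S \<omega>))) \<partial>M) \<le> (\<integral>\<^sup>+ \<omega>. ?S \<omega> \<partial>M)"
      by (intro nn_integral_mono) (simp add: ennreal_enn2real_if)
    then show "(\<integral>\<^sup>+ \<omega>. ennreal (norm (enn2real (?S \<omega>))) \<partial>M) < \<infinity>" using fin by (rule order_le_less_trans)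
  qed measurable
  \<comment> \<open>The form of this function comes from \<open>x \<le> 1 + x\<^sup>2\<close> and
    \<open>c * x\<^sup>2 \<le> exp (c * x\<^sup>2)\<close>.\<close>
  then have "integrable M (\<lambda>\<omega>. 1 + enn2real (?S \<omega>) / c)" by simp
  moreover have "AE \<omega> in M. \<forall>l. \<forall>j\<le>2 ^ l. norm (W (T * real j / real (2 ^ l)) \<omega>) \<le> 1 + enn2real (?S \<omega>) / c"
    using ae
  proof eventually_elim
    case (elim \<omega>)
    have "m l \<omega> \<le> 1 + enn2real (?S \<omega>) / c" for l
    proof -
      have "V l \<omega> \<le> ?S \<omega>" by (rule SUP_upper) simp
      moreover have "?S \<omega> < \<top>" using elim unfolding infinity_ennreal_def less_top .
      ultimately have "enn2real (V l \<omega>) \<le> enn2real (?S \<omega>)" by (rule enn2real_mono)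
      then have "exp (c * (m l \<omega>)\<^sup>2) \<le> enn2real (?S \<omega>)" by (simp add: V_def)
      moreover have "c * (m l \<omega>)\<^sup>2 \<le> exp (c * (m l \<omega>)\<^sup>2)"
        using exp_ge_add_one_self[of "c * (m l \<omega>)\<^sup>2"] by linarith
      ultimately have "(m l \<omega>)\<^sup>2 \<le> enn2real (?S \<omega>) / c" using c by (simp add: field_simps)
      moreover have "m l \<omega> \<le> 1 + (m l \<omega>)\<^sup>2"
        using sum_squares_bound[of 1 "m l \<omega>"] m0[of l \<omega>] unfolding power_one mult_1_right by linarith
      ultimately show ?thesis by linarith
    qed
    then show ?case using m_ge order_trans by blast
  qed
  ultimately show ?thesis by (rule that)
qed

text \<open>The law lives on the product space over \<open>[0, T]\<close>, since this is where
  \<open>particle_noise\<close> states the independence of the paths.\<close>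

definition path_law :: "real \<Rightarrow> (real \<Rightarrow> 'a \<Rightarrow> real ^ 'd::finite) \<Rightarrow> (real \<Rightarrow> real ^ 'd) measure" where
  "path_law T W = distr M (\<Pi>\<^sub>M t\<in>{0..T}. borel) (\<lambda>\<omega>. \<lambda>t\<in>{0..T}. W t \<omega>)"

text \<open>Rectangles determine a product law, and on them independence of the preimages is all
  that is needed.\<close>

lemma indep_set_distr_pair:
  assumes "indep_set F G" and X: "X \<in> measurable M S" and Y: "Y \<in> measurable M S'"
    and F: "\<And>A. A \<in> sets S \<Longrightarrow> X -` A \<inter> space M \<in> F"
    and G: "\<And>A. A \<in> sets S' \<Longrightarrow> Y -` A \<inter> space M \<in> G"
  shows "distr M S X \<Otimes>\<^sub>M distr M S' Y = distr M (S \<Otimes>\<^sub>M S') (\<lambda>\<omega>. (X \<omega>, Y \<omega>))"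
proof (rule pair_measure_eqI)
  show "sigma_finite_measure (distr M S X)" "sigma_finite_measure (distr M S' Y)"
    using X Y by (auto intro!: prob_space_imp_sigma_finite prob_space_distr)
  fix A A' assume "A \<in> sets (distr M S X)" "A' \<in> sets (distr M S' Y)"
  then have A: "A \<in> sets S" "A' \<in> sets S'" by auto
  have XY: "(\<lambda>\<omega>. (X \<omega>, Y \<omega>)) \<in> measurable M (S \<Otimes>\<^sub>M S')" using X Y by (rule measurable_Pair)
  have "(\<lambda>\<omega>. (X \<omega>, Y \<omega>)) -` (A \<times> A') \<inter> space M = (X -` A \<inter> space M) \<inter> (Y -` A' \<inter> space M)" by auto
  then show "emeasure (distr M S X) A * emeasure (distr M S' Y) A'
      = emeasure (distr M (S \<Otimes>\<^sub>M S') (\<lambda>\<omega>. (X \<omega>, Y \<omega>))) (A \<times> A')"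
    using A indep_setD[OF assms(1) F[OF A(1)] G[OF A(2)]]
    by (simp add: emeasure_distr X Y XY emeasure_eq_measure flip: ennreal_mult)
qed simp

lemma particle_noise_law:
  fixes \<xi> :: "nat \<Rightarrow> 'a \<Rightarrow> real ^ 'd::finite"
  assumes noise: "particle_noise T \<mu>0 n \<xi> B" and "n \<ge> 1"
  defines "J \<equiv> \<lambda>\<omega>. (\<lambda>i\<in>{..<n}. \<xi> i \<omega>, \<lambda>i\<in>{..<n}. \<lambda>t\<in>{0..T}. B i t \<omega>)"
    and "E \<equiv> (\<Pi>\<^sub>M i\<in>{..<n}. borel) \<Otimes>\<^sub>M (\<Pi>\<^sub>M i\<in>{..<n}. \<Pi>\<^sub>M t\<in>{0..T}. borel)"
  shows "J \<in> measurable M E"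
    and "distr M E J = (\<Pi>\<^sub>M i\<in>{..<n}. \<mu>0) \<Otimes>\<^sub>M (\<Pi>\<^sub>M i\<in>{..<n}. path_law T (B i))"
proof -
  let ?X = "\<lambda>\<omega>. \<lambda>i\<in>{..<n}. \<xi> i \<omega>" and ?Y = "\<lambda>\<omega>. \<lambda>i\<in>{..<n}. \<lambda>t\<in>{0..T}. B i t \<omega>"
  let ?EX = "\<Pi>\<^sub>M i\<in>{..<n}. (borel :: (real ^ 'd) measure)"
  let ?EY = "\<Pi>\<^sub>M i\<in>{..<n}. \<Pi>\<^sub>M t\<in>{0..T}. (borel :: (real ^ 'd) measure)"
  let ?GX = "preimages (space M) {..<n} \<xi>"
  let ?GY = "preimages (space M) ({..<n} \<times> {0..T}) (\<lambda>(i, t). B i t)"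
  have ne: "{..<n} \<noteq> {}" using \<open>n \<ge> 1\<close> by (auto simp: lessThan_empty_iff)
  have iX: "indep_vars (\<lambda>_. borel) \<xi> {..<n}"
    and iY: "indep_vars (\<lambda>_. \<Pi>\<^sub>M t\<in>{0..T}. borel) (\<lambda>i \<omega>. \<lambda>t\<in>{0..T}. B i t \<omega>) {..<n}"
    and iXY: "indep_set (sigma_sets (space M) ?GX) (sigma_sets (space M) ?GY)"
    and \<mu>0: "\<And>i. i < n \<Longrightarrow> distr M borel (\<xi> i) = \<mu>0"
    using noise by (auto simp: particle_noise_def)
  have X: "\<xi> i \<in> borel_measurable M" if "i \<in> {..<n}" for i
    using iX that by (auto simp: indep_vars_def)
  have Y: "(\<lambda>\<omega>. \<lambda>t\<in>{0..T}. B i t \<omega>) \<in> measurable M (\<Pi>\<^sub>M t\<in>{0..T}. borel)" if "i \<in> {..<n}" for i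
    using iY that by (auto simp: indep_vars_def)
  have subX: "?GX \<subseteq> Pow (space M)" and subY: "?GY \<subseteq> Pow (space M)" by (auto simp: preimages_def)
  \<comment> \<open>Measurability for the generated sigma-algebra, and not merely for
    \<open>M\<close>, puts the preimages into the independent families.\<close>
  have mX: "?X \<in> measurable (sigma (space M) ?GX) ?EX"
    by (intro measurable_restrict measurable_sigma_preimages)
  have mY: "?Y \<in> measurable (sigma (space M) ?GY) ?EY"
  proof (intro measurable_restrict)
    fix i t assume "i \<in> {..<n}" "t \<in> {0..T}"
    then have "(i, t) \<in> {..<n} \<times> {0..T}" by simp
    from measurable_sigma_preimages[OF this, of "\<lambda>(i, t). B i t" "space M"]
    show "B i t \<in> borel_measurable (sigma (space M) ?GY)" by simp
  qed
  have rv: "?X \<in> measurable M ?EX" "?Y \<in> measurable M ?EY"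
    by (intro measurable_restrict X Y; simp)+
  have "distr M ?EX ?X \<Otimes>\<^sub>M distr M ?EY ?Y = distr M (?EX \<Otimes>\<^sub>M ?EY) (\<lambda>\<omega>. (?X \<omega>, ?Y \<omega>))"
    using iXY rv
  proof (rule indep_set_distr_pair)
    show "?X -` A \<inter> space M \<in> sigma_sets (space M) ?GX" if "A \<in> sets ?EX" for A
      using measurable_sets[OF mX that] subX by (simp add: space_measure_of_conv sets_measure_of)
    show "?Y -` A \<inter> space M \<in> sigma_sets (space M) ?GY" if "A \<in> sets ?EY" for A
      using measurable_sets[OF mY that] subY by (simp add: space_measure_of_conv sets_measure_of)
  qed
  moreover have "distr M ?EX ?X = (\<Pi>\<^sub>M i\<in>{..<n}. \<mu>0)"
  proof -
    have "distr M ?EX ?X = (\<Pi>\<^sub>M i\<in>{..<n}. distr M borel (\<xi> i))"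
      using indep_vars_iff_distr_eq_PiM'[OF ne X] iX by simp
    also have "\<dots> = (\<Pi>\<^sub>M i\<in>{..<n}. \<mu>0)" using \<mu>0 by (intro PiM_cong) auto
    finally show ?thesis .
  qed
  moreover have "distr M ?EY ?Y = (\<Pi>\<^sub>M i\<in>{..<n}. path_law T (B i))"
    unfolding path_law_def using indep_vars_iff_distr_eq_PiM'[OF ne Y] iY by simp
  ultimately show "distr M E J = (\<Pi>\<^sub>M i\<in>{..<n}. \<mu>0) \<Otimes>\<^sub>M (\<Pi>\<^sub>M i\<in>{..<n}. path_law T (B i))"
    by (simp add: E_def J_def)
  show "J \<in> measurable M E"
    unfolding E_def J_def by (intro measurable_Pair rv)
qed

lemma path_law_prob_space:
  assumes "standard_wiener T W"
  shows "prob_space (path_law T W)"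
  unfolding path_law_def
  by (rule prob_space_distr, rule measurable_restrict) (use assms in \<open>simp add: standard_wiener_def\<close>)

text \<open>With \<open>D\<close> equal to \<open>A\<close> times the maximum, the moment at
  exponent \<open>c = 1 / (8 * T * A\<^sup>2)\<close> is at most
  \<open>m = 4 * sqrt 2 ^ CARD('d)\<close>. The value of \<open>4 * m / c\<close> explains the
  factor \<open>128 = 4 * 4 * 8\<close>.\<close>

lemma sub_gaussian_path_law:
  fixes W :: "real \<Rightarrow> 'a \<Rightarrow> real ^ 'd::finite"
  assumes W: "standard_wiener T W" and "0 < T" "0 < N" "0 < A"
    and f: "f \<in> borel_measurable (path_law T W)"
    and osc: "\<And>u u'. u \<in> space (path_law T W) \<Longrightarrow> u' \<in> space (path_law T W) \<Longrightarrow>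
      \<bar>f u - f u'\<bar> \<le> A * Max ((\<lambda>j. norm (u (T * real j / real N))) ` {..N})
        + A * Max ((\<lambda>j. norm (u' (T * real j / real N))) ` {..N})"
  shows "sub_gaussian (path_law T W) f (128 * sqrt 2 ^ CARD('d) * T * A\<^sup>2)"
proof -
  interpret law: prob_space "path_law T W" by (rule path_law_prob_space[OF W])
  define D where "D = (\<lambda>u :: real \<Rightarrow> real ^ 'd. A * Max ((\<lambda>j. norm (u (T * real j / real N))) ` {..N}))"
  have r: "(\<lambda>\<omega>. \<lambda>t\<in>{0..T}. W t \<omega>) \<in> measurable M (\<Pi>\<^sub>M t\<in>{0..T}. borel)"
    by (rule measurable_restrict) (use W in \<open>simp add: standard_wiener_def\<close>)
  have D_meas: "D \<in> borel_measurable (\<Pi>\<^sub>M t\<in>{0..T}. borel)"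
    unfolding D_def
  proof (intro borel_measurable_times borel_measurable_const borel_measurable_Max)
    fix j assume "j \<in> {..N}"
    then have [measurable]: "(\<lambda>u. u (T * real j / real N)) \<in> borel_measurable (\<Pi>\<^sub>M t\<in>{0..T}. (borel :: (real ^ 'd) measure))"
      using grid_point_in[OF \<open>0 < T\<close> \<open>0 < N\<close>, of j] by (intro measurable_component_singleton) simp
    show "(\<lambda>u. norm (u (T * real j / real N))) \<in> borel_measurable (\<Pi>\<^sub>M t\<in>{0..T}. (borel :: (real ^ 'd) measure))"
      by measurable
  qed simp
  have "sub_gaussian (path_law T W) f (4 * (4 * sqrt 2 ^ CARD('d)) / (1 / (8 * T * A\<^sup>2)))"
  proof (rule law.sub_gaussian_of_square_exponential[where D=D])
    show "D \<in> borel_measurable (path_law T W)" using D_meas by (simp add: path_law_def)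
    show "0 \<le> D u" for u
    proof -
      have "norm (u (T * real 0 / real N)) \<le> Max ((\<lambda>j. norm (u (T * real j / real N))) ` {..N})"
        by (intro Max_ge imageI) auto
      then have "0 \<le> Max ((\<lambda>j. norm (u (T * real j / real N))) ` {..N})"
        by (rule order_trans[OF norm_ge_zero])
      then show ?thesis using \<open>0 < A\<close> by (simp add: D_def)
    qed
    show "\<bar>f u - f u'\<bar> \<le> D u + D u'" if "u \<in> space (path_law T W)" "u' \<in> space (path_law T W)" for u u'
      using osc[OF that] by (simp add: D_def)
    have "(\<integral>\<^sup>+ u. ennreal (exp (1 / (8 * T * A\<^sup>2) * (D u)\<^sup>2)) \<partial>path_law T W)
        = (\<integral>\<^sup>+ \<omega>. ennreal (exp (1 / (8 * T * A\<^sup>2) * (D (\<lambda>t\<in>{0..T}. W t \<omega>))\<^sup>2)) \<partial>M)"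
      unfolding path_law_def using D_meas by (intro nn_integral_distr[OF r]) measurable
    also have "\<dots> = (\<integral>\<^sup>+ \<omega>. ennreal (exp (1 / (8 * T) * (Max ((\<lambda>j. norm (W (T * real j / real N) \<omega>)) ` {..N}))\<^sup>2)) \<partial>M)"
    proof (intro nn_integral_cong)
      fix \<omega>
      have "(\<lambda>j. norm ((\<lambda>t\<in>{0..T}. W t \<omega>) (T * real j / real N))) ` {..N}
          = (\<lambda>j. norm (W (T * real j / real N) \<omega>)) ` {..N}"
        using grid_point_in[OF \<open>0 < T\<close> \<open>0 < N\<close>] by (intro image_cong) auto
      then have "D (\<lambda>t\<in>{0..T}. W t \<omega>) = A * Max ((\<lambda>j. norm (W (T * real j / real N) \<omega>)) ` {..N})"
        by (simp only: D_def)
      then show "ennreal (exp (1 / (8 * T * A\<^sup>2) * (D (\<lambda>t\<in>{0..T}. W t \<omega>))\<^sup>2))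
          = ennreal (exp (1 / (8 * T) * (Max ((\<lambda>j. norm (W (T * real j / real N) \<omega>)) ` {..N}))\<^sup>2))"
        using \<open>0 < A\<close> by (simp add: power_mult_distrib)
    qed
    also have "\<dots> \<le> ennreal (4 * sqrt 2 ^ CARD('d))"
      by (rule wiener_exp_square_maximal[OF W \<open>0 < T\<close> \<open>0 < N\<close>])
    finally show "(\<integral>\<^sup>+ u. ennreal (exp (1 / (8 * T * A\<^sup>2) * (D u)\<^sup>2)) \<partial>path_law T W) \<le> ennreal (4 * sqrt 2 ^ CARD('d))" .
  qed (use f \<open>0 < T\<close> \<open>0 < A\<close> in auto)
  then show ?thesis by (simp add: algebra_simps)
qed

text \<open>The initial states are integrated out first, with the paths frozen, and the paths
  afterwards. Replacing one path moves every grid value of its noise by at most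
  \<open>A * m u + A * m u'\<close>, hence the functional, also after averaging, by at most
  \<open>C\<close> times that. The constant does not involve \<open>N\<close>.\<close>

lemma sub_gaussian_noise_functional:
  fixes \<xi> :: "nat \<Rightarrow> 'a \<Rightarrow> real ^ 'd::finite" and \<sigma> :: "real ^ 'd ^ 'd"
  assumes noise: "particle_noise T \<mu>0 n \<xi> B" and "n \<ge> 1" "0 < T" "0 < N" "0 < C" "0 < A"
    and F: "lipschitz_bounded_tuples n T C F"
    and A: "\<And>x. norm (\<sigma> *v x) \<le> A * norm x"
    and \<mu>0: "prob_space \<mu>0" "sets \<mu>0 = sets borel" "integrable \<mu>0 (\<lambda>x. norm x)" and "0 \<le> \<kappa>"
    and transport: "\<And>\<nu>. prob_space \<nu> \<Longrightarrow> sets \<nu> = sets borel \<Longrightarrow> absolutely_continuous \<mu>0 \<nu> \<Longrightarrow>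
      wasserstein1 \<mu>0 \<nu> \<le> ennreal_sqrt (2 * ennreal \<kappa> * relative_entropy \<nu> \<mu>0)"
  shows "sub_gaussian M (\<lambda>\<omega>. F (\<lambda>i. step_path T N (\<lambda>t. \<xi> i \<omega> + \<sigma> *v B i t \<omega>)))
    (real n * (\<kappa> * C\<^sup>2 / 2 + 128 * sqrt 2 ^ CARD('d) * T * (C * A)\<^sup>2))"
proof -
  define Kx where "Kx = \<kappa> * C\<^sup>2 / 2"
  define Kw where "Kw = 128 * sqrt 2 ^ CARD('d) * T * (C * A)\<^sup>2"
  define r where "r = (\<lambda>j. T * real j / real N)"
  define \<Lambda> where "\<Lambda> = (\<lambda>i. path_law T (B i))"
  define P where "P = (\<Pi>\<^sub>M i\<in>{..<n}. \<mu>0)"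
  define Q where "Q = (\<Pi>\<^sub>M i\<in>{..<n}. \<Lambda> i)"
  define E where "E = (\<Pi>\<^sub>M i\<in>{..<n}. (borel :: (real ^ 'd) measure)) \<Otimes>\<^sub>M
    (\<Pi>\<^sub>M i\<in>{..<n}. \<Pi>\<^sub>M t\<in>{0..T}. (borel :: (real ^ 'd) measure))"
  define J where "J = (\<lambda>\<omega>. (\<lambda>i\<in>{..<n}. \<xi> i \<omega>, \<lambda>i\<in>{..<n}. \<lambda>t\<in>{0..T}. B i t \<omega>))"
  define G where "G = (\<lambda>z :: (nat \<Rightarrow> real ^ 'd) \<times> (nat \<Rightarrow> real \<Rightarrow> real ^ 'd).
    F (\<lambda>i. step_path T N (\<lambda>t. fst z i + \<sigma> *v (snd z i t))))"
  have wiener: "standard_wiener T (B i)" if "i < n" for i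
    using noise that by (simp add: particle_noise_def)
  have r_in: "r j \<in> {0..T}" if "j \<le> N" for j
    unfolding r_def by (rule grid_point_in[OF \<open>0 < T\<close> \<open>0 < N\<close> that])
  have J: "J \<in> measurable M E" and law: "distr M E J = P \<Otimes>\<^sub>M Q"
    unfolding J_def E_def P_def Q_def \<Lambda>_def by (rule particle_noise_law[OF noise \<open>n \<ge> 1\<close>])+
  have setsPQ: "sets (P \<Otimes>\<^sub>M Q) = sets E" unfolding law[symmetric] by (rule sets_distr)
  interpret P: prob_space P unfolding P_def by (intro prob_space_PiM \<mu>0)
  interpret Q: prob_space Q unfolding Q_def \<Lambda>_def by (intro prob_space_PiM path_law_prob_space wiener) simp
  have space_\<mu>0: "space \<mu>0 = UNIV" using sets_eq_imp_space_eq[OF \<mu>0(2)] by simp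
  have G_E: "G \<in> borel_measurable E"
    unfolding G_def
  proof (rule lipschitz_step_path_measurable[OF F \<open>0 < T\<close>])
    fix i j assume ij: "i < n" "j \<le> N"
    have 1: "(\<lambda>z. fst z i) \<in> borel_measurable E"
      unfolding E_def using ij by (intro measurable_compose[OF measurable_fst measurable_component_singleton]) simp
    have "(\<lambda>z. snd z i) \<in> measurable E (\<Pi>\<^sub>M t\<in>{0..T}. (borel :: (real ^ 'd) measure))"
      unfolding E_def using ij by (intro measurable_compose[OF measurable_snd measurable_component_singleton]) simp
    then have 2: "(\<lambda>z. snd z i (r j)) \<in> borel_measurable E"
      by (rule measurable_compose[OF _ measurable_component_singleton]) (rule r_in[OF ij(2)])
    show "(\<lambda>z. fst z i + \<sigma> *v (snd z i (T * real j / real N))) \<in> borel_measurable E"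
      using 1 2 unfolding r_def by (intro borel_measurable_add borel_measurable_matrix_vector_mult)
  qed (use \<open>0 < C\<close> in simp)
  then have G_PQ [measurable]: "G \<in> borel_measurable (P \<Otimes>\<^sub>M Q)"
    using setsPQ by (simp cong: measurable_cong_sets)
  have inner: "sub_gaussian P (\<lambda>x. G (x, w)) (\<Sum>i\<in>{..<n}. Kx)" if w: "w \<in> space Q" for w
    unfolding P_def
  proof (rule sub_gaussian_PiM[where e="\<lambda>i u u'. C * dist u u'"])
    show "(\<lambda>x. G (x, w)) \<in> borel_measurable (\<Pi>\<^sub>M i\<in>{..<n}. \<mu>0)"
      unfolding P_def[symmetric] using w by measurable
    show "sub_gaussian \<mu>0 f Kx"
      if "\<And>u u'. u \<in> space \<mu>0 \<Longrightarrow> u' \<in> space \<mu>0 \<Longrightarrow> \<bar>f u - f u'\<bar> \<le> C * dist u u'" for f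
      unfolding Kx_def
      by (rule transport_entropy_imp_sub_gaussian[OF \<mu>0(1,2) \<open>0 \<le> \<kappa>\<close> transport \<mu>0(3) that \<open>0 < C\<close>])
         (simp_all add: space_\<mu>0)
    fix z :: "nat \<Rightarrow> real ^ 'd" and i u u' assume i: "i \<in> {..<n}"
    \<comment> \<open>A single coordinate changes, so the sum of charges has one nonzero term and
      brings no factor \<open>n\<close>.\<close>
    have "\<bar>G (z(i := u), w) - G (z(i := u'), w)\<bar> \<le> C * (\<Sum>k<n. if k = i then dist u u' else 0)"
      unfolding G_def by (rule lipschitz_step_le[OF F \<open>0 < T\<close>]) (use \<open>0 < C\<close> in \<open>auto simp: dist_norm\<close>)
    then show "\<bar>G (z(i := u), w) - G (z(i := u'), w)\<bar> \<le> C * dist u u'" using i by simp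
  qed (use \<mu>0 in auto)
  define H where "H = (\<lambda>w. \<integral>x. G (x, w) \<partial>P)"
  define m where "m = (\<lambda>u :: real \<Rightarrow> real ^ 'd. Max ((\<lambda>j. norm (u (r j))) ` {..N}))"
  have m: "norm (u (r j)) \<le> m u" if "j \<le> N" for u j
    unfolding m_def using that by (intro Max_ge) auto
  have outer: "sub_gaussian Q H (\<Sum>i\<in>{..<n}. Kw)"
    unfolding Q_def
  proof (rule sub_gaussian_PiM[where e="\<lambda>i u u'. C * A * m u + C * A * m u'"])
    show "prob_space (\<Lambda> i)" if "i \<in> {..<n}" for i
      unfolding \<Lambda>_def using that by (intro path_law_prob_space wiener) simp
    show "H \<in> borel_measurable (\<Pi>\<^sub>M i\<in>{..<n}. \<Lambda> i)"
      unfolding H_def Q_def[symmetric] by measurable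
    show "sub_gaussian (\<Lambda> i) f Kw" if "i \<in> {..<n}" "f \<in> borel_measurable (\<Lambda> i)"
      "\<And>u u'. u \<in> space (\<Lambda> i) \<Longrightarrow> u' \<in> space (\<Lambda> i) \<Longrightarrow> \<bar>f u - f u'\<bar> \<le> C * A * m u + C * A * m u'" for i f
      unfolding Kw_def \<Lambda>_def
    proof (rule sub_gaussian_path_law[OF wiener \<open>0 < T\<close> \<open>0 < N\<close>])
      show "\<bar>f u - f u'\<bar> \<le> C * A * Max ((\<lambda>j. norm (u (T * real j / real N))) ` {..N})
          + C * A * Max ((\<lambda>j. norm (u' (T * real j / real N))) ` {..N})"
        if "u \<in> space (path_law T (B i))" "u' \<in> space (path_law T (B i))" for u u'
        using \<open>\<And>u u'. u \<in> space (\<Lambda> i) \<Longrightarrow> u' \<in> space (\<Lambda> i) \<Longrightarrow> _\<close>[of u u'] that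
        by (simp only: m_def r_def \<Lambda>_def)
    qed (use that \<open>0 < C\<close> \<open>0 < A\<close> in \<open>auto simp: \<Lambda>_def\<close>)
    fix z i u u' assume z: "z \<in> space (\<Pi>\<^sub>M i\<in>{..<n}. \<Lambda> i)" and i: "i \<in> {..<n}"
      and u: "u \<in> space (\<Lambda> i)" "u' \<in> space (\<Lambda> i)"
    have sp: "z(i := v) \<in> space Q" if "v \<in> space (\<Lambda> i)" for v
      using z i that by (auto simp: Q_def space_PiM PiE_iff extensional_def)
    show "\<bar>H (z(i := u)) - H (z(i := u'))\<bar> \<le> C * A * m u + C * A * m u'"
      unfolding H_def
    proof (rule P.integral_diff_le)
      show "integrable P (\<lambda>x. G (x, z(i := u)))" "integrable P (\<lambda>x. G (x, z(i := u')))"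
        by (rule sub_gaussianD(1)[OF inner[OF sp[OF u(1)]]], rule sub_gaussianD(1)[OF inner[OF sp[OF u(2)]]])
      fix x assume "x \<in> space P"
      have "\<bar>G (x, z(i := u)) - G (x, z(i := u'))\<bar> \<le> C * (\<Sum>k<n. if k = i then A * m u + A * m u' else 0)"
        unfolding G_def
      proof (rule lipschitz_step_le[OF F \<open>0 < T\<close>])
        fix k j assume j: "j \<le> N"
        have "norm (\<sigma> *v u (r j) - \<sigma> *v u' (r j)) \<le> norm (\<sigma> *v u (r j)) + norm (\<sigma> *v u' (r j))"
          by (rule norm_triangle_ineq4)
        also have "\<dots> \<le> A * norm (u (r j)) + A * norm (u' (r j))" by (intro add_mono A)
        also have "\<dots> \<le> A * m u + A * m u'"
          using \<open>0 < A\<close> by (intro add_mono mult_left_mono m j) auto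
        finally show "norm (fst (x, z(i := u)) k + \<sigma> *v snd (x, z(i := u)) k (T * real j / real N)
            - (fst (x, z(i := u')) k + \<sigma> *v snd (x, z(i := u')) k (T * real j / real N)))
            \<le> (if k = i then A * m u + A * m u' else 0)"
          by (simp add: r_def)
      qed (use \<open>0 < C\<close> in simp)
      then show "\<bar>G (x, z(i := u)) - G (x, z(i := u'))\<bar> \<le> C * A * m u + C * A * m u'"
        using i by (simp add: algebra_simps)
    qed
  qed simp
  have "sub_gaussian (P \<Otimes>\<^sub>M Q) G ((\<Sum>i\<in>{..<n}. Kx) + (\<Sum>i\<in>{..<n}. Kw))"
    using inner outer unfolding H_def
    by (intro sub_gaussian_pair P.prob_space_axioms Q.prob_space_axioms G_PQ)
  then have "sub_gaussian M (\<lambda>\<omega>. G (J \<omega>)) ((\<Sum>i\<in>{..<n}. Kx) + (\<Sum>i\<in>{..<n}. Kw))"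
    unfolding law[symmetric] by (simp add: sub_gaussian_distr_iff[OF J G_E])
  \<comment> \<open>\<open>J\<close> keeps the paths on \<open>[0, T]\<close> only, which contains
    all the grid points sampled at times in \<open>[0, T]\<close>.\<close>
  moreover have "G (J \<omega>) = F (\<lambda>i. step_path T N (\<lambda>t. \<xi> i \<omega> + \<sigma> *v B i t \<omega>))" for \<omega>
    unfolding G_def
  proof (rule lipschitz_bounded_tuples_cong[OF F])
    fix i t assume "i < n" "t \<in> {0..T}"
    then show "step_path T N (\<lambda>t. fst (J \<omega>) i + \<sigma> *v snd (J \<omega>) i t) t = step_path T N (\<lambda>t. \<xi> i \<omega> + \<sigma> *v B i t \<omega>) t"
      using r_in[OF grid_index_le[OF \<open>0 < T\<close>, of t N]] by (simp add: step_path_def J_def r_def)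
  qed (use \<open>0 < T\<close> in \<open>auto intro: step_path_in_bounded_tuples\<close>)
  ultimately show ?thesis by (simp add: Kx_def Kw_def distrib_left)
qed

text \<open>The discretised bound is free of the level, so it survives refinement. Continuity of the
  driving paths gives convergence, and comparison with the zero tuple gives domination.\<close>

lemma sub_gaussian_noise_limit:
  fixes \<xi> :: "nat \<Rightarrow> 'a \<Rightarrow> real ^ 'd::finite" and \<sigma> :: "real ^ 'd ^ 'd"
  assumes noise: "particle_noise T \<mu>0 n \<xi> B" and "n \<ge> 1" "0 < T" "0 < C" "0 < A"
    and F: "lipschitz_bounded_tuples n T C F"
    and A: "\<And>x. norm (\<sigma> *v x) \<le> A * norm x"
    and \<mu>0: "prob_space \<mu>0" "sets \<mu>0 = sets borel" "integrable \<mu>0 (\<lambda>x. norm x)" and "0 \<le> \<kappa>"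
    and transport: "\<And>\<nu>. prob_space \<nu> \<Longrightarrow> sets \<nu> = sets borel \<Longrightarrow> absolutely_continuous \<mu>0 \<nu> \<Longrightarrow>
      wasserstein1 \<mu>0 \<nu> \<le> ennreal_sqrt (2 * ennreal \<kappa> * relative_entropy \<nu> \<mu>0)"
    and g: "g \<in> borel_measurable M"
    and F_eq: "AE \<omega> in M. F (\<lambda>i t. \<xi> i \<omega> + \<sigma> *v B i t \<omega>) = g \<omega>"
  shows "sub_gaussian M g (real n * (\<kappa> * C\<^sup>2 / 2 + 128 * sqrt 2 ^ CARD('d) * T * (C * A)\<^sup>2))"
proof -
  define f where "f = (\<lambda>l \<omega>. F (\<lambda>i. step_path T (2 ^ l) (\<lambda>t. \<xi> i \<omega> + \<sigma> *v B i t \<omega>)))"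
  have wiener: "standard_wiener T (B i)" if "i < n" for i
    using noise that by (simp add: particle_noise_def)
  have "\<forall>i\<in>{..<n}. \<exists>w. integrable M w \<and> (AE \<omega> in M. \<forall>l. \<forall>j\<le>2 ^ l. norm (B i (T * real j / real (2 ^ l)) \<omega>) \<le> w \<omega>)"
  proof
    fix i assume "i \<in> {..<n}"
    then have "standard_wiener T (B i)" by (simp add: wiener)
    from this \<open>0 < T\<close> obtain v where "integrable M v"
      "AE \<omega> in M. \<forall>l. \<forall>j\<le>2 ^ l. norm (B i (T * real j / real (2 ^ l)) \<omega>) \<le> v \<omega>"
      by (rule wiener_dyadic_dominated)
    then show "\<exists>w. integrable M w \<and> (AE \<omega> in M. \<forall>l. \<forall>j\<le>2 ^ l. norm (B i (T * real j / real (2 ^ l)) \<omega>) \<le> w \<omega>)"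
      by (intro exI conjI)
  qed
  from bchoice[OF this] obtain w where w_int: "\<And>i. i < n \<Longrightarrow> integrable M (w i)"
    and w: "\<And>i. i < n \<Longrightarrow> AE \<omega> in M. \<forall>l. \<forall>j\<le>2 ^ l. norm (B i (T * real j / real (2 ^ l)) \<omega>) \<le> w i \<omega>"
    by auto
  have \<xi>_int: "integrable M (\<lambda>\<omega>. norm (\<xi> i \<omega>))" if "i < n" for i
  proof -
    have \<xi>: "\<xi> i \<in> borel_measurable M" and "distr M borel (\<xi> i) = \<mu>0"
      using noise that by (auto simp: particle_noise_def indep_vars_def)
    then show ?thesis using \<mu>0(3) by (auto simp: integrable_distr_eq)
  qed
  show ?thesis
  proof (rule sub_gaussian_limit[where f=f])
    show "sub_gaussian M (f l) (real n * (\<kappa> * C\<^sup>2 / 2 + 128 * sqrt 2 ^ CARD('d) * T * (C * A)\<^sup>2))" for l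
      unfolding f_def
      by (rule sub_gaussian_noise_functional[OF noise \<open>n \<ge> 1\<close> \<open>0 < T\<close> _ \<open>0 < C\<close> \<open>0 < A\<close> F A \<mu>0 \<open>0 \<le> \<kappa>\<close> transport]) simp
    have "AE \<omega> in M. \<forall>i\<in>{..<n}. continuous_on {0..T} (\<lambda>t. B i t \<omega>)"
      using wiener by (intro AE_finite_allI) (auto simp: standard_wiener_def)
    with F_eq show "AE \<omega> in M. (\<lambda>l. f l \<omega>) \<longlonglongrightarrow> g \<omega>"
    proof eventually_elim
      case (elim \<omega>)
      have "(\<lambda>i t. \<xi> i \<omega> + \<sigma> *v B i t \<omega>) \<in> path_tuples n T"
        unfolding path_tuples_def
        using elim(2) by (auto intro!: continuous_on_add continuous_on_const
            bounded_linear.continuous_on[OF matrix_vector_mul_bounded_linear])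
      from lipschitz_step_path_tendsto[OF F \<open>0 < T\<close> less_imp_le[OF \<open>0 < C\<close>] this]
      have lim: "(\<lambda>N. F (\<lambda>i. step_path T N (\<lambda>t. \<xi> i \<omega> + \<sigma> *v B i t \<omega>))) \<longlonglongrightarrow> g \<omega>"
        by (simp only: elim(1))
      have "strict_mono (\<lambda>l. 2 ^ l :: nat)" by (simp add: strict_mono_def)
      from LIMSEQ_subseq_LIMSEQ[OF lim this] show ?case by (simp add: f_def comp_def)
    qed
    show "integrable M (\<lambda>\<omega>. \<bar>F (\<lambda>i t. 0)\<bar> + C * (\<Sum>i<n. norm (\<xi> i \<omega>) + A * w i \<omega>))"
      by (intro Bochner_Integration.integrable_add integrable_const integrable_mult_right
          Bochner_Integration.integrable_sum \<xi>_int w_int) simp_all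
    have "AE \<omega> in M. \<forall>i\<in>{..<n}. \<forall>l. \<forall>j\<le>2 ^ l. norm (B i (T * real j / real (2 ^ l)) \<omega>) \<le> w i \<omega>"
      using w by (intro AE_finite_allI) auto
    then show "AE \<omega> in M. \<bar>f l \<omega>\<bar> \<le> \<bar>F (\<lambda>i t. 0)\<bar> + C * (\<Sum>i<n. norm (\<xi> i \<omega>) + A * w i \<omega>)" for l
    proof eventually_elim
      case (elim \<omega>)
      have "\<bar>f l \<omega> - F (\<lambda>i. step_path T (2 ^ l) (\<lambda>t. 0))\<bar> \<le> C * (\<Sum>i<n. norm (\<xi> i \<omega>) + A * w i \<omega>)"
        unfolding f_def
      proof (rule lipschitz_step_le[OF F \<open>0 < T\<close>])
        fix i j assume ij: "i < n" "j \<le> (2::nat) ^ l"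
        let ?b = "B i (T * real j / real (2 ^ l)) \<omega>"
        have "norm (\<xi> i \<omega> + \<sigma> *v ?b - 0) \<le> norm (\<xi> i \<omega>) + norm (\<sigma> *v ?b)"
          by (simp add: norm_triangle_ineq)
        also have "norm (\<sigma> *v ?b) \<le> A * norm ?b" by (rule A)
        also have "\<dots> \<le> A * w i \<omega>" using elim ij \<open>0 < A\<close> by (intro mult_left_mono) auto
        finally show "norm (\<xi> i \<omega> + \<sigma> *v ?b - 0) \<le> norm (\<xi> i \<omega>) + A * w i \<omega>" by simp
      qed (use \<open>0 < C\<close> in simp)
      \<comment> \<open>The step path of the zero path is again zero, so the reference value is the
        same at every level.\<close>
      then show ?case by (simp add: step_path_def[abs_def])
    qed
  qed (rule g)
qed

end

text \<open>The null sets that are adjoined are already measurable in \<open>M\<close>; hence a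
  process measurable for the filtration consists of random variables on \<open>M\<close>.\<close>

lemma augmented_filtration_subset:
  assumes \<xi>: "\<And>i. i < n \<Longrightarrow> \<xi> i \<in> borel_measurable M"
    and B: "\<And>i s. i < n \<Longrightarrow> s \<in> {0..t} \<Longrightarrow> B i s \<in> borel_measurable M"
  shows "space (augmented_filtration M n \<xi> B t) = space M"
    and "sets (augmented_filtration M n \<xi> B t) \<subseteq> sets M"
proof -
  let ?G = "preimages (space M) {..<n} \<xi> \<union> preimages (space M) ({..<n} \<times> {0..t}) (\<lambda>(i, s). B i s) \<union> null_sets M"
  have "preimages (space M) {..<n} \<xi> \<subseteq> sets M"
    using \<xi> by (intro preimages_subset_sets) auto
  moreover have "preimages (space M) ({..<n} \<times> {0..t}) (\<lambda>(i, s). B i s) \<subseteq> sets M"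
    using B by (intro preimages_subset_sets) auto
  ultimately have sub: "?G \<subseteq> sets M" by auto
  then have "?G \<subseteq> Pow (space M)" using sets.space_closed by blast
  then show "space (augmented_filtration M n \<xi> B t) = space M"
    "sets (augmented_filtration M n \<xi> B t) \<subseteq> sets M"
    unfolding augmented_filtration_def using sets.sigma_sets_subset[OF sub]
    by (simp_all add: space_measure_of_conv sets_measure_of)
qed

text \<open>No sigma-algebra on path space enters: \<open>\<Phi>\<close> is extended to step
  functions, its values along sampled paths are random variables, and they converge pointwise by
  continuity of the paths.\<close>

lemma lipschitz1_functional_measurable:
  fixes X :: "nat \<Rightarrow> real \<Rightarrow> 'a \<Rightarrow> 'b::{real_normed_vector, second_countable_topology}"
  assumes "0 < T" and \<Phi>: "lipschitz1_functional n T \<Phi>"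
    and cont: "\<And>i \<omega>. i < n \<Longrightarrow> \<omega> \<in> space M \<Longrightarrow> continuous_on {0..T} (\<lambda>t. X i t \<omega>)"
    and meas: "\<And>i t. i < n \<Longrightarrow> t \<in> {0..T} \<Longrightarrow> X i t \<in> borel_measurable M"
  shows "(\<lambda>\<omega>. \<Phi> (\<lambda>i t. X i t \<omega>)) \<in> borel_measurable M"
proof -
  have sub: "x \<in> bounded_tuples n T" if "x \<in> path_tuples n T" for x :: "nat \<Rightarrow> real \<Rightarrow> 'b"
    using path_tuples_subset_bounded_tuples that by blast
  obtain F where F: "\<And>x. x \<in> path_tuples n T \<Longrightarrow> F x = \<Phi> x" "lipschitz_bounded_tuples n T 1 F"
  proof (rule lipschitz_extension[of T 1 "path_tuples n T" "\<lambda>x. x" n \<Phi>])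
    show "\<bar>\<Phi> x - \<Phi> y\<bar> \<le> 1 * paths_norm1 n T (\<lambda>i t. x i t - y i t)"
      if "x \<in> path_tuples n T" "y \<in> path_tuples n T" for x y
      using \<Phi> that by (simp add: lipschitz1_functional_def)
  qed (use \<open>0 < T\<close> sub that in auto)
  show ?thesis
  proof (rule borel_measurable_LIMSEQ_real)
    fix \<omega> assume "\<omega> \<in> space M"
    then have X: "(\<lambda>i t. X i t \<omega>) \<in> path_tuples n T" using cont by (simp add: path_tuples_def)
    have "(\<lambda>N. F (\<lambda>i. step_path T N (\<lambda>t. X i t \<omega>))) \<longlonglongrightarrow> \<Phi> (\<lambda>i t. X i t \<omega>)"
      using lipschitz_step_path_tendsto[OF F(2) \<open>0 < T\<close> zero_le_one X] by (simp only: F(1)[OF X])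
    \<comment> \<open>The shift is made because \<open>grid_point_in\<close> asks for a positive
      number of intervals.\<close>
    then show "(\<lambda>N. F (\<lambda>i. step_path T (Suc N) (\<lambda>t. X i t \<omega>))) \<longlonglongrightarrow> \<Phi> (\<lambda>i t. X i t \<omega>)"
      by (rule LIMSEQ_Suc)
  next
    fix N
    show "(\<lambda>\<omega>. F (\<lambda>i. step_path T (Suc N) (\<lambda>t. X i t \<omega>))) \<in> borel_measurable M"
      by (rule lipschitz_step_path_measurable[OF F(2) \<open>0 < T\<close> zero_le_one])
         (intro meas grid_point_in \<open>0 < T\<close>; simp)
  qed
qed

theorem theorem5p5:
  fixes T L \<kappa>0 :: real
    and \<sigma> :: "real ^ 'd ^ 'd::finite"
    and b :: "real \<Rightarrow> real ^ 'd \<Rightarrow> (real ^ 'd) measure \<Rightarrow> real ^ 'd"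
    and \<mu>0 :: "(real ^ 'd) measure"
  assumes T_pos: "0 < T"
    and b_measurable: "(\<lambda>(t, x, m). b t x m) \<in>
      borel_measurable (restrict_space borel {0..T} \<Otimes>\<^sub>M borel \<Otimes>\<^sub>M wasserstein1_borel)"
    and L_nonneg: "0 \<le> L"
    and b_lipschitz: "\<And>t x x' m m'.
      t \<in> {0..T} \<Longrightarrow> m \<in> finite_mean_measures \<Longrightarrow> m' \<in> finite_mean_measures \<Longrightarrow>
      ennreal (norm (b t x m - b t x' m'))
        \<le> ennreal L * (ennreal (norm (x - x')) + wasserstein1 m m')"
    and b_bounded: "bdd_above ((\<lambda>t. norm (b t 0 (return borel 0))) ` {0..T})"
    and mu0_prob: "prob_space \<mu>0"
    and mu0_sets: "sets \<mu>0 = sets borel"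
    and mu0_moment: "integrable \<mu>0 (\<lambda>x. (norm x)\<^sup>2)"
    and kappa0_nonneg: "0 \<le> \<kappa>0"
    and mu0_transport: "\<And>\<nu>. prob_space \<nu> \<Longrightarrow> sets \<nu> = sets borel \<Longrightarrow>
      absolutely_continuous \<mu>0 \<nu> \<Longrightarrow>
      wasserstein1 \<mu>0 \<nu> \<le> ennreal_sqrt (2 * ennreal \<kappa>0 * relative_entropy \<nu> \<mu>0)"
  shows "\<exists>\<delta>>0. \<forall>n\<ge>1. \<forall>(M :: 'w measure) B X.
    prob_space M \<and> prob_space.particle_noise M T \<mu>0 n (\<lambda>i. X i 0) B \<and>
      strong_solution M T \<sigma> b n B X \<longrightarrow>
    (\<forall>a>0. \<forall>\<Phi>. lipschitz1_functional n T \<Phi> \<longrightarrow>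
      measure M {\<omega> \<in> space M.
          \<Phi> (\<lambda>i t. X i t \<omega>) - (\<integral>\<omega>'. \<Phi> (\<lambda>i t. X i t \<omega>') \<partial>M) > a}
        \<le> 2 * exp (- \<delta> * a\<^sup>2 / real n))"
proof -
  \<comment> \<open>\<open>A\<close> is taken positive even when \<open>\<sigma>\<close> vanishes,
    since its square enters a denominator for the path law.\<close>
  obtain A where A: "0 < A" "\<And>x. norm (\<sigma> *v x) \<le> norm x * A"
    using bounded_linear.pos_bounded[OF matrix_vector_mul_bounded_linear[of \<sigma>]] by blast
  have mu0_mean: "integrable \<mu>0 (\<lambda>x. norm x)"
  proof -
    interpret prob_space \<mu>0 by (rule mu0_prob)
    show ?thesis
      by (rule square_integrable_imp_integrable[OF _ mu0_moment]) (simp add: mu0_sets cong: measurable_cong_sets)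
  qed
  define C where "C = 1 + 4 * L * T * exp ((4 * L + 1) * T)"
  \<comment> \<open>One initial state and one Wiener path contribute one summand each. Neither
    involves \<open>n\<close>, and therefore \<open>1 / (4 * K)\<close> does not.\<close>
  define K where "K = \<kappa>0 * C\<^sup>2 / 2 + 128 * sqrt 2 ^ CARD('d) * T * (C * A)\<^sup>2"
  have C: "0 < C" using T_pos L_nonneg by (simp add: C_def add_pos_nonneg)
  have "0 < 128 * sqrt 2 ^ CARD('d) * T * (C * A)\<^sup>2" using T_pos C A(1) by simp
  moreover have "0 \<le> \<kappa>0 * C\<^sup>2 / 2" using kappa0_nonneg by simp
  ultimately have K: "0 < K" unfolding K_def by linarith
  have main: "measure M {\<omega> \<in> space M.
          \<Phi> (\<lambda>i t. X i t \<omega>) - (\<integral>\<omega>'. \<Phi> (\<lambda>i t. X i t \<omega>') \<partial>M) > a}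
        \<le> 2 * exp (- (1 / (4 * K)) * a\<^sup>2 / real n)"
    if "n \<ge> 1" and M: "prob_space M" and noise: "prob_space.particle_noise M T \<mu>0 n (\<lambda>i. X i 0) B"
      and sol: "strong_solution M T \<sigma> b n B X" and "a > 0" and \<Phi>: "lipschitz1_functional n T \<Phi>"
    for n :: nat and M :: "'w measure" and B X a \<Phi>
  proof -
    interpret prob_space M by (rule M)
    define Z where "Z = (\<lambda>\<omega> i t. X i 0 \<omega> + \<sigma> *v B i t \<omega>)"
    define g where "g = (\<lambda>\<omega>. \<Phi> (\<lambda>i t. X i t \<omega>))"
    define drift where "drift = (\<lambda>i \<omega> s. b s (X i s \<omega>) (empirical_measure n (\<lambda>j. X j s \<omega>)))"
    \<comment> \<open>Exceptional sets are removed for all particles at once, so that any two points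
      of \<open>\<Omega>\<close> can be compared by the deterministic stability estimate.\<close>
    define \<Omega> where "\<Omega> = {\<omega> \<in> space M. \<forall>i\<in>{..<n}. continuous_on {0..T} (\<lambda>t. B i t \<omega>) \<and>
      set_integrable lborel {0..T} (drift i \<omega>) \<and>
      (\<forall>t\<in>{0..T}. X i t \<omega> = X i 0 \<omega> + (LINT s:{0..t}|lborel. drift i \<omega> s) + \<sigma> *v B i t \<omega>)}"
    have wiener: "standard_wiener T (B i)" if "i < n" for i
      using noise that by (simp add: particle_noise_def)
    have X0: "X i 0 \<in> borel_measurable M" if "i < n" for i
      using noise that by (auto simp: particle_noise_def indep_vars_def)
    have B_meas: "B i s \<in> borel_measurable M" if "i < n" "s \<in> {0..T}" for i s
      using wiener[OF that(1)] that(2) by (simp add: standard_wiener_def)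
    have X_cont: "continuous_on {0..T} (\<lambda>t. X i t \<omega>)" if "i < n" "\<omega> \<in> space M" for i \<omega>
      using sol that by (simp add: strong_solution_def)
    have X_meas: "X i t \<in> borel_measurable M" if "i < n" "t \<in> {0..T}" for i t
    proof -
      have "X i t \<in> borel_measurable (augmented_filtration M n (\<lambda>j. X j 0) B t)"
        using sol that by (simp add: strong_solution_def)
      moreover have "space (augmented_filtration M n (\<lambda>j. X j 0) B t) = space M"
        "sets (augmented_filtration M n (\<lambda>j. X j 0) B t) \<subseteq> sets M"
        using that by (intro augmented_filtration_subset X0 B_meas; simp)+
      ultimately show ?thesis by (auto simp: measurable_def)
    qed
    have g_meas: "g \<in> borel_measurable M"
      unfolding g_def by (rule lipschitz1_functional_measurable[OF T_pos \<Phi> X_cont X_meas])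
    have \<Omega>_ae: "AE \<omega> in M. \<omega> \<in> \<Omega>"
    proof -
      have "AE \<omega> in M. \<forall>i\<in>{..<n}. continuous_on {0..T} (\<lambda>t. B i t \<omega>) \<and>
          set_integrable lborel {0..T} (drift i \<omega>) \<and>
          (\<forall>t\<in>{0..T}. X i t \<omega> = X i 0 \<omega> + (LINT s:{0..t}|lborel. drift i \<omega> s) + \<sigma> *v B i t \<omega>)"
      proof (rule AE_finite_allI)
        fix i assume "i \<in> {..<n}"
        then have i: "i < n" by simp
        have "AE \<omega> in M. continuous_on {0..T} (\<lambda>t. B i t \<omega>)"
          using wiener[OF i] by (simp add: standard_wiener_def)
        moreover have "\<forall>i<n. AE \<omega> in M. set_integrable lborel {0..T} (drift i \<omega>) \<and>
            (\<forall>t\<in>{0..T}. X i t \<omega> = X i 0 \<omega> + (LINT s:{0..t}|lborel. drift i \<omega> s) + \<sigma> *v B i t \<omega>)"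
          using sol unfolding strong_solution_def drift_def by (elim conjE)
        then have "AE \<omega> in M. set_integrable lborel {0..T} (drift i \<omega>) \<and>
            (\<forall>t\<in>{0..T}. X i t \<omega> = X i 0 \<omega> + (LINT s:{0..t}|lborel. drift i \<omega> s) + \<sigma> *v B i t \<omega>)"
          using i by (elim allE[where x=i] impE)
        ultimately show "AE \<omega> in M. continuous_on {0..T} (\<lambda>t. B i t \<omega>) \<and>
            set_integrable lborel {0..T} (drift i \<omega>) \<and>
            (\<forall>t\<in>{0..T}. X i t \<omega> = X i 0 \<omega> + (LINT s:{0..t}|lborel. drift i \<omega> s) + \<sigma> *v B i t \<omega>)"
          by (rule AE_conjI)
      qed simp
      then show ?thesis using AE_space unfolding \<Omega>_def by eventually_elim (intro CollectI conjI)
    qed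
    have \<Omega>_space: "\<omega> \<in> space M" if "\<omega> \<in> \<Omega>" for \<omega>
      using that unfolding \<Omega>_def by blast
    have \<Omega>D: "continuous_on {0..T} (\<lambda>t. B i t \<omega>)" "set_integrable lborel {0..T} (drift i \<omega>)"
      if "\<omega> \<in> \<Omega>" "i < n" for \<omega> i
      using that unfolding \<Omega>_def by blast+
    have \<Omega>_eq: "X i t \<omega> = X i 0 \<omega> + (LINT s:{0..t}|lborel. drift i \<omega> s) + \<sigma> *v B i t \<omega>"
      if "\<omega> \<in> \<Omega>" "i < n" "t \<in> {0..T}" for \<omega> i t
      using that unfolding \<Omega>_def by blast
    have Z_path: "Z \<omega> \<in> path_tuples n T" if "\<omega> \<in> \<Omega>" for \<omega>
      using \<Omega>D(1)[OF that] unfolding Z_def path_tuples_def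
      by (auto intro!: continuous_on_add continuous_on_const
          bounded_linear.continuous_on[OF matrix_vector_mul_bounded_linear])
    have X_path: "(\<lambda>i t. X i t \<omega>) \<in> path_tuples n T" if "\<omega> \<in> \<Omega>" for \<omega>
      using X_cont \<Omega>_space[OF that] by (simp add: path_tuples_def)
    have Z_bdd: "Z \<omega> \<in> bounded_tuples n T" if "\<omega> \<in> \<Omega>" for \<omega>
      using Z_path[OF that] path_tuples_subset_bounded_tuples by blast
    have g_lip: "\<bar>g \<omega> - g \<omega>'\<bar> \<le> C * paths_norm1 n T (\<lambda>i t. Z \<omega> i t - Z \<omega>' i t)"
      if \<omega>: "\<omega> \<in> \<Omega>" "\<omega>' \<in> \<Omega>" for \<omega> \<omega>'
    proof -
      have "\<bar>g \<omega> - g \<omega>'\<bar> \<le> paths_norm1 n T (\<lambda>i t. X i t \<omega> - X i t \<omega>')"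
        using \<Phi> X_path[OF \<omega>(1)] X_path[OF \<omega>(2)] unfolding g_def lipschitz1_functional_def by blast
      also have "\<dots> \<le> C * paths_norm1 n T (\<lambda>i t. Z \<omega> i t - Z \<omega>' i t)"
        unfolding C_def
      proof (rule particle_system_stability[OF T_pos L_nonneg \<open>n \<ge> 1\<close> b_lipschitz])
        show "X i t \<omega> = Z \<omega> i t + (LINT s:{0..t}|lborel. b s (X i s \<omega>) (empirical_measure n (\<lambda>j. X j s \<omega>)))"
          if "i < n" "t \<in> {0..T}" for i t
          using \<Omega>_eq[OF \<omega>(1) that] unfolding Z_def drift_def by (simp only: ac_simps)
        show "X i t \<omega>' = Z \<omega>' i t + (LINT s:{0..t}|lborel. b s (X i s \<omega>') (empirical_measure n (\<lambda>j. X j s \<omega>')))"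
          if "i < n" "t \<in> {0..T}" for i t
          using \<Omega>_eq[OF \<omega>(2) that] unfolding Z_def drift_def by (simp only: ac_simps)
        show "set_integrable lborel {0..T} (\<lambda>s. b s (X i s \<omega>) (empirical_measure n (\<lambda>j. X j s \<omega>)))" if "i < n" for i
          using \<Omega>D(2)[OF \<omega>(1) that] unfolding drift_def .
        show "set_integrable lborel {0..T} (\<lambda>s. b s (X i s \<omega>') (empirical_measure n (\<lambda>j. X j s \<omega>')))" if "i < n" for i
          using \<Omega>D(2)[OF \<omega>(2) that] unfolding drift_def .
      qed (use \<omega> in \<open>auto intro: X_path Z_bdd\<close>)
      finally show ?thesis .
    qed
    \<comment> \<open>On \<open>\<Omega>\<close> the bound \<open>g_lip\<close> makes
      \<open>g\<close> a Lipschitz function of the driving paths \<open>Z\<close>; its extension can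
      be evaluated along step functions.\<close>
    obtain F where F: "\<And>\<omega>. \<omega> \<in> \<Omega> \<Longrightarrow> F (Z \<omega>) = g \<omega>" "lipschitz_bounded_tuples n T C F"
      by (rule lipschitz_extension[of T C \<Omega> Z n g])
         (use T_pos C Z_bdd g_lip in auto)
    have "sub_gaussian M g (real n * K)"
      unfolding K_def
    proof (rule sub_gaussian_noise_limit[OF noise \<open>n \<ge> 1\<close> T_pos C A(1) F(2) _ mu0_prob mu0_sets mu0_mean
          kappa0_nonneg mu0_transport g_meas])
      show "norm (\<sigma> *v x) \<le> A * norm x" for x using A(2)[of x] by (simp add: mult.commute)
      show "AE \<omega> in M. F (\<lambda>i t. X i 0 \<omega> + \<sigma> *v B i t \<omega>) = g \<omega>"
        using \<Omega>_ae by eventually_elim (simp add: F(1)[symmetric] Z_def)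
    qed
    then have "measure M {\<omega> \<in> space M. g \<omega> - (\<integral>\<omega>'. g \<omega>' \<partial>M) > a} \<le> exp (- a\<^sup>2 / (4 * (real n * K)))"
      using K \<open>n \<ge> 1\<close> \<open>a > 0\<close> by (intro sub_gaussian_tail) auto
    also have "\<dots> \<le> 2 * exp (- a\<^sup>2 / (4 * (real n * K)))" by simp
    also have "- a\<^sup>2 / (4 * (real n * K)) = - (1 / (4 * K)) * a\<^sup>2 / real n" by simp
    finally show ?thesis by (simp add: g_def)
  qed
  show ?thesis
  proof (rule exI[of _ "1 / (4 * K)"], intro conjI allI impI)
    show "0 < 1 / (4 * K)" using K by simp
  qed (elim conjE, rule main)
qed

end
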